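(* For each integer $n\geq 1$ there exist two sequences $(\lambda_N)$, $(\mu_N)$ of irreducible representations of $\mathrm{GL}(n)$ (respectively, of $\mathrm{SL}(n)$) which tend to infinity, with the property that the inequality $$\frac{c_{\lambda,\mu}^{\nu}\,d_\nu}{d_\lambda\,d_\mu}\leq C_n\left(\frac{1}{\lambda_1-\lambda_n}+\frac{1}{\mu_1-\mu_n}\right)$$ for irreducible representations $\lambda,\mu,\nu$ of $\mathrm{GL}(n)$ (respectively, the inequality $$\frac{d_\nu}{d_\lambda\,d_\mu}\leq C_n\left(\frac{1}{\lambda_1}+\frac{1}{\mu_1}\right)$$ for irreducible representations $\lambda,\mu,\nu$ of $\mathrm{SL}(n)$ such that $\nu$ contributes with multiplicity at least $1$ to the decomposition of $\lambda\otimes\mu$ into irreducible components), taken with $\lambda=\lambda_N$ and $\mu=\mu_N$, is saturated up to a multiplicative constant that depends only on $n$ and not on $N$.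
   Context: $\mathrm{GL}(n)=\mathrm{GL}(n,\mathbb{C})$ and $\mathrm{SL}(n)=\mathrm{SL}(n,\mathbb{C})$. Irreducible representations of $\mathrm{GL}(n)$ are identified with their highest weights $\lambda=(\lambda_1\geq\cdots\geq\lambda_n)\in\mathbb{Z}^n$; irreducible representations of $\mathrm{SL}(n)$ are parametrized, via restriction from $\mathrm{GL}(n)$, by those weights whose last component $\lambda_n$ is equal to zero. In the inequalities, $\lambda_i$ and $\mu_i$ denote the $i$-th components of the weights $\lambda$ and $\mu$. $d_\rho$ is the dimension of the irreducible representation $\rho$, and $c_{\lambda,\mu}^{\nu}$ is the Littlewood-Richardson coefficient, i.e. the multiplicity of $\nu$ in the Kronecker tensor product $\lambda\otimes\mu$ (the tensor product with the diagonal action of the group). $C_n$ is a constant depending only on $n$ for which the respective inequality holds for all such $\lambda,\mu,\nu$. That the inequality is saturated up to a multiplicative constant means that, for each $N$, there is an admissible $\nu$ for which the left-hand side is at least a positive constant, depending only on $n$, times the right-hand side.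
   Formalization: The SL(n) claim is stated only for n ≥ 2, since SL(1) has a single irreducible representation and no sequence can tend to infinity; for GL(1), where λ_1−λ_n = 0 makes the bound undefined, 1/0 is read as 0. *)

theory Defs
  imports Complex_Main "Jordan_Normal_Form.VS_Connect"
begin

definition GL :: "nat \<Rightarrow> complex mat set" where
  "GL n = {A \<in> carrier_mat n n. invertible_mat A}"

definition SL :: "nat \<Rightarrow> complex mat set" where
  "SL n = {A \<in> carrier_mat n n. det A = 1}"

(* The coordinate ring of the algebraic group GL(n): polynomials in the matrix entries and 1/det.
   Its restriction to SL n is the coordinate ring of SL(n). *)
inductive_set regular_funs :: "nat \<Rightarrow> (complex mat \<Rightarrow> complex) set" for n :: nat where
  const: "(\<lambda>A. c) \<in> regular_funs n"
| entry: "i < n \<Longrightarrow> j < n \<Longrightarrow> (\<lambda>A. A $$ (i, j)) \<in> regular_funs n"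
| inv_det: "(\<lambda>A. 1 / det A) \<in> regular_funs n"
| add: "f \<in> regular_funs n \<Longrightarrow> g \<in> regular_funs n \<Longrightarrow> (\<lambda>A. f A + g A) \<in> regular_funs n"
| mult: "f \<in> regular_funs n \<Longrightarrow> g \<in> regular_funs n \<Longrightarrow> (\<lambda>A. f A * g A) \<in> regular_funs n"

(* A representation in matrix form, on the space carrier_vec (deg V). Only the values of act V on
   the group under consideration matter, so restricting to a subgroup does not change the record. *)
record rep =
  deg :: nat
  act :: "complex mat \<Rightarrow> complex mat"

definition is_rep :: "nat \<Rightarrow> complex mat set \<Rightarrow> rep \<Rightarrow> bool" where
  "is_rep n G V \<longleftrightarrow>
     (\<forall>g\<in>G. act V g \<in> carrier_mat (deg V) (deg V)) \<and>
     act V (1\<^sub>m n) = 1\<^sub>m (deg V) \<and>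
     (\<forall>g\<in>G. \<forall>h\<in>G. act V (g * h) = act V g * act V h) \<and>
     (\<forall>i<deg V. \<forall>j<deg V. \<exists>f\<in>regular_funs n. \<forall>g\<in>G. act V g $$ (i, j) = f g)"

definition irreducible_rep :: "nat \<Rightarrow> complex mat set \<Rightarrow> rep \<Rightarrow> bool" where
  "irreducible_rep n G V \<longleftrightarrow>
     is_rep n G V \<and> deg V > 0 \<and>
     (\<forall>W. VectorSpace.subspace class_ring W (module_vec TYPE(complex) (deg V)) \<longrightarrow>
          (\<forall>g\<in>G. \<forall>w\<in>W. act V g *\<^sub>v w \<in> W) \<longrightarrow>
          W = {0\<^sub>v (deg V)} \<or> W = carrier_vec (deg V))"

definition rep_iso :: "complex mat set \<Rightarrow> rep \<Rightarrow> rep \<Rightarrow> bool" where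
  "rep_iso G V W \<longleftrightarrow>
     deg V = deg W \<and>
     (\<exists>P \<in> carrier_mat (deg V) (deg V). invertible_mat P \<and>
        (\<forall>g\<in>G. P * act V g = act W g * P))"

definition direct_sum_rep :: "rep list \<Rightarrow> rep" where
  "direct_sum_rep Vs =
     \<lparr>deg = sum_list (map deg Vs), act = (\<lambda>g. diag_block_mat (map (\<lambda>V. act V g) Vs))\<rparr>"

(* The basis vector e_i \<otimes> e_j has index i * deg W + j, so that g acts by the Kronecker product
   of act V g and act W g. *)
definition tensor_rep :: "rep \<Rightarrow> rep \<Rightarrow> rep" where
  "tensor_rep V W =
     \<lparr>deg = deg V * deg W,
      act = (\<lambda>g. mat (deg V * deg W) (deg V * deg W)
               (\<lambda>(i, j). act V g $$ (i div deg W, j div deg W) *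
                         act W g $$ (i mod deg W, j mod deg W)))\<rparr>"

(* R decomposes into irreducible components, exactly m of which are isomorphic to U.
   For given G, U and R there is at most one such m, by the Krull-Schmidt theorem. *)
definition has_multiplicity ::
    "nat \<Rightarrow> complex mat set \<Rightarrow> rep \<Rightarrow> rep \<Rightarrow> nat \<Rightarrow> bool" where
  "has_multiplicity n G U R m \<longleftrightarrow>
     (\<exists>Vs. (\<forall>V\<in>set Vs. irreducible_rep n G V) \<and>
           rep_iso G R (direct_sum_rep Vs) \<and>
           m = length (filter (rep_iso G U) Vs))"

(* Weights are integer lists of length n; the first and the last component are hd and last. *)
definition dominant :: "nat \<Rightarrow> int list \<Rightarrow> bool" where
  "dominant n lam \<longleftrightarrow> length lam = n \<and> sorted_wrt (\<ge>) lam"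

(* Highest weight vectors are eigenvectors of the Borel subgroup of upper triangular matrices. *)
definition has_highest_weight :: "nat \<Rightarrow> int list \<Rightarrow> rep \<Rightarrow> bool" where
  "has_highest_weight n lam V \<longleftrightarrow>
     (\<exists>v \<in> carrier_vec (deg V). v \<noteq> 0\<^sub>v (deg V) \<and>
        (\<forall>b \<in> GL n. upper_triangular b \<longrightarrow>
           act V b *\<^sub>v v = (\<Prod>i<n. (b $$ (i, i)) powi (lam ! i)) \<cdot>\<^sub>v v))"

definition gl_irrep :: "nat \<Rightarrow> int list \<Rightarrow> rep \<Rightarrow> bool" where
  "gl_irrep n lam V \<longleftrightarrow>
     dominant n lam \<and> irreducible_rep n (GL n) V \<and> has_highest_weight n lam V"

(* Irreducible representations of SL(n) are labelled via restriction from GL(n), normalised by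
   requiring the last component of the weight to vanish. *)
definition sl_irrep :: "nat \<Rightarrow> int list \<Rightarrow> rep \<Rightarrow> bool" where
  "sl_irrep n lam V \<longleftrightarrow>
     last lam = 0 \<and> irreducible_rep n (SL n) V \<and>
     (\<exists>V'. gl_irrep n lam V' \<and> rep_iso (SL n) V V')"

(* The sequence leaves every finite set of weights. For n \<ge> 2 the gap between the first and the last
   component is also required to be positive and to diverge: otherwise twisting fixed
   representations of GL(n) by powers of the determinant would count as tending to infinity,
   although neither dimensions nor multiplicities change. *)
definition tends_to_infinity :: "nat \<Rightarrow> (nat \<Rightarrow> int list) \<Rightarrow> bool" where
  "tends_to_infinity n lam \<longleftrightarrow>
     filterlim lam cofinite sequentially \<and>
     (n \<ge> 2 \<longrightarrow>
        (\<forall>N. last (lam N) < hd (lam N)) \<and>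
        filterlim (\<lambda>N. hd (lam N) - last (lam N)) at_top sequentially)"

end

theory Submission
  imports Defs "Jordan_Normal_Form.Schur_Decomposition"
begin

text \<open>
  Take \<open>\<lambda> = \<mu> = (M, 0, \<dots>, 0)\<close>. Both representations are then the symmetric power \<open>S\<close> of degree
  \<open>M\<close> of the standard representation. For \<open>n \<ge> 2\<close> the tensor square \<open>S \<otimes> S\<close> has at most \<open>M + 1\<close>
  irreducible components (the two-row case of the Pieri rule), so one of them, \<open>\<nu>\<close> say, has
  dimension at least \<open>d\<^sub>\<lambda> d\<^sub>\<mu> / (M + 1)\<close>. Since \<open>1 / (M + 1) \<ge> 1 / (2 M)\<close> and
  \<open>1 / \<lambda>\<^sub>1 + 1 / \<mu>\<^sub>1 = 2 / M\<close>, this is saturation. For \<open>n = 1\<close> the gap of a weight is \<open>0\<close>, so by the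
  convention \<open>1 / 0 = 0\<close> the right-hand side vanishes.

  Three facts carry the argument.

  Complete reducibility. The algebraic form of the unitarian trick is used: if \<open>act V\<close> turns
  conjugate transposes into conjugate transposes, the orthogonal complement of an invariant
  subspace is invariant. This property passes to subrepresentations in an orthonormal basis and to
  tensor products (\<open>star_rep_sub_rep\<close>, \<open>star_rep_tensor_rep\<close>), so that everything cut out of tensor
  powers splits into irreducible components (\<open>decomposition_exists\<close>).

  Highest weights separate components. Every nonzero invariant subspace contains an eigenvector of
  the group of upper triangular matrices (\<open>highest_weight_vector_exists\<close>). Different summands are
  orthogonal; hence if two eigenvectors of the same weight are never orthogonal, then distinct
  summands have distinct weights, and the components can be counted by counting weights.

  Counting weights. The symmetric power carries a polynomial equivariant map \<open>\<psi>\<close> from the space of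
  column vectors, \<open>x \<mapsto> x \<otimes> \<dots> \<otimes> x\<close>, whose values span it. Pairing with an eigenvector \<open>w\<close> of
  \<open>S \<otimes> S\<close> gives a function \<open>F x y = \<langle>\<psi> x \<otimes> \<psi> y, w\<rangle>\<close> that lower triangular matrices multiply by a
  character. A generic pair of vectors is in the lower triangular orbit of a pair
  \<open>(e\<^sub>0, e\<^sub>1 + s e\<^sub>0)\<close>, so \<open>F\<close>, and with it \<open>w\<close>, is determined by the polynomial
  \<open>s \<mapsto> F e\<^sub>0 (e\<^sub>1 + s e\<^sub>0)\<close> of degree at most \<open>M\<close>. The diagonal matrices force this polynomial to be a
  monomial \<open>c s\<^sup>a\<close> and the weight to be \<open>(M + a, M - a, 0, \<dots>, 0)\<close>
  (\<open>tensor_square_highest_weights\<close>). That leaves \<open>M + 1\<close> weights, all of them dominant. The same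
  argument with one vector in place of two shows that \<open>S\<close> is irreducible.

  For \<open>SL(n)\<close> the same sequence works: on all representations involved the scalar matrices act by
  scalars, so irreducibility survives restriction, and a twist by a power of the determinant makes
  the last component of a weight zero.
\<close>

section \<open>Adjoints and orthogonal complements\<close>

lemma index_mat_adjoint [simp]:
  fixes A :: "complex mat"
  assumes "i < dim_col A" "j < dim_row A"
  shows "mat_adjoint A $$ (i, j) = cnj (A $$ (j, i))"
  using assms unfolding mat_adjoint_def by (simp add: mat_of_rows_index)

lemma dim_mat_adjoint [simp]:
  "dim_row (mat_adjoint A) = dim_col A" "dim_col (mat_adjoint A) = dim_row A"
  unfolding mat_adjoint_def by auto

lemma mat_adjoint_carrier [simp, intro]:
  "A \<in> carrier_mat m n \<Longrightarrow> mat_adjoint A \<in> carrier_mat n m"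
  unfolding carrier_mat_def by simp

lemma mult_mat_vec_carrier_iff [simp]: "A *\<^sub>v v \<in> carrier_vec n \<longleftrightarrow> dim_row A = n"
  by (metis carrier_vecD carrier_vecI dim_mult_mat_vec)

lemma mult_mat_carrier_iff [simp]: "A * B \<in> carrier_mat m n \<longleftrightarrow> dim_row A = m \<and> dim_col B = n"
  by (metis carrier_matD carrier_matI index_mult_mat(2,3))

lemma mult_unit_vec_col:
  fixes A :: "complex mat"
  assumes "A \<in> carrier_mat m n" "j < n"
  shows "A *\<^sub>v unit_vec n j = col A j"
  using assms by (intro eq_vecI) auto

lemma mat_eq_by_vec:
  fixes A B :: "complex mat"
  assumes "A \<in> carrier_mat m n" "B \<in> carrier_mat m n"
    and "\<And>v. v \<in> carrier_vec n \<Longrightarrow> A *\<^sub>v v = B *\<^sub>v v"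
  shows "A = B"
proof (rule eq_matI)
  fix i j assume "i < dim_row B" "j < dim_col B"
  then have ij: "i < m" "j < n" using assms by auto
  have "col A j = col B j"
    using assms(3)[of "unit_vec n j"] assms(1,2) ij by (simp add: mult_unit_vec_col)
  then have "col A j $ i = col B j $ i" by simp
  then show "A $$ (i, j) = B $$ (i, j)" using assms(1,2) ij by simp
qed (use assms in auto)

lemma mat_adjoint_adjoint [simp]: "mat_adjoint (mat_adjoint A) = (A :: complex mat)"
  by (intro eq_matI) auto

lemma mat_adjoint_one [simp]: "mat_adjoint (1\<^sub>m n) = (1\<^sub>m n :: complex mat)"
  by (intro eq_matI) auto

lemma mat_adjoint_zero [simp]: "mat_adjoint (0\<^sub>m m n) = (0\<^sub>m n m :: complex mat)"
  by (intro eq_matI) auto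

lemma mat_adjoint_mult:
  fixes A B :: "complex mat"
  assumes "A \<in> carrier_mat m n" "B \<in> carrier_mat n k"
  shows "mat_adjoint (A * B) = mat_adjoint B * mat_adjoint A"
  using assms by (intro eq_matI) (auto simp: scalar_prod_def mult.commute)

lemma cscalar_adjoint:
  fixes A :: "complex mat"
  assumes "A \<in> carrier_mat m n" "x \<in> carrier_vec n" "y \<in> carrier_vec m"
  shows "(A *\<^sub>v x) \<bullet>c y = x \<bullet>c (mat_adjoint A *\<^sub>v y)"
proof -
  have "(A *\<^sub>v x) \<bullet>c y = (\<Sum>i<m. \<Sum>j<n. A $$ (i, j) * x $ j * cnj (y $ i))"
    using assms by (auto simp: scalar_prod_def atLeast0LessThan sum_distrib_right)
  also have "\<dots> = (\<Sum>j<n. \<Sum>i<m. A $$ (i, j) * x $ j * cnj (y $ i))"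
    by (rule sum.swap)
  also have "\<dots> = x \<bullet>c (mat_adjoint A *\<^sub>v y)"
    using assms by (auto simp: scalar_prod_def atLeast0LessThan sum_distrib_left mult_ac)
  finally show ?thesis .
qed

lemma cscalar_swap:
  fixes x y :: "complex vec"
  assumes "x \<in> carrier_vec n" "y \<in> carrier_vec n"
  shows "x \<bullet>c y = cnj (y \<bullet>c x)"
  using assms by (auto simp: scalar_prod_def mult.commute)

lemma cscalar_add_left:
  fixes x y z :: "complex vec"
  assumes "x \<in> carrier_vec n" "y \<in> carrier_vec n" "z \<in> carrier_vec n"
  shows "(x + y) \<bullet>c z = x \<bullet>c z + y \<bullet>c z"
  using assms by (intro add_scalar_prod_distrib) auto

lemma cscalar_smult_left:
  fixes x y :: "complex vec"
  assumes "x \<in> carrier_vec n" "y \<in> carrier_vec n"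
  shows "(c \<cdot>\<^sub>v x) \<bullet>c y = c * (x \<bullet>c y)"
  using assms by auto

lemma cscalar_add_right:
  fixes x y z :: "complex vec"
  assumes "x \<in> carrier_vec n" "y \<in> carrier_vec n" "z \<in> carrier_vec n"
  shows "x \<bullet>c (y + z) = x \<bullet>c y + x \<bullet>c z"
  using assms by (auto simp: scalar_prod_def algebra_simps sum.distrib)

lemma cscalar_smult_right:
  fixes x y :: "complex vec"
  assumes "x \<in> carrier_vec n" "y \<in> carrier_vec n"
  shows "x \<bullet>c (c \<cdot>\<^sub>v y) = cnj c * (x \<bullet>c y)"
  using assms by (auto simp: scalar_prod_def algebra_simps sum_distrib_left)

lemma cscalar_zero_iff:
  fixes x :: "complex vec"
  assumes "x \<in> carrier_vec n"
  shows "x \<bullet>c x = 0 \<longleftrightarrow> x = 0\<^sub>v n"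
  using conjugate_square_eq_0_vec[OF assms] .

text \<open>
  Subspaces in the sense of the definition of irreducibility are translated once into this elementary
  predicate, with which the arguments about orthogonal complements work.
\<close>

definition lin_subspace :: "nat \<Rightarrow> complex vec set \<Rightarrow> bool" where
  "lin_subspace d W \<longleftrightarrow>
     W \<subseteq> carrier_vec d \<and> 0\<^sub>v d \<in> W \<and>
     (\<forall>u\<in>W. \<forall>v\<in>W. u + v \<in> W) \<and> (\<forall>c. \<forall>v\<in>W. c \<cdot>\<^sub>v v \<in> W)"

lemma subspace_imp_lin_subspace:
  assumes "VectorSpace.subspace class_ring W (module_vec TYPE(complex) d)"
  shows "lin_subspace d W"
proof -
  have "submodule class_ring W (module_vec TYPE(complex) d)"
    using assms by (simp add: VectorSpace.subspace_def)
  then show ?thesis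
    unfolding lin_subspace_def submodule_def by (auto simp: module_vec_simps)
qed

definition orth_compl :: "nat \<Rightarrow> complex vec set \<Rightarrow> complex vec set" where
  "orth_compl d W = {x \<in> carrier_vec d. \<forall>w\<in>W. x \<bullet>c w = 0}"

lemma lin_subspace_orth_compl:
  assumes "W \<subseteq> carrier_vec d"
  shows "lin_subspace d (orth_compl d W)"
  using assms unfolding lin_subspace_def orth_compl_def
  by (auto simp: cscalar_add_left[of _ d] cscalar_smult_left[of _ d] subset_iff)

text \<open>
  The heart of complete reducibility: \<open>\<langle>A x, w\<rangle> = \<langle>x, A\<^sup>* w\<rangle>\<close>.
\<close>

lemma orth_compl_invariant:
  assumes "A \<in> carrier_mat d d" "W \<subseteq> carrier_vec d" "\<forall>w\<in>W. mat_adjoint A *\<^sub>v w \<in> W"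
    and "x \<in> orth_compl d W"
  shows "A *\<^sub>v x \<in> orth_compl d W"
  using assms unfolding orth_compl_def by (auto simp: cscalar_adjoint subset_iff)

text \<open>
  The columns of \<open>Q\<close> are an orthonormal basis of \<open>W\<close>, so that \<open>Q\<close> times its adjoint is the
  orthogonal projection onto \<open>W\<close>.
\<close>

definition isometry_onto :: "nat \<Rightarrow> nat \<Rightarrow> complex mat \<Rightarrow> complex vec set \<Rightarrow> bool" where
  "isometry_onto d k Q W \<longleftrightarrow>
     Q \<in> carrier_mat d k \<and> mat_adjoint Q * Q = 1\<^sub>m k \<and>
     (\<forall>v\<in>carrier_vec k. Q *\<^sub>v v \<in> W) \<and> (\<forall>w\<in>W. Q *\<^sub>v (mat_adjoint Q *\<^sub>v w) = w)"

lemma isometry_dim_le: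
  assumes Q: "Q \<in> carrier_mat d k" and iso: "mat_adjoint Q * Q = (1\<^sub>m k :: complex mat)"
  shows "k \<le> d"
proof (rule ccontr)
  assume "\<not> k \<le> d"
  then have dk: "d < k" by simp
  \<comment> \<open>Padding with zero rows gives a square matrix with a left inverse and a zero row.\<close>
  define M where "M = mat k k (\<lambda>(i, j). if i < d then Q $$ (i, j) else 0)"
  have M: "M \<in> carrier_mat k k" by (simp add: M_def)
  have "mat_adjoint M * M = mat_adjoint Q * Q"
  proof (rule eq_matI)
    fix i j assume ij: "i < dim_row (mat_adjoint Q * Q)" "j < dim_col (mat_adjoint Q * Q)"
    then have ij: "i < k" "j < k" using Q by auto
    have "(mat_adjoint M * M) $$ (i, j) = (\<Sum>l<k. cnj (M $$ (l, i)) * M $$ (l, j))"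
      using M ij by (auto simp: scalar_prod_def atLeast0LessThan)
    also have "\<dots> = (\<Sum>l<d. cnj (Q $$ (l, i)) * Q $$ (l, j))"
      using dk ij by (intro sum.mono_neutral_cong_right) (auto simp: M_def)
    also have "\<dots> = (mat_adjoint Q * Q) $$ (i, j)"
      using Q ij by (auto simp: scalar_prod_def atLeast0LessThan)
    finally show "(mat_adjoint M * M) $$ (i, j) = (mat_adjoint Q * Q) $$ (i, j)" .
  qed (use M Q in auto)
  then have "M * mat_adjoint M = 1\<^sub>m k"
    using mat_mult_left_right_inverse[of "mat_adjoint M" k M] M iso by auto
  moreover have "(M * mat_adjoint M) $$ (d, d) = 0"
    using M dk by (auto simp: scalar_prod_def M_def)
  ultimately show False using dk by simp
qed

lemma isometry_inj:
  assumes "Q \<in> carrier_mat d k" "mat_adjoint Q * Q = (1\<^sub>m k :: complex mat)" "v \<in> carrier_vec k"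
  shows "mat_adjoint Q *\<^sub>v (Q *\<^sub>v v) = v"
proof -
  have "mat_adjoint Q *\<^sub>v (Q *\<^sub>v v) = (mat_adjoint Q * Q) *\<^sub>v v"
    using assms by (intro assoc_mult_mat_vec[symmetric]) auto
  then show ?thesis using assms by simp
qed

text \<open>
  Gram--Schmidt in the form of a maximality argument: an orthonormal system in \<open>W\<close> that is as
  long as possible spans \<open>W\<close>, since otherwise the normalized component of some \<open>w \<in> W\<close>
  orthogonal to the system could be appended.
\<close>

lemma isometry_onto_exists:
  assumes W: "lin_subspace d W"
  shows "\<exists>k Q. isometry_onto d k Q W"
proof -
  define iso where "iso k Q \<longleftrightarrow> Q \<in> carrier_mat d k \<and> mat_adjoint Q * Q = (1\<^sub>m k :: complex mat) \<and>
     (\<forall>v\<in>carrier_vec k. Q *\<^sub>v v \<in> W)" for k Q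
  have Wd: "W \<subseteq> carrier_vec d" and W0: "0\<^sub>v d \<in> W"
    and Wadd: "\<And>u v. u \<in> W \<Longrightarrow> v \<in> W \<Longrightarrow> u + v \<in> W"
    and Wsm: "\<And>c v. v \<in> W \<Longrightarrow> c \<cdot>\<^sub>v v \<in> W"
    using W unfolding lin_subspace_def by auto
  have base: "\<exists>Q. iso 0 Q"
  proof
    show "iso 0 (0\<^sub>m d 0)" unfolding iso_def
    proof (intro conjI ballI)
      fix v :: "complex vec" assume "v \<in> carrier_vec 0"
      then have "0\<^sub>m d 0 *\<^sub>v v = 0\<^sub>v d" by (intro eq_vecI) (auto simp: scalar_prod_def)
      then show "0\<^sub>m d 0 *\<^sub>v v \<in> W" using W0 by simp
    qed (auto intro!: eq_matI)
  qed
  have bound: "k \<le> d" if "\<exists>Q. iso k Q" for k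
    using that isometry_dim_le unfolding iso_def by blast
  obtain k where k: "\<exists>Q. iso k Q" and max: "\<And>m. \<exists>Q. iso m Q \<Longrightarrow> m \<le> k"
    using GreatestI_nat[where P = "\<lambda>k. \<exists>Q. iso k Q", OF base bound]
      Greatest_le_nat[where P = "\<lambda>k. \<exists>Q. iso k Q", OF _ bound] by blast
  obtain Q where Q: "iso k Q" using k by blast
  have not_larger: "\<not> iso (Suc k) Q'" for Q'
    using max[of "Suc k"] by auto
  have Qc: "Q \<in> carrier_mat d k" and QQ: "mat_adjoint Q * Q = 1\<^sub>m k"
    and QW: "\<And>v. v \<in> carrier_vec k \<Longrightarrow> Q *\<^sub>v v \<in> W" using Q unfolding iso_def by auto
  have "Q *\<^sub>v (mat_adjoint Q *\<^sub>v w) = w" if w: "w \<in> W" for w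
  proof (rule ccontr)
    assume ne: "Q *\<^sub>v (mat_adjoint Q *\<^sub>v w) \<noteq> w"
    have wc: "w \<in> carrier_vec d" using w Wd by auto
    define r where "r = w + (- 1) \<cdot>\<^sub>v (Q *\<^sub>v (mat_adjoint Q *\<^sub>v w))"
    have aw: "mat_adjoint Q *\<^sub>v w \<in> carrier_vec k" using Qc wc by auto
    have qaw: "Q *\<^sub>v (mat_adjoint Q *\<^sub>v w) \<in> carrier_vec d" using Qc by auto
    have rW: "r \<in> W" unfolding r_def by (intro Wadd Wsm w QW aw)
    have rc: "r \<in> carrier_vec d" using rW Wd by auto
    have r0: "r \<noteq> 0\<^sub>v d"
    proof
      assume "r = 0\<^sub>v d"
      have "(Q *\<^sub>v (mat_adjoint Q *\<^sub>v w)) $ i = w $ i" if "i < d" for i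
      proof -
        have "r $ i = w $ i - (Q *\<^sub>v (mat_adjoint Q *\<^sub>v w)) $ i"
          unfolding r_def using that wc carrier_vecD[OF qaw]
          by (simp del: index_mult_mat_vec)
        then show ?thesis using \<open>r = 0\<^sub>v d\<close> that by simp
      qed
      then have "Q *\<^sub>v (mat_adjoint Q *\<^sub>v w) = w"
        using carrier_vecD[OF qaw] carrier_vecD[OF wc]
        by (intro eq_vecI) (simp_all del: index_mult_mat_vec)
      with ne show False by simp
    qed
    have "mat_adjoint Q *\<^sub>v r = mat_adjoint Q *\<^sub>v w + (- 1) \<cdot>\<^sub>v (mat_adjoint Q *\<^sub>v (Q *\<^sub>v (mat_adjoint Q *\<^sub>v w)))"
      unfolding r_def using Qc wc qaw
      by (subst mult_add_distrib_mat_vec[of _ k d]) (auto simp: mult_mat_vec[of _ k d])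
    also have "\<dots> = 0\<^sub>v k" using isometry_inj[OF Qc QQ aw] aw
      by (intro eq_vecI) auto
    finally have orth: "mat_adjoint Q *\<^sub>v r = 0\<^sub>v k" .
    have "r \<bullet>c r > 0" using conjugate_square_greater_0_vec[OF rc] r0 by simp
    then have "Re (r \<bullet>c r) > 0" "Im (r \<bullet>c r) = 0" by (simp_all add: less_complex_def)
    then obtain t :: real where t: "t > 0" "r \<bullet>c r = complex_of_real t"
      using complex_eq_iff[of "r \<bullet>c r" "complex_of_real (Re (r \<bullet>c r))"]
      by (metis Im_complex_of_real Re_complex_of_real)
    define u where "u = complex_of_real (1 / sqrt t) \<cdot>\<^sub>v r"
    have uc: "u \<in> carrier_vec d" and uW: "u \<in> W" using rc rW Wsm by (auto simp: u_def)
    have "u \<bullet>c u = complex_of_real (1 / sqrt t) * (complex_of_real (1 / sqrt t) * complex_of_real t)"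
      unfolding u_def using rc t by (simp add: cscalar_smult_left[of _ d] cscalar_smult_right[of _ d])
    also have "\<dots> = complex_of_real ((1 / sqrt t) * ((1 / sqrt t) * t))" by (simp only: of_real_mult)
    also have "(1 / sqrt t) * ((1 / sqrt t) * t) = 1" using t(1) by (simp add: real_div_sqrt)
    finally have uu: "u \<bullet>c u = 1" by simp
    have orthu: "mat_adjoint Q *\<^sub>v u = 0\<^sub>v k" unfolding u_def using Qc rc orth
      by (subst mult_mat_vec[of _ k d]) auto
    have orthu': "(\<Sum>l<d. cnj (Q $$ (l, i)) * u $ l) = 0" if "i < k" for i
    proof -
      have "(mat_adjoint Q *\<^sub>v u) $ i = (\<Sum>l<d. cnj (Q $$ (l, i)) * u $ l)"
        using that Qc uc by (auto simp: scalar_prod_def atLeast0LessThan)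
      then show ?thesis using orthu that by simp
    qed
    define Q' where "Q' = mat d (Suc k) (\<lambda>(i, j). if j < k then Q $$ (i, j) else u $ i)"
    have Q'c: "Q' \<in> carrier_mat d (Suc k)" by (simp add: Q'_def)
    have "mat_adjoint Q' * Q' = 1\<^sub>m (Suc k)"
    proof (rule eq_matI)
      fix i j assume "i < dim_row (1\<^sub>m (Suc k) :: complex mat)" "j < dim_col (1\<^sub>m (Suc k) :: complex mat)"
      then have ij: "i < Suc k" "j < Suc k" by auto
      have e: "(mat_adjoint Q' * Q') $$ (i, j) = (\<Sum>l<d. cnj (Q' $$ (l, i)) * Q' $$ (l, j))"
        using Q'c ij by (auto simp: scalar_prod_def atLeast0LessThan)
      consider "i < k" "j < k" | "i < k" "j = k" | "i = k" "j < k" | "i = k" "j = k"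
        using ij by linarith
      then show "(mat_adjoint Q' * Q') $$ (i, j) = 1\<^sub>m (Suc k) $$ (i, j)"
      proof cases
        case 1
        have "(mat_adjoint Q * Q) $$ (i, j) = (\<Sum>l<d. cnj (Q $$ (l, i)) * Q $$ (l, j))"
          using Qc 1 by (auto simp: scalar_prod_def atLeast0LessThan)
        then show ?thesis using 1 QQ unfolding e by (auto simp: Q'_def)
      next
        case 2
        then show ?thesis using orthu'[of i] unfolding e by (auto simp: Q'_def)
      next
        case 3
        have "(\<Sum>l<d. cnj (u $ l) * Q $$ (l, j)) = cnj (\<Sum>l<d. cnj (Q $$ (l, j)) * u $ l)"
          by (simp add: mult.commute)
        then show ?thesis using 3 orthu'[of j] unfolding e by (auto simp: Q'_def)
      next
        case 4
        have "u \<bullet>c u = (\<Sum>l<d. cnj (u $ l) * u $ l)"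
          using uc by (auto simp: scalar_prod_def atLeast0LessThan mult.commute)
        then show ?thesis using 4 uu unfolding e by (auto simp: Q'_def)
      qed
    qed (use Q'c in auto)
    moreover have "Q' *\<^sub>v v \<in> W" if v: "v \<in> carrier_vec (Suc k)" for v
    proof -
      define v0 where "v0 = vec k (\<lambda>i. v $ i)"
      have "Q' *\<^sub>v v = Q *\<^sub>v v0 + (v $ k) \<cdot>\<^sub>v u"
        using v Qc Q'c uc
        by (intro eq_vecI) (auto simp: scalar_prod_def Q'_def v0_def)
      then show ?thesis using QW[of v0] uW by (auto simp: v0_def intro!: Wadd Wsm)
    qed
    ultimately have "iso (Suc k) Q'" unfolding iso_def using Q'c by auto
    with not_larger show False by blast
  qed
  then have "isometry_onto d k Q W" unfolding isometry_onto_def using Qc QQ QW by blast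
  then show ?thesis by blast
qed

lemma isometry_onto_orthogonal:
  assumes Q: "isometry_onto d k Q W" and Q': "isometry_onto d k' Q' (orth_compl d W)"
  shows "mat_adjoint Q * Q' = 0\<^sub>m k k'" "mat_adjoint Q' * Q = 0\<^sub>m k' k"
proof -
  have c: "Q \<in> carrier_mat d k" "Q' \<in> carrier_mat d k'"
    using Q Q' by (auto simp: isometry_onto_def)
  show 1: "mat_adjoint Q * Q' = 0\<^sub>m k k'"
  proof (rule eq_matI)
    fix i j assume "i < dim_row (0\<^sub>m k k' :: complex mat)" "j < dim_col (0\<^sub>m k k' :: complex mat)"
    then have ij: "i < k" "j < k'" by auto
    have "Q' *\<^sub>v unit_vec k' j \<in> orth_compl d W" "Q *\<^sub>v unit_vec k i \<in> W"
      using Q Q' by (auto simp: isometry_onto_def)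
    then have "(Q' *\<^sub>v unit_vec k' j) \<bullet>c (Q *\<^sub>v unit_vec k i) = 0" by (simp add: orth_compl_def)
    moreover have "Q' *\<^sub>v unit_vec k' j = col Q' j" "Q *\<^sub>v unit_vec k i = col Q i"
      using c ij by (auto intro!: mult_unit_vec_col)
    ultimately have "col Q' j \<bullet>c col Q i = 0" by simp
    then show "(mat_adjoint Q * Q') $$ (i, j) = 0\<^sub>m k k' $$ (i, j)"
      using c ij by (auto simp: scalar_prod_def mult.commute)
  qed (use c in auto)
  have "mat_adjoint (mat_adjoint Q * Q') = mat_adjoint Q' * Q"
    using c by (subst mat_adjoint_mult[of _ k d]) auto
  then show "mat_adjoint Q' * Q = 0\<^sub>m k' k" unfolding 1 by (metis mat_adjoint_zero)
qed

text \<open>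
  An orthonormal basis of \<open>W\<close> and one of its orthogonal complement make up one of the whole space.
\<close>

lemma isometry_onto_complete:
  assumes Q: "isometry_onto d k Q W" and Q': "isometry_onto d k' Q' (orth_compl d W)"
    and W: "W \<subseteq> carrier_vec d"
  shows "Q * mat_adjoint Q + Q' * mat_adjoint Q' = 1\<^sub>m d"
proof -
  have c: "Q \<in> carrier_mat d k" "Q' \<in> carrier_mat d k'" and QQ: "mat_adjoint Q * Q = 1\<^sub>m k"
    and QW: "\<And>v. v \<in> carrier_vec k \<Longrightarrow> Q *\<^sub>v v \<in> W" and WQ: "\<And>w. w \<in> W \<Longrightarrow> Q *\<^sub>v (mat_adjoint Q *\<^sub>v w) = w"
    and WQ': "\<And>w. w \<in> orth_compl d W \<Longrightarrow> Q' *\<^sub>v (mat_adjoint Q' *\<^sub>v w) = w"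
    using Q Q' by (auto simp: isometry_onto_def)
  have apply_x: "(Q * mat_adjoint Q + Q' * mat_adjoint Q') *\<^sub>v x = x" if x: "x \<in> carrier_vec d" for x
  proof -
    define q where "q = Q *\<^sub>v (mat_adjoint Q *\<^sub>v x)"
    define y where "y = x + (- 1) \<cdot>\<^sub>v q"
    have qc: "q \<in> carrier_vec d" and yc: "y \<in> carrier_vec d" using c x by (auto simp: q_def y_def)
    have xqy: "x = q + y" unfolding y_def using x qc by (intro eq_vecI) simp_all
    have "mat_adjoint Q *\<^sub>v q = mat_adjoint Q *\<^sub>v x"
      unfolding q_def using c x QQ by (intro isometry_inj) auto
    then have Qy: "mat_adjoint Q *\<^sub>v y = 0\<^sub>v k" unfolding y_def using c x qc
      by (subst mult_add_distrib_mat_vec[of _ k d]) (auto simp: mult_mat_vec[of _ k d])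
    have yo: "y \<in> orth_compl d W" unfolding orth_compl_def
    proof (intro CollectI conjI ballI yc)
      fix w assume w: "w \<in> W"
      then have wc: "w \<in> carrier_vec d" using W by auto
      have "w \<bullet>c y = (Q *\<^sub>v (mat_adjoint Q *\<^sub>v w)) \<bullet>c y" using WQ[OF w] by simp
      also have "\<dots> = (mat_adjoint Q *\<^sub>v w) \<bullet>c (mat_adjoint Q *\<^sub>v y)"
        using c wc yc by (intro cscalar_adjoint) auto
      also have "\<dots> = 0" unfolding Qy using c wc by simp
      finally show "y \<bullet>c w = 0" using cscalar_swap[OF yc wc] by simp
    qed
    have "mat_adjoint Q' *\<^sub>v q = (mat_adjoint Q' * Q) *\<^sub>v (mat_adjoint Q *\<^sub>v x)"
      unfolding q_def using c x by (intro assoc_mult_mat_vec[symmetric]) auto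
    then have Q'q: "mat_adjoint Q' *\<^sub>v q = 0\<^sub>v k'"
      using isometry_onto_orthogonal(2)[OF Q Q'] c x by auto
    have "mat_adjoint Q' *\<^sub>v x = mat_adjoint Q' *\<^sub>v y"
      unfolding xqy using c qc yc Q'q by (subst mult_add_distrib_mat_vec[of _ k' d]) auto
    then have "Q' *\<^sub>v (mat_adjoint Q' *\<^sub>v x) = y" using WQ'[OF yo] by simp
    then have "Q *\<^sub>v (mat_adjoint Q *\<^sub>v x) + Q' *\<^sub>v (mat_adjoint Q' *\<^sub>v x) = x"
      by (simp only: q_def[symmetric] xqy[symmetric])
    moreover have "(Q * mat_adjoint Q + Q' * mat_adjoint Q') *\<^sub>v x =
        (Q * mat_adjoint Q) *\<^sub>v x + (Q' * mat_adjoint Q') *\<^sub>v x"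
      using c x by (intro add_mult_distrib_mat_vec[of _ d d]) auto
    moreover have "(Q * mat_adjoint Q) *\<^sub>v x = Q *\<^sub>v (mat_adjoint Q *\<^sub>v x)"
      "(Q' * mat_adjoint Q') *\<^sub>v x = Q' *\<^sub>v (mat_adjoint Q' *\<^sub>v x)"
      using c x by (intro assoc_mult_mat_vec; auto)+
    ultimately show ?thesis by simp
  qed
  show ?thesis by (rule mat_eq_by_vec[of _ d d]) (use c apply_x in auto)
qed

section \<open>Kronecker products\<close>

text \<open>
  The indexing convention is that of \<^const>\<open>tensor_rep\<close>.
\<close>

definition kron :: "complex mat \<Rightarrow> complex mat \<Rightarrow> complex mat" where
  "kron A B = mat (dim_row A * dim_row B) (dim_col A * dim_col B)
     (\<lambda>(i, j). A $$ (i div dim_row B, j div dim_col B) * B $$ (i mod dim_row B, j mod dim_col B))"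

definition kron_vec :: "complex vec \<Rightarrow> complex vec \<Rightarrow> complex vec" where
  "kron_vec x y = vec (dim_vec x * dim_vec y) (\<lambda>i. x $ (i div dim_vec y) * y $ (i mod dim_vec y))"

lemma div_mod_less_mult:
  fixes i a b :: nat
  assumes "i < a * b"
  shows "i div b < a" "i mod b < b"
proof -
  have "b > 0" using assms by (cases b) auto
  then show "i div b < a" "i mod b < b"
    using assms by (simp_all add: less_mult_imp_div_less)
qed

text \<open>
  Division with remainder by \<open>b\<close> identifies the index range of a Kronecker product with pairs of
  indices.
\<close>

lemma sum_div_mod:
  fixes f :: "nat \<Rightarrow> nat \<Rightarrow> 'a :: comm_monoid_add"
  shows "(\<Sum>k<a * b. f (k div b) (k mod b)) = (\<Sum>i<a. \<Sum>j<b. f i j)"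
proof -
  have "(\<Sum>k<a * b. f (k div b) (k mod b)) = (\<Sum>i<a. \<Sum>k=i * b..<i * b + b. f (k div b) (k mod b))"
    by (rule sum.nat_group[symmetric])
  also have "\<dots> = (\<Sum>i<a. \<Sum>j<b. f i j)"
  proof (rule sum.cong[OF refl])
    fix i
    have "(\<Sum>k=i * b..<i * b + b. f (k div b) (k mod b)) =
        (\<Sum>j=0..<b. f ((j + i * b) div b) ((j + i * b) mod b))"
      using sum.shift_bounds_nat_ivl[of "\<lambda>k. f (k div b) (k mod b)" 0 "i * b" b] by (simp add: add.commute)
    also have "\<dots> = (\<Sum>j<b. f i j)"
      by (intro sum.cong) auto
    finally show "(\<Sum>k=i * b..<i * b + b. f (k div b) (k mod b)) = (\<Sum>j<b. f i j)" .
  qed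
  finally show ?thesis .
qed

lemma kron_carrier [simp, intro]:
  "A \<in> carrier_mat m n \<Longrightarrow> B \<in> carrier_mat m' n' \<Longrightarrow> kron A B \<in> carrier_mat (m * m') (n * n')"
  by (auto simp: kron_def)

lemma dim_kron [simp]:
  "dim_row (kron A B) = dim_row A * dim_row B" "dim_col (kron A B) = dim_col A * dim_col B"
  by (auto simp: kron_def)

lemma kron_vec_carrier [simp, intro]:
  "x \<in> carrier_vec m \<Longrightarrow> y \<in> carrier_vec n \<Longrightarrow> kron_vec x y \<in> carrier_vec (m * n)"
  by (auto simp: kron_vec_def)

lemma index_kron:
  assumes "A \<in> carrier_mat m n" "B \<in> carrier_mat m' n'" "i < m * m'" "j < n * n'"
  shows "kron A B $$ (i, j) = A $$ (i div m', j div n') * B $$ (i mod m', j mod n')"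
  using assms by (auto simp: kron_def)

lemma index_kron_vec:
  assumes "x \<in> carrier_vec m" "y \<in> carrier_vec n" "i < m * n"
  shows "kron_vec x y $ i = x $ (i div n) * y $ (i mod n)"
  using assms by (auto simp: kron_vec_def)

lemma kron_mult:
  assumes A: "A \<in> carrier_mat m n" and C: "C \<in> carrier_mat n p"
    and B: "B \<in> carrier_mat m' n'" and D: "D \<in> carrier_mat n' p'"
  shows "kron A B * kron C D = kron (A * C) (B * D)"
proof (rule eq_matI)
  fix i j assume "i < dim_row (kron (A * C) (B * D))" "j < dim_col (kron (A * C) (B * D))"
  then have ij: "i < m * m'" "j < p * p'" using A B C D by auto
  note ij' = div_mod_less_mult[OF ij(1)] div_mod_less_mult[OF ij(2)]
  have "(kron A B * kron C D) $$ (i, j) = (\<Sum>k<n * n'. kron A B $$ (i, k) * kron C D $$ (k, j))"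
    using A B C D ij by (auto simp: scalar_prod_def atLeast0LessThan)
  also have "\<dots> = (\<Sum>k<n * n'. (A $$ (i div m', k div n') * C $$ (k div n', j div p')) *
      (B $$ (i mod m', k mod n') * D $$ (k mod n', j mod p')))"
    using ij by (intro sum.cong) (auto simp: index_kron[OF A B] index_kron[OF C D])
  also have "\<dots> = (\<Sum>k<n. \<Sum>l<n'. (A $$ (i div m', k) * C $$ (k, j div p')) *
      (B $$ (i mod m', l) * D $$ (l, j mod p')))"
    by (rule sum_div_mod)
  also have "\<dots> = (\<Sum>k<n. A $$ (i div m', k) * C $$ (k, j div p')) *
      (\<Sum>l<n'. B $$ (i mod m', l) * D $$ (l, j mod p'))"
    by (simp add: sum_product)
  also have "\<dots> = (A * C) $$ (i div m', j div p') * (B * D) $$ (i mod m', j mod p')"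
    using A B C D ij' by (auto simp: scalar_prod_def atLeast0LessThan)
  also have "\<dots> = kron (A * C) (B * D) $$ (i, j)"
    using A B C D ij by (subst index_kron[of _ m p _ m' p']) auto
  finally show "(kron A B * kron C D) $$ (i, j) = kron (A * C) (B * D) $$ (i, j)" .
qed (use A B C D in auto)

lemma kron_mult_vec:
  assumes A: "A \<in> carrier_mat m n" and B: "B \<in> carrier_mat m' n'"
    and x: "x \<in> carrier_vec n" and y: "y \<in> carrier_vec n'"
  shows "kron A B *\<^sub>v kron_vec x y = kron_vec (A *\<^sub>v x) (B *\<^sub>v y)"
proof (rule eq_vecI)
  fix i assume "i < dim_vec (kron_vec (A *\<^sub>v x) (B *\<^sub>v y))"
  then have i: "i < m * m'" using A B by (auto simp: kron_vec_def)
  note i' = div_mod_less_mult[OF i]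
  have "(kron A B *\<^sub>v kron_vec x y) $ i = (\<Sum>k<n * n'. kron A B $$ (i, k) * kron_vec x y $ k)"
    using A B x y i by (auto simp: scalar_prod_def atLeast0LessThan kron_vec_def)
  also have "\<dots> = (\<Sum>k<n * n'. (A $$ (i div m', k div n') * x $ (k div n')) *
      (B $$ (i mod m', k mod n') * y $ (k mod n')))"
    using i by (intro sum.cong) (auto simp: index_kron[OF A B] index_kron_vec[OF x y])
  also have "\<dots> = (\<Sum>k<n. \<Sum>l<n'. (A $$ (i div m', k) * x $ k) * (B $$ (i mod m', l) * y $ l))"
    by (rule sum_div_mod)
  also have "\<dots> = (\<Sum>k<n. A $$ (i div m', k) * x $ k) * (\<Sum>l<n'. B $$ (i mod m', l) * y $ l)"
    by (simp add: sum_product)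
  also have "\<dots> = (A *\<^sub>v x) $ (i div m') * (B *\<^sub>v y) $ (i mod m')"
    using A B x y i' by (auto simp: scalar_prod_def atLeast0LessThan)
  also have "\<dots> = kron_vec (A *\<^sub>v x) (B *\<^sub>v y) $ i"
    using A B i by (subst index_kron_vec[of _ m _ m']) auto
  finally show "(kron A B *\<^sub>v kron_vec x y) $ i = kron_vec (A *\<^sub>v x) (B *\<^sub>v y) $ i" .
qed (use A B in \<open>auto simp: kron_vec_def\<close>)

lemma mat_adjoint_kron: "mat_adjoint (kron A B) = kron (mat_adjoint A) (mat_adjoint B)"
proof (rule eq_matI)
  fix i j assume "i < dim_row (kron (mat_adjoint A) (mat_adjoint B))"
    "j < dim_col (kron (mat_adjoint A) (mat_adjoint B))"
  then have ij: "i < dim_col A * dim_col B" "j < dim_row A * dim_row B" by auto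
  then show "mat_adjoint (kron A B) $$ (i, j) = kron (mat_adjoint A) (mat_adjoint B) $$ (i, j)"
    using div_mod_less_mult[OF ij(1)] div_mod_less_mult[OF ij(2)] by (simp add: kron_def)
qed auto

lemma kron_smult_one: "kron (a \<cdot>\<^sub>m 1\<^sub>m m) (b \<cdot>\<^sub>m 1\<^sub>m n) = (a * b) \<cdot>\<^sub>m 1\<^sub>m (m * n)"
proof (rule eq_matI)
  fix i j assume "i < dim_row ((a * b) \<cdot>\<^sub>m 1\<^sub>m (m * n))" "j < dim_col ((a * b) \<cdot>\<^sub>m 1\<^sub>m (m * n))"
  then have ij: "i < m * n" "j < m * n" by auto
  have "i = j \<longleftrightarrow> i div n = j div n \<and> i mod n = j mod n" by (metis div_mod_decomp)
  then show "kron (a \<cdot>\<^sub>m 1\<^sub>m m) (b \<cdot>\<^sub>m 1\<^sub>m n) $$ (i, j) = ((a * b) \<cdot>\<^sub>m 1\<^sub>m (m * n)) $$ (i, j)"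
    using ij div_mod_less_mult[OF ij(1)] div_mod_less_mult[OF ij(2)] by (auto simp: kron_def)
qed auto

lemma kron_one: "kron (1\<^sub>m m) (1\<^sub>m n) = 1\<^sub>m (m * n)"
proof -
  have one: "(1 :: complex) \<cdot>\<^sub>m 1\<^sub>m k = 1\<^sub>m k" for k by (intro eq_matI) auto
  have "kron (1\<^sub>m m) (1\<^sub>m n) = kron (1 \<cdot>\<^sub>m 1\<^sub>m m) (1 \<cdot>\<^sub>m 1\<^sub>m n)" by (simp only: one)
  also have "\<dots> = 1\<^sub>m (m * n)" unfolding kron_smult_one mult_1 by (rule one)
  finally show ?thesis .
qed

text \<open>
  The index \<open>i\<close> of a Kronecker product orders the pairs \<open>(i div n, i mod n)\<close> lexicographically, so
  below the diagonal one of the two factors is below its own diagonal.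
\<close>

lemma upper_triangular_kron:
  assumes A: "A \<in> carrier_mat m m" "upper_triangular A" and B: "B \<in> carrier_mat n n" "upper_triangular B"
  shows "upper_triangular (kron A B)"
  unfolding upper_triangular_def
proof (intro allI impI)
  fix i j assume "i < dim_row (kron A B)" and ji: "j < i"
  then have i: "i < m * n" and j: "j < m * n" using A B by auto
  note b = div_mod_less_mult[OF i] div_mod_less_mult[OF j]
  have "j div n < i div n \<or> (j div n = i div n \<and> j mod n < i mod n)"
  proof (cases "j div n = i div n")
    case True
    have "j = n * (j div n) + j mod n" "i = n * (i div n) + i mod n" by simp_all
    then have "j mod n < i mod n" using ji True by (metis nat_add_left_cancel_less)
    with True show ?thesis by simp
  next
    case False
    then show ?thesis using div_le_mono[of j i n] ji by linarith
  qed
  then have "A $$ (i div n, j div n) = 0 \<or> B $$ (i mod n, j mod n) = 0"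
    using A B b by (auto simp: upper_triangular_def)
  then show "kron A B $$ (i, j) = 0" using index_kron[OF A(1) B(1) i j] by auto
qed

lemma kron_vec_cscalar:
  assumes x: "x \<in> carrier_vec m" "x' \<in> carrier_vec m" and y: "y \<in> carrier_vec n" "y' \<in> carrier_vec n"
  shows "kron_vec x y \<bullet>c kron_vec x' y' = (x \<bullet>c x') * (y \<bullet>c y')"
proof -
  have "kron_vec x y \<bullet>c kron_vec x' y' = (\<Sum>k<m * n. kron_vec x y $ k * cnj (kron_vec x' y' $ k))"
    using x y by (auto simp: scalar_prod_def atLeast0LessThan kron_vec_def)
  also have "\<dots> = (\<Sum>k<m * n. (x $ (k div n) * cnj (x' $ (k div n))) * (y $ (k mod n) * cnj (y' $ (k mod n))))"
    by (intro sum.cong) (auto simp: index_kron_vec[OF x(1) y(1)] index_kron_vec[OF x(2) y(2)])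
  also have "\<dots> = (\<Sum>k<m. \<Sum>l<n. (x $ k * cnj (x' $ k)) * (y $ l * cnj (y' $ l)))"
    by (rule sum_div_mod)
  also have "\<dots> = (x \<bullet>c x') * (y \<bullet>c y')"
    using x y by (simp add: sum_product scalar_prod_def atLeast0LessThan)
  finally show ?thesis .
qed

lemma kron_vec_nonzero:
  assumes "x \<in> carrier_vec m" "y \<in> carrier_vec n" "x \<noteq> 0\<^sub>v m" "y \<noteq> 0\<^sub>v n"
  shows "kron_vec x y \<noteq> 0\<^sub>v (m * n)"
  using kron_vec_cscalar[OF assms(1,1,2,2)] assms
    cscalar_zero_iff[OF assms(1)] cscalar_zero_iff[OF assms(2)]
    cscalar_zero_iff[OF kron_vec_carrier[OF assms(1,2)]] by auto

section \<open>The general linear group\<close>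

lemma invertible_mat_iff_det:
  fixes A :: "complex mat"
  assumes A: "A \<in> carrier_mat n n"
  shows "invertible_mat A \<longleftrightarrow> det A \<noteq> 0"
proof
  assume "invertible_mat A"
  then obtain B where B: "A * B = 1\<^sub>m n" "B * A = 1\<^sub>m (dim_row B)"
    using A by (auto simp: invertible_mat_def inverts_mat_def)
  have "dim_col (A * B) = n" "dim_col (B * A) = dim_row B" using B by auto
  then have "B \<in> carrier_mat n n" using A by (intro carrier_matI) auto
  then have "det A * det B = 1" using det_mult[OF A] B by (metis det_one)
  then show "det A \<noteq> 0" by auto
next
  assume "det A \<noteq> 0"
  from det_non_zero_imp_unit[OF A this] obtain B where
    "B \<in> carrier_mat n n" "B * A = 1\<^sub>m n" "A * B = 1\<^sub>m n"
    unfolding Units_def ring_mat_def by auto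
  then show "invertible_mat A"
    using A unfolding invertible_mat_def inverts_mat_def by auto
qed

lemma GL_iff: "g \<in> GL n \<longleftrightarrow> g \<in> carrier_mat n n \<and> det g \<noteq> 0"
  using invertible_mat_iff_det by (auto simp: GL_def)

lemma invertible_mat_inverse:
  fixes A B :: "complex mat"
  assumes "A \<in> carrier_mat n n" "B \<in> carrier_mat n n" "A * B = 1\<^sub>m n"
  shows "invertible_mat A"
  using det_mult[OF assms(1,2)] assms by (auto simp: invertible_mat_iff_det)

lemma SL_subset_GL: "SL n \<subseteq> GL n"
  by (auto simp: SL_def GL_iff)

lemma one_in_GL [simp]: "1\<^sub>m n \<in> GL n"
  by (simp add: GL_iff)

lemma mult_in_GL: "g \<in> GL n \<Longrightarrow> h \<in> GL n \<Longrightarrow> g * h \<in> GL n"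
  by (auto simp: GL_iff det_mult)

interpretation cnj_hom: comm_ring_hom cnj
  by unfold_locales auto

lemma det_mat_adjoint:
  assumes "g \<in> carrier_mat n n"
  shows "det (mat_adjoint g) = cnj (det g)"
proof -
  have "mat_adjoint g = transpose_mat (map_mat cnj g)"
    using assms by (intro eq_matI) auto
  then have "det (mat_adjoint g) = det (map_mat cnj g)"
    using det_transpose[of "map_mat cnj g" n] assms by simp
  also have "\<dots> = cnj (det g)"
    by (rule cnj_hom.hom_det)
  finally show ?thesis .
qed

lemma adjoint_in_GL: "g \<in> GL n \<Longrightarrow> mat_adjoint g \<in> GL n"
  by (auto simp: GL_iff det_mat_adjoint)

lemma scalar_in_GL: "c \<noteq> 0 \<Longrightarrow> c \<cdot>\<^sub>m 1\<^sub>m n \<in> GL n"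
  by (simp add: GL_iff)

definition borel :: "nat \<Rightarrow> complex mat set" where
  "borel n = {b \<in> GL n. upper_triangular b}"

lemma det_triangular:
  fixes g :: "complex mat"
  assumes g: "g \<in> carrier_mat n n"
    and "upper_triangular g \<or> (\<forall>i<n. \<forall>j<n. i < j \<longrightarrow> g $$ (i, j) = 0)"
  shows "det g = (\<Prod>i<n. g $$ (i, i))"
proof -
  have "det g = prod_list (diag_mat g)"
    using assms det_upper_triangular[of g n] det_lower_triangular[of n g] by auto
  then show ?thesis using g by (simp add: prod_list_diag_prod atLeast0LessThan)
qed

text \<open>
  Taking adjoints of eigenvector equations replaces the upper by the lower triangular group. The
  lower triangular matrices that move vectors around later on enter through this lemma.
\<close>

lemma lower_triangular_adjoint_borel:
  assumes g: "g \<in> carrier_mat n n" and low: "\<And>i j. i < j \<Longrightarrow> j < n \<Longrightarrow> g $$ (i, j) = 0"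
    and diag: "\<And>i. i < n \<Longrightarrow> g $$ (i, i) \<noteq> 0"
  shows "g \<in> GL n" "mat_adjoint g \<in> borel n"
proof -
  have "det g = (\<Prod>i<n. g $$ (i, i))" using low by (intro det_triangular[OF g]) auto
  then show gl: "g \<in> GL n" using g diag by (simp add: GL_iff)
  have "upper_triangular (mat_adjoint g)"
    unfolding upper_triangular_def using g low by auto
  then show "mat_adjoint g \<in> borel n" using adjoint_in_GL[OF gl] by (simp add: borel_def)
qed

section \<open>Representations compatible with adjoints\<close>

text \<open>
  This is the condition of \<^const>\<open>has_highest_weight\<close> on a vector.
\<close>

definition hw_vector :: "nat \<Rightarrow> rep \<Rightarrow> int list \<Rightarrow> complex vec \<Rightarrow> bool" where
  "hw_vector n V k w \<longleftrightarrow> w \<in> carrier_vec (deg V) \<and> w \<noteq> 0\<^sub>v (deg V) \<and> length k = n \<and>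
     (\<forall>b\<in>borel n. act V b *\<^sub>v w = (\<Prod>i<n. (b $$ (i, i)) powi (k ! i)) \<cdot>\<^sub>v w)"

text \<open>
  The representation sits isometrically, by \<open>P\<close>, in a space on which the upper triangular group acts by upper
  triangular matrices with monomials in the diagonal entries on the diagonal. An ambient space is
  allowed because such a basis is evident for tensor powers but not for their
  subrepresentations.
\<close>

definition triangular_flag :: "nat \<Rightarrow> rep \<Rightarrow> bool" where
  "triangular_flag n V \<longleftrightarrow>
     (\<exists>D P A \<kappa>. P \<in> carrier_mat D (deg V) \<and> mat_adjoint P * P = 1\<^sub>m (deg V) \<and>
        (\<forall>b\<in>borel n. A b \<in> carrier_mat D D \<and> upper_triangular (A b) \<and> P * act V b = A b * P \<and>
           (\<forall>l<D. A b $$ (l, l) = (\<Prod>i<n. (b $$ (i, i)) ^ (\<kappa> l i :: nat)))))"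

text \<open>
  The class of representations in which the proof takes place: compatible with adjoints,
  homogeneous of degree \<open>M\<close> under scalar matrices, and triangularizable over the upper triangular group.
\<close>

definition star_rep :: "nat \<Rightarrow> nat \<Rightarrow> rep \<Rightarrow> bool" where
  "star_rep n M V \<longleftrightarrow> is_rep n (GL n) V \<and>
     (\<forall>g\<in>GL n. act V (mat_adjoint g) = mat_adjoint (act V g)) \<and>
     (\<forall>c. c \<noteq> 0 \<longrightarrow> act V (c \<cdot>\<^sub>m 1\<^sub>m n) = c ^ M \<cdot>\<^sub>m 1\<^sub>m (deg V)) \<and>
     triangular_flag n V"

lemma is_repD:
  assumes "is_rep n G V"
  shows "g \<in> G \<Longrightarrow> act V g \<in> carrier_mat (deg V) (deg V)"
    and "act V (1\<^sub>m n) = 1\<^sub>m (deg V)"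
    and "g \<in> G \<Longrightarrow> h \<in> G \<Longrightarrow> act V (g * h) = act V g * act V h"
    and "i < deg V \<Longrightarrow> j < deg V \<Longrightarrow> \<exists>f\<in>regular_funs n. \<forall>g\<in>G. act V g $$ (i, j) = f g"
  using assms unfolding is_rep_def by auto

lemma star_repD:
  assumes "star_rep n M V"
  shows "is_rep n (GL n) V"
    and "g \<in> GL n \<Longrightarrow> act V g \<in> carrier_mat (deg V) (deg V)"
    and "g \<in> GL n \<Longrightarrow> act V (mat_adjoint g) = mat_adjoint (act V g)"
    and "c \<noteq> 0 \<Longrightarrow> act V (c \<cdot>\<^sub>m 1\<^sub>m n) = c ^ M \<cdot>\<^sub>m 1\<^sub>m (deg V)"
    and "triangular_flag n V"
  using assms unfolding star_rep_def is_rep_def by auto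

lemma regular_funs_sum:
  assumes "finite S" "\<And>i. i \<in> S \<Longrightarrow> f i \<in> regular_funs n"
  shows "(\<lambda>A. \<Sum>i\<in>S. f i A) \<in> regular_funs n"
  using assms by (induction S rule: finite_induct) (auto intro: regular_funs.intros)

lemma regular_funs_power:
  assumes "f \<in> regular_funs n"
  shows "(\<lambda>A. f A ^ k) \<in> regular_funs n"
  using assms by (induction k) (auto intro: regular_funs.intros)

lemma borel_subset_GL: "borel n \<subseteq> GL n"
  by (auto simp: borel_def)

lemma borel_diag_nonzero:
  assumes "b \<in> borel n" "i < n"
  shows "b $$ (i, i) \<noteq> 0"
proof -
  have "b \<in> carrier_mat n n" "upper_triangular b" "det b \<noteq> 0"
    using assms by (auto simp: borel_def GL_iff)
  then have "(\<Prod>i<n. b $$ (i, i)) \<noteq> 0" using det_triangular[of b n] by simp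
  then show ?thesis using assms by simp
qed

text \<open>
  Let the depth of \<open>w \<in> W\<close> be the largest index at which \<open>P w\<close> is nonzero, and let \<open>w \<noteq> 0\<close> have
  minimal depth \<open>l\<close>. An upper triangular \<open>b\<close> multiplies the \<open>l\<close>-th entry of \<open>P w\<close> by the \<open>l\<close>-th
  diagonal entry of the ambient matrix and leaves the later entries zero. Subtracting this multiple of \<open>w\<close> from
  \<open>b w\<close> gives an element of \<open>W\<close> of smaller depth, which must be zero.
\<close>

lemma highest_weight_vector_exists:
  assumes V: "triangular_flag n V" and Vc: "\<And>b. b \<in> borel n \<Longrightarrow> act V b \<in> carrier_mat (deg V) (deg V)"
    and W: "lin_subspace (deg V) W" and inv: "\<And>b w. b \<in> borel n \<Longrightarrow> w \<in> W \<Longrightarrow> act V b *\<^sub>v w \<in> W"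
    and ne: "W \<noteq> {0\<^sub>v (deg V)}"
  shows "\<exists>k. \<exists>w\<in>W. hw_vector n V k w"
proof -
  let ?d = "deg V"
  from V obtain D P A \<kappa> where F: "P \<in> carrier_mat D ?d \<and> mat_adjoint P * P = 1\<^sub>m ?d \<and>
      (\<forall>b\<in>borel n. A b \<in> carrier_mat D D \<and> upper_triangular (A b) \<and> P * act V b = A b * P \<and>
         (\<forall>l<D. A b $$ (l, l) = (\<Prod>i<n. (b $$ (i, i)) ^ (\<kappa> l i :: nat))))"
    unfolding triangular_flag_def by blast
  from F have P: "P \<in> carrier_mat D ?d" and PP: "mat_adjoint P * P = 1\<^sub>m ?d"
    and A: "\<And>b. b \<in> borel n \<Longrightarrow> A b \<in> carrier_mat D D"
    and up: "\<And>b. b \<in> borel n \<Longrightarrow> upper_triangular (A b)"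
    and int: "\<And>b. b \<in> borel n \<Longrightarrow> P * act V b = A b * P"
    and diag: "\<And>b l. b \<in> borel n \<Longrightarrow> l < D \<Longrightarrow> A b $$ (l, l) = (\<Prod>i<n. (b $$ (i, i)) ^ (\<kappa> l i :: nat))"
    by blast+
  have Wc: "W \<subseteq> carrier_vec ?d" and W0: "0\<^sub>v ?d \<in> W"
    and Wadd: "\<And>u v. u \<in> W \<Longrightarrow> v \<in> W \<Longrightarrow> u + v \<in> W"
    and Wsm: "\<And>c v. v \<in> W \<Longrightarrow> c \<cdot>\<^sub>v v \<in> W"
    using W unfolding lin_subspace_def by auto
  define low where "low m w \<longleftrightarrow> w \<in> W \<and> w \<noteq> 0\<^sub>v ?d \<and> (\<forall>i<D. m \<le> i \<longrightarrow> (P *\<^sub>v w) $ i = 0)" for m w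
  obtain w0 where "w0 \<in> W" "w0 \<noteq> 0\<^sub>v ?d" using ne W0 by auto
  then have "\<exists>w. low D w" by (auto simp: low_def)
  define m where "m = (LEAST m. \<exists>w. low m w)"
  have "\<exists>w. low m w" unfolding m_def by (rule LeastI) fact
  then obtain w where w: "low m w" by blast
  have minimal: "\<not> low l u" if "l < m" for l u
    using that not_less_Least unfolding m_def by blast
  have wW: "w \<in> W" and wc: "w \<in> carrier_vec ?d" and wn: "w \<noteq> 0\<^sub>v ?d"
    and wz: "\<And>i. i < D \<Longrightarrow> m \<le> i \<Longrightarrow> (P *\<^sub>v w) $ i = 0"
    using w Wc by (auto simp: low_def)
  have "m \<noteq> 0"
  proof
    assume "m = 0"
    then have "P *\<^sub>v w = 0\<^sub>v D" using wz P by (intro eq_vecI) (auto simp del: index_mult_mat_vec)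
    then have "mat_adjoint P *\<^sub>v (P *\<^sub>v w) = 0\<^sub>v ?d" using P by auto
    then show False using isometry_inj[OF P PP wc] wn by simp
  qed
  then obtain l where l: "m = Suc l" by (cases m) auto
  have lD: "l < D"
  proof (rule ccontr)
    assume "\<not> l < D"
    then have "low l w" using wW wn by (auto simp: low_def)
    then show False using minimal[of l w] l by simp
  qed
  define c where "c b = (\<Prod>i<n. (b $$ (i, i)) ^ (\<kappa> l i))" for b :: "complex mat"
  have eig: "act V b *\<^sub>v w = c b \<cdot>\<^sub>v w" if b: "b \<in> borel n" for b
  proof -
    \<comment> \<open>The eigenvalue is the \<open>l\<close>-th diagonal entry of \<open>A b\<close>.\<close>
    define u where "u = act V b *\<^sub>v w + (- c b) \<cdot>\<^sub>v w"
    have Vb: "act V b \<in> carrier_mat ?d ?d" using Vc b by auto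
    have uW: "u \<in> W" unfolding u_def using inv[OF b wW] wW by (intro Wadd Wsm)
    have Pw: "P *\<^sub>v w \<in> carrier_vec D" using P by simp
    have Pu: "P *\<^sub>v u = A b *\<^sub>v (P *\<^sub>v w) + (- c b) \<cdot>\<^sub>v (P *\<^sub>v w)"
    proof -
      have "P *\<^sub>v (act V b *\<^sub>v w) = (P * act V b) *\<^sub>v w"
        using P Vb wc by (intro assoc_mult_mat_vec[symmetric])
      also have "\<dots> = A b *\<^sub>v (P *\<^sub>v w)"
        unfolding int[OF b] using A[OF b] P wc by (intro assoc_mult_mat_vec)
      finally have "P *\<^sub>v (act V b *\<^sub>v w) = A b *\<^sub>v (P *\<^sub>v w)" .
      moreover have "P *\<^sub>v u = P *\<^sub>v (act V b *\<^sub>v w) + P *\<^sub>v ((- c b) \<cdot>\<^sub>v w)"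
        unfolding u_def using P Vb wc by (intro mult_add_distrib_mat_vec) auto
      moreover have "P *\<^sub>v ((- c b) \<cdot>\<^sub>v w) = (- c b) \<cdot>\<^sub>v (P *\<^sub>v w)"
        using P wc by (intro mult_mat_vec)
      ultimately show ?thesis by simp
    qed
    have "(P *\<^sub>v u) $ i = 0" if i: "i < D" "l \<le> i" for i
    proof -
      define p where "p = P *\<^sub>v w"
      have p: "p \<in> carrier_vec D" and pz: "\<And>j. j < D \<Longrightarrow> m \<le> j \<Longrightarrow> p $ j = 0"
        using Pw wz by (simp_all add: p_def del: index_mult_mat_vec)
      have "(A b *\<^sub>v p) $ i = (\<Sum>j<D. A b $$ (i, j) * p $ j)"
        using A[OF b] p i by (simp add: scalar_prod_def atLeast0LessThan)
      also have "\<dots> = (\<Sum>j\<in>{i}. A b $$ (i, j) * p $ j)"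
      proof (rule sum.mono_neutral_right)
        show "\<forall>j\<in>{..<D} - {i}. A b $$ (i, j) * p $ j = 0"
        proof
          fix j assume j: "j \<in> {..<D} - {i}"
          show "A b $$ (i, j) * p $ j = 0"
          proof (cases "j < i")
            case True
            then show ?thesis using up[OF b] A[OF b] i by (simp add: upper_triangular_def)
          next
            case False
            then show ?thesis using j pz[of j] i l by simp
          qed
        qed
      qed (use i in auto)
      finally have "(P *\<^sub>v u) $ i = A b $$ (i, i) * p $ i - c b * p $ i"
        unfolding Pu p_def[symmetric] using A[OF b] p i by (simp del: index_mult_mat_vec)
      then show ?thesis
        using pz[of i] i l diag[OF b lD] by (cases "i = l") (simp_all add: c_def)
    qed
    then have "u = 0\<^sub>v ?d" using minimal[of l u] l uW unfolding low_def by auto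
    then have "act V b *\<^sub>v w + (- c b) \<cdot>\<^sub>v w = 0\<^sub>v ?d" by (simp add: u_def)
    then have e: "(act V b *\<^sub>v w + (- c b) \<cdot>\<^sub>v w) $ i = 0" if "i < ?d" for i using that by simp
    show ?thesis
    proof (rule eq_vecI)
      fix i assume "i < dim_vec (c b \<cdot>\<^sub>v w)"
      then have i: "i < ?d" using wc by simp
      show "(act V b *\<^sub>v w) $ i = (c b \<cdot>\<^sub>v w) $ i"
        using e[OF i] i wc Vb by (simp del: index_mult_mat_vec(1))
    qed (use Vb wc in auto)
  qed
  define k where "k = map (\<lambda>i. int (\<kappa> l i)) [0..<n]"
  have "hw_vector n V k w"
    unfolding hw_vector_def using wc wn eig by (simp add: k_def c_def power_int_of_nat)
  with wW show ?thesis by blast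
qed

section \<open>Subrepresentations and tensor products\<close>

text \<open>
  The representation on the range of an isometry \<open>Q\<close>, in the coordinates given by the columns
  of \<open>Q\<close>.
\<close>

definition sub_rep :: "rep \<Rightarrow> complex mat \<Rightarrow> rep" where
  "sub_rep V Q = \<lparr>deg = dim_col Q, act = (\<lambda>g. mat_adjoint Q * act V g * Q)\<rparr>"

definition invariant :: "complex mat set \<Rightarrow> rep \<Rightarrow> complex vec set \<Rightarrow> bool" where
  "invariant G V W \<longleftrightarrow> (\<forall>g\<in>G. \<forall>w\<in>W. act V g *\<^sub>v w \<in> W)"

lemma invariant_orth_compl:
  assumes V: "star_rep n M V" and W: "W \<subseteq> carrier_vec (deg V)" and inv: "invariant (GL n) V W"
  shows "invariant (GL n) V (orth_compl (deg V) W)"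
  unfolding invariant_def
proof (intro ballI)
  fix g x assume g: "g \<in> GL n" and x: "x \<in> orth_compl (deg V) W"
  have "\<forall>w\<in>W. mat_adjoint (act V g) *\<^sub>v w \<in> W"
    using inv adjoint_in_GL[OF g] star_repD(3)[OF V g] by (auto simp: invariant_def)
  then show "act V g *\<^sub>v x \<in> orth_compl (deg V) W"
    using orth_compl_invariant[OF star_repD(2)[OF V g] W _ x] by blast
qed

lemma isometry_ontoD:
  assumes "isometry_onto d k Q W"
  shows "Q \<in> carrier_mat d k" "mat_adjoint Q * Q = 1\<^sub>m k"
    "v \<in> carrier_vec k \<Longrightarrow> Q *\<^sub>v v \<in> W" "w \<in> W \<Longrightarrow> Q *\<^sub>v (mat_adjoint Q *\<^sub>v w) = w"
  using assms by (auto simp: isometry_onto_def)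

lemma deg_sub_rep: "isometry_onto d k Q W \<Longrightarrow> deg (sub_rep V Q) = k"
  by (auto simp: isometry_onto_def sub_rep_def)

text \<open>
  The second equation is the adjoint of the first one, taken at the adjoint of \<open>g\<close>.
\<close>

lemma sub_rep_intertwines:
  assumes V: "star_rep n M V" and Q: "isometry_onto (deg V) k Q W"
    and inv: "invariant (GL n) V W" and g: "g \<in> GL n"
  shows "Q * act (sub_rep V Q) g = act V g * Q"
    and "mat_adjoint Q * act V g = act (sub_rep V Q) g * mat_adjoint Q"
proof -
  have first: "Q * act (sub_rep V Q) h = act V h * Q" if h: "h \<in> GL n" for h
  proof (rule mat_eq_by_vec)
    have Qc: "Q \<in> carrier_mat (deg V) k" and Vh: "act V h \<in> carrier_mat (deg V) (deg V)"
      using isometry_ontoD(1)[OF Q] star_repD(2)[OF V h] by auto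
    show "Q * act (sub_rep V Q) h \<in> carrier_mat (deg V) k" "act V h * Q \<in> carrier_mat (deg V) k"
      using Qc Vh by (auto simp: sub_rep_def)
    fix v :: "complex vec" assume v: "v \<in> carrier_vec k"
    have in_W: "act V h *\<^sub>v (Q *\<^sub>v v) \<in> W"
      using inv h isometry_ontoD(3)[OF Q v] by (auto simp: invariant_def)
    have "(Q * act (sub_rep V Q) h) *\<^sub>v v = Q *\<^sub>v ((mat_adjoint Q * act V h * Q) *\<^sub>v v)"
      using Qc Vh v by (subst assoc_mult_mat_vec[of _ "deg V" k _ k]) (auto simp: sub_rep_def)
    also have "(mat_adjoint Q * act V h * Q) *\<^sub>v v = (mat_adjoint Q * act V h) *\<^sub>v (Q *\<^sub>v v)"
      using Qc Vh v by (intro assoc_mult_mat_vec[of _ k "deg V" _ k]) auto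
    also have "\<dots> = mat_adjoint Q *\<^sub>v (act V h *\<^sub>v (Q *\<^sub>v v))"
      using Qc Vh v by (intro assoc_mult_mat_vec[of _ k "deg V" _ "deg V"]) auto
    also have "Q *\<^sub>v \<dots> = act V h *\<^sub>v (Q *\<^sub>v v)" by (rule isometry_ontoD(4)[OF Q in_W])
    also have "\<dots> = (act V h * Q) *\<^sub>v v"
      using Qc Vh v by (intro assoc_mult_mat_vec[symmetric]) auto
    finally show "(Q * act (sub_rep V Q) h) *\<^sub>v v = (act V h * Q) *\<^sub>v v" .
  qed
  show "Q * act (sub_rep V Q) g = act V g * Q" by (rule first[OF g])
  have Qc: "Q \<in> carrier_mat (deg V) k" and Vg: "act V g \<in> carrier_mat (deg V) (deg V)"
    using isometry_ontoD(1)[OF Q] star_repD(2)[OF V g] by auto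
  have star: "act V (mat_adjoint g) = mat_adjoint (act V g)" by (rule star_repD(3)[OF V g])
  have "act (sub_rep V Q) (mat_adjoint g) = mat_adjoint (act (sub_rep V Q) g)"
  proof -
    have "mat_adjoint (mat_adjoint Q * act V g * Q) = mat_adjoint Q * (mat_adjoint (act V g) * mat_adjoint (mat_adjoint Q))"
      using Qc Vg by (subst mat_adjoint_mult[of _ k "deg V" _ k], auto) (subst mat_adjoint_mult[of _ k "deg V" _ "deg V"], auto)
    also have "\<dots> = mat_adjoint Q * mat_adjoint (act V g) * Q"
      using Qc Vg by (subst assoc_mult_mat[of _ k "deg V" _ "deg V" _ k]) auto
    finally show ?thesis by (simp add: sub_rep_def star)
  qed
  note star' = this
  have sg: "act (sub_rep V Q) g \<in> carrier_mat k k" using Qc by (auto simp: sub_rep_def)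
  have "mat_adjoint (Q * act (sub_rep V Q) (mat_adjoint g)) = mat_adjoint (act V (mat_adjoint g) * Q)"
    by (simp only: first[OF adjoint_in_GL[OF g]])
  also have "mat_adjoint (act V (mat_adjoint g) * Q) = mat_adjoint Q * act V g"
    unfolding star using Qc Vg by (subst mat_adjoint_mult[of _ "deg V" "deg V" _ k]) auto
  also have "mat_adjoint (Q * act (sub_rep V Q) (mat_adjoint g)) = act (sub_rep V Q) g * mat_adjoint Q"
    unfolding star' using Qc sg by (subst mat_adjoint_mult[of _ "deg V" k _ k]) auto
  finally show "mat_adjoint Q * act V g = act (sub_rep V Q) g * mat_adjoint Q" by simp
qed

lemma star_rep_sub_rep:
  assumes V: "star_rep n M V" and Q: "isometry_onto (deg V) k Q W" and inv: "invariant (GL n) V W"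
  shows "star_rep n M (sub_rep V Q)"
proof -
  let ?d = "deg V" and ?U = "sub_rep V Q"
  note Qc = isometry_ontoD(1)[OF Q] and QQ = isometry_ontoD(2)[OF Q]
  note Vc = star_repD(2)[OF V] and rep = star_repD(1)[OF V]
  note int = sub_rep_intertwines[OF V Q inv]
  have dk: "deg ?U = k" by (rule deg_sub_rep[OF Q])
  have act: "act ?U g = mat_adjoint Q * act V g * Q" for g by (simp add: sub_rep_def)
  have Uc: "act ?U g \<in> carrier_mat k k" for g using Qc by (auto simp: sub_rep_def)
  have one: "act ?U (1\<^sub>m n) = 1\<^sub>m k"
    unfolding act is_repD(2)[OF rep] using Qc QQ by simp
  have mult: "act ?U (g * h) = act ?U g * act ?U h" if "g \<in> GL n" "h \<in> GL n" for g h
  proof -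
    have "act ?U g * act ?U h = mat_adjoint Q * act V g * (Q * act ?U h)"
      unfolding act[of g] using Vc[OF that(1)] Qc Uc[of h]
      by (intro assoc_mult_mat[of _ k ?d _ k _ k]) auto
    also have "\<dots> = mat_adjoint Q * act V g * (act V h * Q)" by (simp only: int(1)[OF that(2)])
    also have "\<dots> = mat_adjoint Q * act V g * act V h * Q"
      using Vc[OF that(1)] Vc[OF that(2)] Qc by (intro assoc_mult_mat[symmetric, of _ k ?d _ ?d _ k]) auto
    also have "mat_adjoint Q * act V g * act V h = mat_adjoint Q * (act V g * act V h)"
      using Vc[OF that(1)] Vc[OF that(2)] Qc by (intro assoc_mult_mat[of _ k ?d _ ?d _ ?d]) auto
    finally show ?thesis using is_repD(3)[OF rep that] by (simp add: act)
  qed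
  have reg: "\<exists>f\<in>regular_funs n. \<forall>g\<in>GL n. act ?U g $$ (i, j) = f g" if ij: "i < k" "j < k" for i j
  proof -
    have "\<exists>f. \<forall>a<?d. \<forall>b<?d. f a b \<in> regular_funs n \<and> (\<forall>g\<in>GL n. act V g $$ (a, b) = f a b g)"
      using is_repD(4)[OF rep] by metis
    then obtain f where f: "\<And>a b. a < ?d \<Longrightarrow> b < ?d \<Longrightarrow> f a b \<in> regular_funs n"
      "\<And>a b g. a < ?d \<Longrightarrow> b < ?d \<Longrightarrow> g \<in> GL n \<Longrightarrow> act V g $$ (a, b) = f a b g" by blast
    have "(\<lambda>g. \<Sum>b<?d. (\<Sum>a<?d. cnj (Q $$ (a, i)) * f a b g) * Q $$ (b, j)) \<in> regular_funs n"
      (is "?F \<in> _")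
      by (intro regular_funs_sum regular_funs.mult regular_funs.const f) auto
    moreover have "act ?U g $$ (i, j) = ?F g"
      if g: "g \<in> GL n" for g
    proof -
      have "act ?U g $$ (i, j) = (\<Sum>b<?d. (mat_adjoint Q * act V g) $$ (i, b) * Q $$ (b, j))"
        unfolding act using Qc Vc[OF g] ij by (auto simp: scalar_prod_def atLeast0LessThan)
      also have "\<dots> = (\<Sum>b<?d. (\<Sum>a<?d. cnj (Q $$ (a, i)) * f a b g) * Q $$ (b, j))"
        using Qc Vc[OF g] ij f(2)[OF _ _ g]
        by (intro sum.cong) (auto simp: scalar_prod_def atLeast0LessThan)
      finally show ?thesis .
    qed
    ultimately show ?thesis by (intro bexI[of _ ?F] ballI) auto
  qed
  have rep_GL: "is_rep n (GL n) ?U" unfolding is_rep_def dk using Uc one mult reg by blast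
  have star: "act ?U (mat_adjoint g) = mat_adjoint (act ?U g)" if g: "g \<in> GL n" for g
  proof -
    have "mat_adjoint (mat_adjoint Q * act V g * Q) = mat_adjoint Q * mat_adjoint (mat_adjoint Q * act V g)"
      using Qc Vc[OF g] by (intro mat_adjoint_mult[of _ k ?d _ k]) auto
    also have "mat_adjoint (mat_adjoint Q * act V g) = mat_adjoint (act V g) * Q"
      using Qc Vc[OF g] by (subst mat_adjoint_mult[of _ k ?d _ ?d]) auto
    also have "mat_adjoint Q * (mat_adjoint (act V g) * Q) = mat_adjoint Q * mat_adjoint (act V g) * Q"
      using Qc Vc[OF g] by (intro assoc_mult_mat[symmetric, of _ k ?d _ ?d _ k]) auto
    finally show ?thesis by (simp add: act star_repD(3)[OF V g])
  qed
  have scal: "act ?U (c \<cdot>\<^sub>m 1\<^sub>m n) = c ^ M \<cdot>\<^sub>m 1\<^sub>m k" if "c \<noteq> 0" for c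
  proof -
    have "mat_adjoint Q * (c ^ M \<cdot>\<^sub>m 1\<^sub>m ?d) = c ^ M \<cdot>\<^sub>m mat_adjoint Q"
      using Qc by (subst mult_smult_distrib[of _ k ?d _ ?d]) auto
    then have "act ?U (c \<cdot>\<^sub>m 1\<^sub>m n) = (c ^ M \<cdot>\<^sub>m mat_adjoint Q) * Q"
      unfolding act star_repD(4)[OF V that] by simp
    also have "\<dots> = c ^ M \<cdot>\<^sub>m (mat_adjoint Q * Q)" using Qc by (intro mult_smult_assoc_mat) auto
    finally show ?thesis by (simp add: QQ)
  qed
  have flag: "triangular_flag n ?U"
  proof -
    from star_repD(5)[OF V] obtain D P A \<kappa> where F: "P \<in> carrier_mat D ?d \<and> mat_adjoint P * P = 1\<^sub>m ?d \<and>
      (\<forall>b\<in>borel n. A b \<in> carrier_mat D D \<and> upper_triangular (A b) \<and> P * act V b = A b * P \<and>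
         (\<forall>l<D. A b $$ (l, l) = (\<Prod>i<n. (b $$ (i, i)) ^ (\<kappa> l i :: nat))))"
      unfolding triangular_flag_def by blast
    then have P: "P \<in> carrier_mat D ?d" and PP: "mat_adjoint P * P = 1\<^sub>m ?d" by auto
    have "mat_adjoint (P * Q) * (P * Q) = mat_adjoint Q * mat_adjoint P * (P * Q)"
      using P Qc by (simp add: mat_adjoint_mult)
    also have "\<dots> = mat_adjoint Q * (mat_adjoint P * (P * Q))"
      using P Qc by (intro assoc_mult_mat[of _ k ?d _ D _ k]) auto
    also have "mat_adjoint P * (P * Q) = mat_adjoint P * P * Q"
      using P Qc by (intro assoc_mult_mat[symmetric, of _ ?d D _ ?d _ k]) auto
    finally have "mat_adjoint (P * Q) * (P * Q) = 1\<^sub>m k" using PP QQ Qc by simp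
    moreover have "P * Q * act ?U b = A b * (P * Q)" if b: "b \<in> borel n" for b
    proof -
      have g: "b \<in> GL n" using b borel_subset_GL by auto
      have Ab: "A b \<in> carrier_mat D D" and e: "P * act V b = A b * P" using F b by auto
      have "P * Q * act ?U b = P * (Q * act ?U b)"
        using P Qc Uc[of b] by (intro assoc_mult_mat) auto
      also have "\<dots> = P * (act V b * Q)" by (simp only: int(1)[OF g])
      also have "\<dots> = P * act V b * Q" using P Qc Vc[OF g] by (intro assoc_mult_mat[symmetric]) auto
      also have "\<dots> = A b * (P * Q)" unfolding e using P Qc Ab by (intro assoc_mult_mat) auto
      finally show ?thesis .
    qed
    moreover have "P * Q \<in> carrier_mat D k" using P Qc by auto
    ultimately show ?thesis unfolding triangular_flag_def dk using F
      by (intro exI[of _ D] exI[of _ "P * Q"] exI[of _ A] exI[of _ \<kappa>]) auto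
  qed
  show ?thesis unfolding star_rep_def dk using rep_GL star scal flag by auto
qed

lemma act_tensor_rep:
  assumes "act V g \<in> carrier_mat (deg V) (deg V)" "act W g \<in> carrier_mat (deg W) (deg W)"
  shows "act (tensor_rep V W) g = kron (act V g) (act W g)"
  using assms by (auto simp: tensor_rep_def kron_def)

lemma deg_tensor_rep [simp]: "deg (tensor_rep V W) = deg V * deg W"
  by (simp add: tensor_rep_def)

text \<open>
  The degrees and the exponents on the diagonal add up; everything else is the mixed product
  rule for Kronecker products.
\<close>

lemma star_rep_tensor_rep:
  assumes V: "star_rep n M V" and W: "star_rep n M' W"
  shows "star_rep n (M + M') (tensor_rep V W)"
proof -
  let ?d = "deg V" and ?e = "deg W" and ?T = "tensor_rep V W"
  note Vc = star_repD(2)[OF V] and Wc = star_repD(2)[OF W]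
  have act: "act ?T g = kron (act V g) (act W g)" if "g \<in> GL n" for g
    using act_tensor_rep Vc Wc that by blast
  have Tc: "act ?T g \<in> carrier_mat (?d * ?e) (?d * ?e)" for g by (simp add: tensor_rep_def)
  have reg: "\<exists>f\<in>regular_funs n. \<forall>g\<in>GL n. act ?T g $$ (i, j) = f g"
    if ij: "i < ?d * ?e" "j < ?d * ?e" for i j
  proof -
    obtain f where f: "f \<in> regular_funs n" "\<forall>g\<in>GL n. act V g $$ (i div ?e, j div ?e) = f g"
      using is_repD(4)[OF star_repD(1)[OF V]] div_mod_less_mult[OF ij(1)] div_mod_less_mult[OF ij(2)] by metis
    obtain f' where f': "f' \<in> regular_funs n" "\<forall>g\<in>GL n. act W g $$ (i mod ?e, j mod ?e) = f' g"
      using is_repD(4)[OF star_repD(1)[OF W]] div_mod_less_mult[OF ij(1)] div_mod_less_mult[OF ij(2)] by metis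
    have "\<forall>g\<in>GL n. act ?T g $$ (i, j) = f g * f' g"
      using f f' ij by (auto simp: tensor_rep_def)
    then show ?thesis by (intro bexI[OF _ regular_funs.mult[OF f(1) f'(1)]])
  qed
  have one: "act ?T (1\<^sub>m n) = 1\<^sub>m (?d * ?e)"
    by (simp add: act is_repD(2)[OF star_repD(1)[OF V]] is_repD(2)[OF star_repD(1)[OF W]] kron_one)
  have mult: "act ?T (g * h) = act ?T g * act ?T h" if g: "g \<in> GL n" and h: "h \<in> GL n" for g h
    using kron_mult[OF Vc[OF g] Vc[OF h] Wc[OF g] Wc[OF h]]
      is_repD(3)[OF star_repD(1)[OF V] g h] is_repD(3)[OF star_repD(1)[OF W] g h]
    by (simp add: act g h mult_in_GL)
  have rep_GL: "is_rep n (GL n) ?T"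
    unfolding is_rep_def deg_tensor_rep using Tc one mult reg by blast
  have star: "act ?T (mat_adjoint g) = mat_adjoint (act ?T g)" if g: "g \<in> GL n" for g
    by (simp add: act g adjoint_in_GL star_repD(3)[OF V g] star_repD(3)[OF W g] mat_adjoint_kron)
  have scal: "act ?T (c \<cdot>\<^sub>m 1\<^sub>m n) = c ^ (M + M') \<cdot>\<^sub>m 1\<^sub>m (?d * ?e)" if "c \<noteq> 0" for c
    by (simp add: act scalar_in_GL that star_repD(4)[OF V that] star_repD(4)[OF W that] kron_smult_one power_add)
  have flag: "triangular_flag n ?T"
  proof -
    from star_repD(5)[OF V] obtain D P A \<kappa> where F: "P \<in> carrier_mat D ?d \<and> mat_adjoint P * P = 1\<^sub>m ?d \<and>
      (\<forall>b\<in>borel n. A b \<in> carrier_mat D D \<and> upper_triangular (A b) \<and> P * act V b = A b * P \<and>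
         (\<forall>l<D. A b $$ (l, l) = (\<Prod>i<n. (b $$ (i, i)) ^ (\<kappa> l i :: nat))))"
      unfolding triangular_flag_def by blast
    from star_repD(5)[OF W] obtain D' P' A' \<kappa>' where F': "P' \<in> carrier_mat D' ?e \<and> mat_adjoint P' * P' = 1\<^sub>m ?e \<and>
      (\<forall>b\<in>borel n. A' b \<in> carrier_mat D' D' \<and> upper_triangular (A' b) \<and> P' * act W b = A' b * P' \<and>
         (\<forall>l<D'. A' b $$ (l, l) = (\<Prod>i<n. (b $$ (i, i)) ^ (\<kappa>' l i :: nat))))"
      unfolding triangular_flag_def by blast
    have P: "P \<in> carrier_mat D ?d" and P': "P' \<in> carrier_mat D' ?e" using F F' by auto
    have "kron P P' \<in> carrier_mat (D * D') (?d * ?e)" using P P' by auto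
    moreover have "mat_adjoint (kron P P') * kron P P' = 1\<^sub>m (?d * ?e)"
      using F F' kron_mult[OF mat_adjoint_carrier[OF P] P mat_adjoint_carrier[OF P'] P']
      by (simp add: mat_adjoint_kron kron_one)
    moreover have "kron (A b) (A' b) \<in> carrier_mat (D * D') (D * D') \<and> upper_triangular (kron (A b) (A' b)) \<and>
        kron P P' * act ?T b = kron (A b) (A' b) * kron P P' \<and>
        (\<forall>l<D * D'. kron (A b) (A' b) $$ (l, l) =
           (\<Prod>i<n. (b $$ (i, i)) ^ (\<kappa> (l div D') i + \<kappa>' (l mod D') i)))"
      if b: "b \<in> borel n" for b
    proof (intro conjI allI impI)
      have g: "b \<in> GL n" using b borel_subset_GL by auto
      have A: "A b \<in> carrier_mat D D" and A': "A' b \<in> carrier_mat D' D'"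
        and up: "upper_triangular (A b)" "upper_triangular (A' b)" using F F' b by auto
      show "kron (A b) (A' b) \<in> carrier_mat (D * D') (D * D')" using A A' by auto
      show "upper_triangular (kron (A b) (A' b))" using upper_triangular_kron A A' up by blast
      show "kron P P' * act ?T b = kron (A b) (A' b) * kron P P'"
        using kron_mult[OF P Vc[OF g] P' Wc[OF g]] kron_mult[OF A P A' P'] F F' b by (simp add: act g)
      fix l assume l: "l < D * D'"
      then show "kron (A b) (A' b) $$ (l, l) =
           (\<Prod>i<n. (b $$ (i, i)) ^ (\<kappa> (l div D') i + \<kappa>' (l mod D') i))"
        using F F' b div_mod_less_mult[OF l] by (simp add: index_kron[OF A A'] power_add prod.distrib)
    qed
    ultimately show ?thesis unfolding triangular_flag_def deg_tensor_rep
      by (intro exI[of _ "D * D'"] exI[of _ "kron P P'"] exI[of _ "\<lambda>b. kron (A b) (A' b)"]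
          exI[of _ "\<lambda>l i. \<kappa> (l div D') i + \<kappa>' (l mod D') i"]) blast
  qed
  show ?thesis unfolding star_rep_def deg_tensor_rep using rep_GL star scal flag by auto
qed

lemma hw_vector_sub_rep:
  assumes V: "star_rep n M V" and Q: "isometry_onto (deg V) k Q W" and inv: "invariant (GL n) V W"
    and w: "hw_vector n (sub_rep V Q) \<nu> w"
  shows "hw_vector n V \<nu> (Q *\<^sub>v w)"
proof -
  note Qc = isometry_ontoD(1)[OF Q] and QQ = isometry_ontoD(2)[OF Q]
  have wc: "w \<in> carrier_vec k" and wn: "w \<noteq> 0\<^sub>v k"
    and weig: "\<And>b. b \<in> borel n \<Longrightarrow> act (sub_rep V Q) b *\<^sub>v w = (\<Prod>i<n. (b $$ (i, i)) powi (\<nu> ! i)) \<cdot>\<^sub>v w"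
    and len: "length \<nu> = n"
    using w deg_sub_rep[OF Q, of V] by (auto simp: hw_vector_def)
  have "Q *\<^sub>v w \<noteq> 0\<^sub>v (deg V)"
  proof
    assume "Q *\<^sub>v w = 0\<^sub>v (deg V)"
    then have "mat_adjoint Q *\<^sub>v (Q *\<^sub>v w) = 0\<^sub>v k" using Qc by auto
    then show False using isometry_inj[OF Qc QQ wc] wn by simp
  qed
  moreover have "act V b *\<^sub>v (Q *\<^sub>v w) = (\<Prod>i<n. (b $$ (i, i)) powi (\<nu> ! i)) \<cdot>\<^sub>v (Q *\<^sub>v w)"
    if b: "b \<in> borel n" for b
  proof -
    have g: "b \<in> GL n" using b borel_subset_GL by auto
    have "act V b *\<^sub>v (Q *\<^sub>v w) = (act V b * Q) *\<^sub>v w"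
      using star_repD(2)[OF V g] Qc wc by (intro assoc_mult_mat_vec[symmetric]) auto
    also have "\<dots> = (Q * act (sub_rep V Q) b) *\<^sub>v w"
      by (simp only: sub_rep_intertwines(1)[OF V Q inv g])
    also have "\<dots> = Q *\<^sub>v (act (sub_rep V Q) b *\<^sub>v w)"
      using Qc wc by (intro assoc_mult_mat_vec[of _ "deg V" k _ k]) (auto simp: sub_rep_def)
    also have "\<dots> = (\<Prod>i<n. (b $$ (i, i)) powi (\<nu> ! i)) \<cdot>\<^sub>v (Q *\<^sub>v w)"
      unfolding weig[OF b] by (intro mult_mat_vec[OF Qc wc])
    finally show ?thesis .
  qed
  ultimately show ?thesis unfolding hw_vector_def using Qc len by auto
qed

section \<open>Decomposition into irreducible representations\<close>

definition unitary_equiv :: "complex mat set \<Rightarrow> rep \<Rightarrow> rep \<Rightarrow> bool" where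
  "unitary_equiv G V V' \<longleftrightarrow>
     (\<exists>S \<in> carrier_mat (deg V') (deg V). S * mat_adjoint S = 1\<^sub>m (deg V') \<and>
        mat_adjoint S * S = 1\<^sub>m (deg V) \<and> (\<forall>g\<in>G. S * act V g = act V' g * S))"

lemma unitary_equiv_imp_rep_iso:
  assumes "unitary_equiv G V V'"
  shows "rep_iso G V V'"
proof -
  obtain S where S: "S \<in> carrier_mat (deg V') (deg V)" "S * mat_adjoint S = 1\<^sub>m (deg V')"
    "mat_adjoint S * S = 1\<^sub>m (deg V)" "\<forall>g\<in>G. S * act V g = act V' g * S"
    using assms by (auto simp: unitary_equiv_def)
  have "deg V \<le> deg V'" using isometry_dim_le[OF S(1,3)] .
  moreover have "deg V' \<le> deg V" using isometry_dim_le[OF mat_adjoint_carrier[OF S(1)]] S(2) by simp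
  ultimately have d: "deg V = deg V'" by simp
  then have "invertible_mat S" using invertible_mat_inverse[of S "deg V" "mat_adjoint S"] S by auto
  then show ?thesis using S d by (auto simp: rep_iso_def)
qed

lemma deg_direct_sum_append: "deg (direct_sum_rep (Vs @ Ws)) = deg (direct_sum_rep Vs) + deg (direct_sum_rep Ws)"
  by (simp add: direct_sum_rep_def)

lemma act_direct_sum_carrier:
  assumes "\<And>V. V \<in> set Vs \<Longrightarrow> act V g \<in> carrier_mat (deg V) (deg V)"
  shows "act (direct_sum_rep Vs) g \<in> carrier_mat (deg (direct_sum_rep Vs)) (deg (direct_sum_rep Vs))"
proof -
  have "map dim_row (map (\<lambda>V. act V g) Vs) = map deg Vs" "map dim_col (map (\<lambda>V. act V g) Vs) = map deg Vs"
    using assms by (auto dest: carrier_matD)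
  then show ?thesis
    by (intro carrier_matI) (simp_all only: direct_sum_rep_def dim_diag_block_mat rep.simps)
qed

lemma act_direct_sum_append:
  assumes "\<And>V. V \<in> set (Vs @ Ws) \<Longrightarrow> act V g \<in> carrier_mat (deg V) (deg V)"
  shows "act (direct_sum_rep (Vs @ Ws)) g =
    four_block_mat (act (direct_sum_rep Vs) g) (0\<^sub>m (deg (direct_sum_rep Vs)) (deg (direct_sum_rep Ws)))
      (0\<^sub>m (deg (direct_sum_rep Ws)) (deg (direct_sum_rep Vs))) (act (direct_sum_rep Ws) g)"
proof -
  have "act (direct_sum_rep Vs) g \<in> carrier_mat (deg (direct_sum_rep Vs)) (deg (direct_sum_rep Vs))"
    "act (direct_sum_rep Ws) g \<in> carrier_mat (deg (direct_sum_rep Ws)) (deg (direct_sum_rep Ws))"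
    using assms by (auto intro!: act_direct_sum_carrier)
  moreover have "act (direct_sum_rep (Vs @ Ws)) g = diag_block_mat (map (\<lambda>V. act V g) Vs @ map (\<lambda>V. act V g) Ws)"
    "act (direct_sum_rep Vs) g = diag_block_mat (map (\<lambda>V. act V g) Vs)"
    "act (direct_sum_rep Ws) g = diag_block_mat (map (\<lambda>V. act V g) Ws)"
    by (simp_all add: direct_sum_rep_def)
  ultimately show ?thesis by (simp add: diag_block_mat_append Let_def)
qed

lemma append_rows_mult:
  fixes X Y A :: "complex mat"
  assumes X: "X \<in> carrier_mat r d" and Y: "Y \<in> carrier_mat r' d" and A: "A \<in> carrier_mat d e"
  shows "(X @\<^sub>r Y) * A = (X * A) @\<^sub>r (Y * A)"
proof (rule eq_matI)
  fix i j assume "i < dim_row ((X * A) @\<^sub>r (Y * A))" "j < dim_col ((X * A) @\<^sub>r (Y * A))"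
  then show "((X @\<^sub>r Y) * A) $$ (i, j) = ((X * A) @\<^sub>r (Y * A)) $$ (i, j)"
    using X Y A by (auto simp: append_rows_def scalar_prod_def)
qed (use X Y A in \<open>auto simp: append_rows_def\<close>)

lemma four_block_diag_mult_append_rows:
  fixes X Y A B :: "complex mat"
  assumes X: "X \<in> carrier_mat r d" and Y: "Y \<in> carrier_mat r' d"
    and A: "A \<in> carrier_mat r r" and B: "B \<in> carrier_mat r' r'"
  shows "four_block_mat A (0\<^sub>m r r') (0\<^sub>m r' r) B * (X @\<^sub>r Y) = (A * X) @\<^sub>r (B * Y)"
proof -
  have "four_block_mat A (0\<^sub>m r r') (0\<^sub>m r' r) B * four_block_mat X (0\<^sub>m r 0) Y (0\<^sub>m r' 0) =
    four_block_mat (A * X + 0\<^sub>m r r' * Y) (A * 0\<^sub>m r 0 + 0\<^sub>m r r' * 0\<^sub>m r' 0)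
      (0\<^sub>m r' r * X + B * Y) (0\<^sub>m r' r * 0\<^sub>m r 0 + B * 0\<^sub>m r' 0)"
    using assms by (intro mult_four_block_mat) auto
  also have "\<dots> = four_block_mat (A * X) (0\<^sub>m r 0) (B * Y) (0\<^sub>m r' 0)"
    using assms by (intro cong_four_block_mat) auto
  finally show ?thesis using assms by (simp add: append_rows_def)
qed

lemma append_rows_unitary:
  fixes X Y :: "complex mat"
  assumes X: "X \<in> carrier_mat r d" and Y: "Y \<in> carrier_mat r' d"
    and XX: "X * mat_adjoint X = 1\<^sub>m r" and YY: "Y * mat_adjoint Y = 1\<^sub>m r'"
    and XY: "X * mat_adjoint Y = 0\<^sub>m r r'"
    and complete: "mat_adjoint X * X + mat_adjoint Y * Y = 1\<^sub>m d"
  shows "(X @\<^sub>r Y) * mat_adjoint (X @\<^sub>r Y) = 1\<^sub>m (r + r')"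
    and "mat_adjoint (X @\<^sub>r Y) * (X @\<^sub>r Y) = 1\<^sub>m d"
proof -
  have adj: "mat_adjoint (X @\<^sub>r Y) = four_block_mat (mat_adjoint X) (mat_adjoint Y) (0\<^sub>m 0 r) (0\<^sub>m 0 r')"
    using X Y by (intro eq_matI) (auto simp: append_rows_def)
  have "mat_adjoint (X * mat_adjoint Y) = Y * mat_adjoint X"
    using X Y by (subst mat_adjoint_mult[of _ r d _ r']) auto
  then have YX: "Y * mat_adjoint X = 0\<^sub>m r' r" unfolding XY by simp
  have "four_block_mat X (0\<^sub>m r 0) Y (0\<^sub>m r' 0) *
      four_block_mat (mat_adjoint X) (mat_adjoint Y) (0\<^sub>m 0 r) (0\<^sub>m 0 r') =
    four_block_mat (X * mat_adjoint X + 0\<^sub>m r 0 * 0\<^sub>m 0 r) (X * mat_adjoint Y + 0\<^sub>m r 0 * 0\<^sub>m 0 r')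
      (Y * mat_adjoint X + 0\<^sub>m r' 0 * 0\<^sub>m 0 r) (Y * mat_adjoint Y + 0\<^sub>m r' 0 * 0\<^sub>m 0 r')"
    using X Y by (intro mult_four_block_mat) auto
  also have "\<dots> = 1\<^sub>m (r + r')" by (simp add: XX YY XY YX)
  finally show "(X @\<^sub>r Y) * mat_adjoint (X @\<^sub>r Y) = 1\<^sub>m (r + r')"
    unfolding adj using X Y by (simp add: append_rows_def)
  have "four_block_mat (mat_adjoint X) (mat_adjoint Y) (0\<^sub>m 0 r) (0\<^sub>m 0 r') *
      four_block_mat X (0\<^sub>m r 0) Y (0\<^sub>m r' 0) =
    four_block_mat (mat_adjoint X * X + mat_adjoint Y * Y) (mat_adjoint X * 0\<^sub>m r 0 + mat_adjoint Y * 0\<^sub>m r' 0)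
      (0\<^sub>m 0 r * X + 0\<^sub>m 0 r' * Y) (0\<^sub>m 0 r * 0\<^sub>m r 0 + 0\<^sub>m 0 r' * 0\<^sub>m r' 0)"
    using X Y by (intro mult_four_block_mat) auto
  also have "\<dots> = 1\<^sub>m d" unfolding complete by (intro eq_matI) auto
  finally show "mat_adjoint (X @\<^sub>r Y) * (X @\<^sub>r Y) = 1\<^sub>m d"
    unfolding adj using X Y by (simp add: append_rows_def)
qed

text \<open>
  If \<open>T\<close> and \<open>T'\<close> decompose the representations on \<open>W\<close> and on its complement, then stacking the rows of
  \<open>T Q\<^sup>*\<close> on those of \<open>T' Q'\<^sup>*\<close> decomposes the whole representation.
\<close>

lemma unitary_equiv_split:
  assumes V: "star_rep n M V"
    and Q: "isometry_onto (deg V) k Q W" and Q': "isometry_onto (deg V) k' Q' (orth_compl (deg V) W)"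
    and W: "W \<subseteq> carrier_vec (deg V)" and inv: "invariant (GL n) V W"
    and Vs: "\<And>U. U \<in> set (Vs @ Ws) \<Longrightarrow> star_rep n M U"
    and S: "unitary_equiv (GL n) (sub_rep V Q) (direct_sum_rep Vs)"
    and S': "unitary_equiv (GL n) (sub_rep V Q') (direct_sum_rep Ws)"
  shows "unitary_equiv (GL n) V (direct_sum_rep (Vs @ Ws))"
proof -
  let ?d = "deg V" and ?r = "deg (direct_sum_rep Vs)" and ?r' = "deg (direct_sum_rep Ws)"
  note inv' = invariant_orth_compl[OF V W inv]
  have half: "X \<in> carrier_mat r ?d \<and> X * mat_adjoint X = 1\<^sub>m r \<and> mat_adjoint X * X = R * mat_adjoint R \<and>
      (\<forall>g\<in>GL n. X * act V g = act Z g * X)"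
    if R: "isometry_onto ?d l R Y" and iY: "invariant (GL n) V Y" and T: "T \<in> carrier_mat r l"
      and TT: "T * mat_adjoint T = 1\<^sub>m r" "mat_adjoint T * T = 1\<^sub>m l"
      and int: "\<forall>g\<in>GL n. T * act (sub_rep V R) g = act Z g * T"
      and Zc: "\<And>g. g \<in> GL n \<Longrightarrow> act Z g \<in> carrier_mat r r" and X: "X = T * mat_adjoint R"
    for l R Y T r Z X
  proof (intro conjI ballI)
    note Rc = isometry_ontoD(1)[OF R] and RR = isometry_ontoD(2)[OF R]
    show Xc: "X \<in> carrier_mat r ?d" using T Rc X by auto
    have adjX: "mat_adjoint X = R * mat_adjoint T" unfolding X using T Rc by (subst mat_adjoint_mult) auto
    have "X * mat_adjoint X = T * (mat_adjoint R * (R * mat_adjoint T))"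
      unfolding adjX unfolding X using T Rc by (intro assoc_mult_mat[of _ r l _ ?d _ r]) auto
    also have "mat_adjoint R * (R * mat_adjoint T) = mat_adjoint R * R * mat_adjoint T"
      using T Rc by (intro assoc_mult_mat[symmetric, of _ l ?d _ l _ r]) auto
    also have "T * \<dots> = 1\<^sub>m r" using T RR TT by simp
    finally show "X * mat_adjoint X = 1\<^sub>m r" .
    have "mat_adjoint X * X = R * (mat_adjoint T * (T * mat_adjoint R))"
      unfolding adjX unfolding X using T Rc by (intro assoc_mult_mat[of _ ?d l _ r _ ?d]) auto
    also have "mat_adjoint T * (T * mat_adjoint R) = mat_adjoint T * T * mat_adjoint R"
      using T Rc by (intro assoc_mult_mat[symmetric, of _ l r _ l _ ?d]) auto
    finally show "mat_adjoint X * X = R * mat_adjoint R" using TT Rc by simp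
    fix g assume g: "g \<in> GL n"
    have U: "act (sub_rep V R) g \<in> carrier_mat l l" using Rc by (auto simp: sub_rep_def)
    have "X * act V g = T * (mat_adjoint R * act V g)"
      unfolding X using T Rc star_repD(2)[OF V g] by (intro assoc_mult_mat) auto
    also have "\<dots> = T * (act (sub_rep V R) g * mat_adjoint R)"
      by (simp only: sub_rep_intertwines(2)[OF V R iY g])
    also have "\<dots> = T * act (sub_rep V R) g * mat_adjoint R"
      using T Rc U by (intro assoc_mult_mat[symmetric]) auto
    also have "\<dots> = act Z g * T * mat_adjoint R" using int g by simp
    also have "\<dots> = act Z g * X" unfolding X using Zc[OF g] T Rc by (intro assoc_mult_mat) auto
    finally show "X * act V g = act Z g * X" .
  qed
  obtain T where T: "T \<in> carrier_mat ?r k" "T * mat_adjoint T = 1\<^sub>m ?r" "mat_adjoint T * T = 1\<^sub>m k"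
    "\<forall>g\<in>GL n. T * act (sub_rep V Q) g = act (direct_sum_rep Vs) g * T"
    using S unfolding unitary_equiv_def deg_sub_rep[OF Q] by blast
  obtain T' where T': "T' \<in> carrier_mat ?r' k'" "T' * mat_adjoint T' = 1\<^sub>m ?r'" "mat_adjoint T' * T' = 1\<^sub>m k'"
    "\<forall>g\<in>GL n. T' * act (sub_rep V Q') g = act (direct_sum_rep Ws) g * T'"
    using S' unfolding unitary_equiv_def deg_sub_rep[OF Q'] by blast
  define X where "X = T * mat_adjoint Q"
  define Y where "Y = T' * mat_adjoint Q'"
  have Vsc: "act (direct_sum_rep Vs) g \<in> carrier_mat ?r ?r" and Wsc: "act (direct_sum_rep Ws) g \<in> carrier_mat ?r' ?r'"
    if "g \<in> GL n" for g
    using that Vs by (auto intro!: act_direct_sum_carrier star_repD(2))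
  have X: "X \<in> carrier_mat ?r ?d" "X * mat_adjoint X = 1\<^sub>m ?r" "mat_adjoint X * X = Q * mat_adjoint Q"
    "\<And>g. g \<in> GL n \<Longrightarrow> X * act V g = act (direct_sum_rep Vs) g * X"
    using half[OF Q inv T(1-4) Vsc X_def] by auto
  have Y: "Y \<in> carrier_mat ?r' ?d" "Y * mat_adjoint Y = 1\<^sub>m ?r'" "mat_adjoint Y * Y = Q' * mat_adjoint Q'"
    "\<And>g. g \<in> GL n \<Longrightarrow> Y * act V g = act (direct_sum_rep Ws) g * Y"
    using half[OF Q' inv' T'(1-4) Wsc Y_def] by auto
  note Qc = isometry_ontoD(1)[OF Q] and Q'c = isometry_ontoD(1)[OF Q']
  have "X * mat_adjoint Y = T * mat_adjoint Q * (Q' * mat_adjoint T')"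
    unfolding X_def Y_def using T'(1) Q'c by (subst mat_adjoint_mult[of _ ?r' k' _ ?d]) auto
  also have "\<dots> = T * (mat_adjoint Q * (Q' * mat_adjoint T'))"
    using T(1) T'(1) Qc Q'c by (intro assoc_mult_mat[of _ ?r k _ ?d _ ?r']) auto
  also have "mat_adjoint Q * (Q' * mat_adjoint T') = mat_adjoint Q * Q' * mat_adjoint T'"
    using T'(1) Qc Q'c by (intro assoc_mult_mat[symmetric, of _ k ?d _ k' _ ?r']) auto
  also have "\<dots> = 0\<^sub>m k ?r'" unfolding isometry_onto_orthogonal(1)[OF Q Q'] using T'(1) by auto
  also have "T * 0\<^sub>m k ?r' = 0\<^sub>m ?r ?r'" using T(1) by auto
  finally have XY: "X * mat_adjoint Y = 0\<^sub>m ?r ?r'" .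
  have complete: "mat_adjoint X * X + mat_adjoint Y * Y = 1\<^sub>m ?d"
    unfolding X(3) Y(3) by (rule isometry_onto_complete[OF Q Q' W])
  have "(X @\<^sub>r Y) * act V g = act (direct_sum_rep (Vs @ Ws)) g * (X @\<^sub>r Y)" if g: "g \<in> GL n" for g
  proof -
    have "act (direct_sum_rep (Vs @ Ws)) g * (X @\<^sub>r Y) =
        (act (direct_sum_rep Vs) g * X) @\<^sub>r (act (direct_sum_rep Ws) g * Y)"
      using four_block_diag_mult_append_rows[OF X(1) Y(1) Vsc[OF g] Wsc[OF g]]
        act_direct_sum_append[of Vs Ws g] star_repD(2)[OF Vs g] by auto
    also have "\<dots> = (X @\<^sub>r Y) * act V g"
      using append_rows_mult[OF X(1) Y(1) star_repD(2)[OF V g]] X(4)[OF g] Y(4)[OF g] by simp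
    finally show ?thesis by simp
  qed
  then show ?thesis
    unfolding unitary_equiv_def deg_direct_sum_append
    using append_rows_unitary[OF X(1) Y(1) X(2) Y(2) XY complete] X(1) Y(1)
    by (intro bexI[of _ "X @\<^sub>r Y"]) auto
qed

text \<open>
  A way of saying that every weight has at most one highest weight vector up to scalars which, by
  \<open>orth_free_sub_rep\<close>, passes to subrepresentations at once and is contradicted by two orthogonal
  summands with a common highest weight.
\<close>

definition orth_free :: "nat \<Rightarrow> rep \<Rightarrow> bool" where
  "orth_free n V \<longleftrightarrow> (\<forall>\<nu> w w'. hw_vector n V \<nu> w \<longrightarrow> hw_vector n V \<nu> w' \<longrightarrow> w \<bullet>c w' \<noteq> 0)"

lemma hw_vector_carrier: "hw_vector n V \<nu> w \<Longrightarrow> w \<in> carrier_vec (deg V)"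
  by (simp add: hw_vector_def)

lemma orth_free_sub_rep:
  assumes V: "star_rep n M V" and Q: "isometry_onto (deg V) k Q W" and inv: "invariant (GL n) V W"
    and free: "orth_free n V"
  shows "orth_free n (sub_rep V Q)"
  unfolding orth_free_def
proof (intro allI impI)
  fix \<nu> w w' assume w: "hw_vector n (sub_rep V Q) \<nu> w" "hw_vector n (sub_rep V Q) \<nu> w'"
  note Qc = isometry_ontoD(1)[OF Q]
  have c: "w \<in> carrier_vec k" "w' \<in> carrier_vec k"
    using w hw_vector_carrier deg_sub_rep[OF Q] by metis+
  have "(Q *\<^sub>v w) \<bullet>c (Q *\<^sub>v w') = w \<bullet>c (mat_adjoint Q *\<^sub>v (Q *\<^sub>v w'))"
    using Qc c by (intro cscalar_adjoint[of _ "deg V" k]) auto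
  also have "mat_adjoint Q *\<^sub>v (Q *\<^sub>v w') = w'" using isometry_inj[OF Qc isometry_ontoD(2)[OF Q] c(2)] .
  finally show "w \<bullet>c w' \<noteq> 0"
    using free hw_vector_sub_rep[OF V Q inv w(1)] hw_vector_sub_rep[OF V Q inv w(2)]
    by (auto simp: orth_free_def)
qed

lemma lin_subspace_carrier: "lin_subspace d (carrier_vec d)"
  by (auto simp: lin_subspace_def)

lemma isometry_onto_full:
  assumes Q: "isometry_onto d k Q W" and W: "W \<subseteq> carrier_vec d" and one: "Q * mat_adjoint Q = 1\<^sub>m d"
  shows "W = carrier_vec d"
proof -
  note Qc = isometry_ontoD(1)[OF Q]
  have "x \<in> W" if x: "x \<in> carrier_vec d" for x :: "complex vec"
  proof -
    have "x = (Q * mat_adjoint Q) *\<^sub>v x" using x one by simp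
    also have "\<dots> = Q *\<^sub>v (mat_adjoint Q *\<^sub>v x)" using Qc x by (intro assoc_mult_mat_vec) auto
    finally show ?thesis using isometry_ontoD(3)[OF Q, of "mat_adjoint Q *\<^sub>v x"] Qc by simp
  qed
  then show ?thesis using W by auto
qed

lemma isometry_onto_dim_less:
  assumes Q: "isometry_onto d k Q W" and W: "W \<subseteq> carrier_vec d" "W \<noteq> carrier_vec d"
  shows "k < d"
proof (rule ccontr)
  note Qc = isometry_ontoD(1)[OF Q] and QQ = isometry_ontoD(2)[OF Q]
  assume "\<not> k < d"
  then have "k = d" using isometry_dim_le[OF Qc QQ] by simp
  then have "Q * mat_adjoint Q = 1\<^sub>m d"
    using mat_mult_left_right_inverse[of "mat_adjoint Q" d Q] Qc QQ by auto
  then show False using isometry_onto_full[OF Q W(1)] W(2) by simp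
qed

lemma orth_compl_eq_carrier:
  assumes "lin_subspace d W" "orth_compl d W = carrier_vec d"
  shows "W = {0\<^sub>v d}"
proof -
  have "w = 0\<^sub>v d" if "w \<in> W" for w
  proof -
    have wc: "w \<in> carrier_vec d" using assms(1) that by (auto simp: lin_subspace_def)
    then have "w \<in> orth_compl d W" using assms(2) by simp
    then have "w \<bullet>c w = 0" using that by (simp add: orth_compl_def)
    then show ?thesis using cscalar_zero_iff[OF wc] by simp
  qed
  then show ?thesis using assms(1) by (auto simp: lin_subspace_def)
qed

lemma orth_compl_eq_zero:
  assumes W: "lin_subspace d W" and z: "orth_compl d W = {0\<^sub>v d}"
  shows "W = carrier_vec d"
proof -
  have Wc: "W \<subseteq> carrier_vec d" using W by (simp add: lin_subspace_def)
  obtain k Q where Q: "isometry_onto d k Q W" using isometry_onto_exists[OF W] by blast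
  \<comment> \<open>The zero subspace is the range of the isometry with no columns.\<close>
  have null: "isometry_onto d 0 (0\<^sub>m d 0) (orth_compl d W)"
    unfolding isometry_onto_def z by (auto intro!: eq_matI eq_vecI simp: scalar_prod_def)
  have "0\<^sub>m d 0 * mat_adjoint (0\<^sub>m d 0) = (0\<^sub>m d d :: complex mat)"
    by (intro eq_matI) (auto simp: scalar_prod_def)
  then have "Q * mat_adjoint Q = 1\<^sub>m d"
    using isometry_onto_complete[OF Q null Wc] isometry_ontoD(1)[OF Q] by simp
  then show ?thesis by (rule isometry_onto_full[OF Q Wc])
qed

lemma hw_vector_exists:
  assumes V: "star_rep n M V" and W: "lin_subspace (deg V) W" and inv: "invariant (GL n) V W"
    and ne: "W \<noteq> {0\<^sub>v (deg V)}"
  shows "\<exists>\<nu>. \<exists>w\<in>W. hw_vector n V \<nu> w"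
proof (rule highest_weight_vector_exists[OF star_repD(5)[OF V] _ W _ ne])
  fix b assume "b \<in> borel n"
  then have g: "b \<in> GL n" using borel_subset_GL by auto
  then show "act V b \<in> carrier_mat (deg V) (deg V)" by (rule star_repD(2)[OF V])
  show "act V b *\<^sub>v w \<in> W" if "w \<in> W" for w using inv g that by (auto simp: invariant_def)
qed

lemma invariant_carrier:
  assumes "star_rep n M V"
  shows "invariant (GL n) V (carrier_vec (deg V))"
  using star_repD(2)[OF assms] by (fastforce simp: invariant_def)

text \<open>
  Induction on the dimension: a reducible representation splits into an invariant subspace and its
  complement, both of smaller dimension. A weight that occurred in both halves would come from two orthogonal
  highest weight vectors, so distinctness of the weights is inherited from the halves.
\<close>

theorem decomposition_exists:
  assumes "star_rep n M V"
  shows "\<exists>Vs \<nu>s. list_all2 (\<lambda>U \<nu>. star_rep n M U \<and> irreducible_rep n (GL n) U \<and> (\<exists>w. hw_vector n U \<nu> w)) Vs \<nu>s \<and>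
     unitary_equiv (GL n) V (direct_sum_rep Vs) \<and> (\<forall>\<nu>\<in>set \<nu>s. \<exists>w. hw_vector n V \<nu> w) \<and>
     (orth_free n V \<longrightarrow> distinct \<nu>s)"
  using assms
proof (induction "deg V" arbitrary: V rule: less_induct)
  case less
  note V = less.prems
  consider "deg V = 0" | "deg V > 0" "irreducible_rep n (GL n) V" | "deg V > 0" "\<not> irreducible_rep n (GL n) V"
    by blast
  then show ?case
  proof cases
    case 1
    have "unitary_equiv (GL n) V (direct_sum_rep [])"
      unfolding unitary_equiv_def
    proof (intro bexI[of _ "0\<^sub>m 0 0"] conjI ballI)
      fix g assume "g \<in> GL n"
      then show "0\<^sub>m 0 0 * act V g = act (direct_sum_rep []) g * 0\<^sub>m 0 0"
        using star_repD(2)[OF V] 1 by (intro eq_matI) (auto simp: direct_sum_rep_def)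
    qed (use 1 in \<open>auto simp: direct_sum_rep_def intro!: eq_matI\<close>)
    then show ?thesis by (intro exI[of _ "[]"]) simp
  next
    case 2
    have "carrier_vec (deg V) \<noteq> {0\<^sub>v (deg V) :: complex vec}"
    proof
      assume "carrier_vec (deg V) = {0\<^sub>v (deg V) :: complex vec}"
      then have "unit_vec (deg V) 0 = (0\<^sub>v (deg V) :: complex vec)" using unit_vec_carrier by blast
      then have "unit_vec (deg V) 0 $ 0 = (0\<^sub>v (deg V) :: complex vec) $ 0" by simp
      then show False using 2 by simp
    qed
    then obtain \<nu> w where w: "hw_vector n V \<nu> w"
      using hw_vector_exists[OF V lin_subspace_carrier invariant_carrier[OF V]] by blast
    have "unitary_equiv (GL n) V (direct_sum_rep [V])"
      unfolding unitary_equiv_def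
    proof (intro bexI[of _ "1\<^sub>m (deg V)"] conjI ballI)
      fix g assume g: "g \<in> GL n"
      show "1\<^sub>m (deg V) * act V g = act (direct_sum_rep [V]) g * 1\<^sub>m (deg V)"
        using left_mult_one_mat[OF star_repD(2)[OF V g]] right_mult_one_mat[OF star_repD(2)[OF V g]]
        by (simp only: direct_sum_rep_def rep.simps list.map diag_block_mat_singleton)
    qed (auto simp: direct_sum_rep_def)
    then show ?thesis using V 2 w by (intro exI[of _ "[V]"] exI[of _ "[\<nu>]"]) auto
  next
    case 3
    let ?d = "deg V"
    obtain W where W: "lin_subspace ?d W" and inv: "invariant (GL n) V W"
      and ne: "W \<noteq> {0\<^sub>v ?d}" "W \<noteq> carrier_vec ?d"
      using 3 star_repD(1)[OF V] unfolding irreducible_rep_def invariant_def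
      by (auto dest: subspace_imp_lin_subspace)
    have Wc: "W \<subseteq> carrier_vec ?d" using W by (simp add: lin_subspace_def)
    note inv' = invariant_orth_compl[OF V Wc inv]
    obtain k Q where Q: "isometry_onto ?d k Q W" using isometry_onto_exists[OF W] by blast
    obtain k' Q' where Q': "isometry_onto ?d k' Q' (orth_compl ?d W)"
      using isometry_onto_exists[OF lin_subspace_orth_compl[OF Wc]] by blast
    have k: "k < ?d" using isometry_onto_dim_less[OF Q Wc ne(2)] .
    have "orth_compl ?d W \<noteq> carrier_vec ?d" using orth_compl_eq_carrier[OF W] ne(1) by blast
    then have k': "k' < ?d" using isometry_onto_dim_less[OF Q'] by (auto simp: orth_compl_def)
    note U = star_rep_sub_rep[OF V Q inv] and U' = star_rep_sub_rep[OF V Q' inv']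
    have less_k: "deg (sub_rep V Q) < ?d" and less_k': "deg (sub_rep V Q') < ?d"
      using k k' deg_sub_rep[OF Q] deg_sub_rep[OF Q'] by simp_all
    obtain Vs \<nu>s where 1: "list_all2 (\<lambda>U \<nu>. star_rep n M U \<and> irreducible_rep n (GL n) U \<and> (\<exists>w. hw_vector n U \<nu> w)) Vs \<nu>s"
      "unitary_equiv (GL n) (sub_rep V Q) (direct_sum_rep Vs)" "\<forall>\<nu>\<in>set \<nu>s. \<exists>w. hw_vector n (sub_rep V Q) \<nu> w"
      "orth_free n (sub_rep V Q) \<longrightarrow> distinct \<nu>s"
      using less.hyps[OF less_k U] by (elim exE conjE)
    obtain Ws \<mu>s where 2: "list_all2 (\<lambda>U \<nu>. star_rep n M U \<and> irreducible_rep n (GL n) U \<and> (\<exists>w. hw_vector n U \<nu> w)) Ws \<mu>s"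
      "unitary_equiv (GL n) (sub_rep V Q') (direct_sum_rep Ws)" "\<forall>\<nu>\<in>set \<mu>s. \<exists>w. hw_vector n (sub_rep V Q') \<nu> w"
      "orth_free n (sub_rep V Q') \<longrightarrow> distinct \<mu>s"
      using less.hyps[OF less_k' U'] by (elim exE conjE)
    have in_W: "\<exists>w\<in>W. hw_vector n V \<nu> w" if mem: "\<nu> \<in> set \<nu>s" for \<nu>
    proof -
      obtain w where w: "hw_vector n (sub_rep V Q) \<nu> w" using 1(3) mem by blast
      have "Q *\<^sub>v w \<in> W"
        using hw_vector_carrier[OF w] by (intro isometry_ontoD(3)[OF Q]) (simp only: deg_sub_rep[OF Q])
      then show ?thesis using hw_vector_sub_rep[OF V Q inv w] by (rule bexI[rotated])
    qed
    have in_W': "\<exists>w\<in>orth_compl ?d W. hw_vector n V \<nu> w" if mem: "\<nu> \<in> set \<mu>s" for \<nu>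
    proof -
      obtain w where w: "hw_vector n (sub_rep V Q') \<nu> w" using 2(3) mem by blast
      have "Q' *\<^sub>v w \<in> orth_compl ?d W"
        using hw_vector_carrier[OF w] by (intro isometry_ontoD(3)[OF Q']) (simp only: deg_sub_rep[OF Q'])
      then show ?thesis using hw_vector_sub_rep[OF V Q' inv' w] by (rule bexI[rotated])
    qed
    have "distinct (\<nu>s @ \<mu>s)" if free: "orth_free n V"
    proof -
      have "set \<nu>s \<inter> set \<mu>s = {}"
      proof (rule ccontr)
        assume "set \<nu>s \<inter> set \<mu>s \<noteq> {}"
        then obtain \<nu> where "\<nu> \<in> set \<nu>s" "\<nu> \<in> set \<mu>s" by blast
        then obtain w w' where "w \<in> W" "hw_vector n V \<nu> w" "w' \<in> orth_compl ?d W" "hw_vector n V \<nu> w'"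
          using in_W in_W' by blast
        then show False using free unfolding orth_free_def orth_compl_def by blast
      qed
      then show ?thesis using 1(4) 2(4) orth_free_sub_rep[OF V Q inv free] orth_free_sub_rep[OF V Q' inv' free]
        by simp
    qed
    moreover have "unitary_equiv (GL n) V (direct_sum_rep (Vs @ Ws))"
    proof (rule unitary_equiv_split[OF V Q Q' Wc inv _ 1(2) 2(2)])
      fix U assume "U \<in> set (Vs @ Ws)"
      then show "star_rep n M U" using 1(1) 2(1) by (auto simp: list_all2_conv_all_nth in_set_conv_nth)
    qed
    moreover have "\<forall>\<nu>\<in>set (\<nu>s @ \<mu>s). \<exists>w. hw_vector n V \<nu> w" using in_W in_W' by auto
    ultimately show ?thesis using list_all2_appendI[OF 1(1) 2(1)] by blast
  qed
qed

section \<open>Coherent states and symmetric powers\<close>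

text \<open>
  \<open>\<psi>\<close> plays the role of \<open>x \<mapsto> x \<otimes> \<dots> \<otimes> x\<close> (\<open>N\<close> factors), the coherent state map of the symmetric
  power of degree \<open>N\<close>. That the values of \<open>\<psi>\<close> span is expressed by the vanishing of their common orthogonal
  complement, and polynomiality by restriction to lines; both forms survive the passage to a
  subrepresentation, and both are what density arguments use.
\<close>

definition coherent :: "nat \<Rightarrow> nat \<Rightarrow> rep \<Rightarrow> (complex vec \<Rightarrow> complex vec) \<Rightarrow> bool" where
  "coherent n N V \<psi> \<longleftrightarrow> star_rep n N V \<and>
     (\<forall>x\<in>carrier_vec n. \<psi> x \<in> carrier_vec (deg V)) \<and>
     (\<forall>g\<in>GL n. \<forall>x\<in>carrier_vec n. act V g *\<^sub>v \<psi> x = \<psi> (g *\<^sub>v x)) \<and>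
     (\<forall>w\<in>carrier_vec (deg V). (\<forall>x\<in>carrier_vec n. \<psi> x \<bullet>c w = 0) \<longrightarrow> w = 0\<^sub>v (deg V)) \<and>
     (\<forall>x\<in>carrier_vec n. \<forall>v\<in>carrier_vec n. \<forall>i<deg V.
        \<exists>p. degree p \<le> N \<and> (\<forall>s. \<psi> (x + s \<cdot>\<^sub>v v) $ i = poly p s)) \<and>
     \<psi> (unit_vec n 0) \<noteq> 0\<^sub>v (deg V)"

lemma coherentD:
  assumes "coherent n N V \<psi>"
  shows "star_rep n N V"
    and "x \<in> carrier_vec n \<Longrightarrow> \<psi> x \<in> carrier_vec (deg V)"
    and "g \<in> GL n \<Longrightarrow> x \<in> carrier_vec n \<Longrightarrow> act V g *\<^sub>v \<psi> x = \<psi> (g *\<^sub>v x)"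
    and "w \<in> carrier_vec (deg V) \<Longrightarrow> (\<And>x. x \<in> carrier_vec n \<Longrightarrow> \<psi> x \<bullet>c w = 0) \<Longrightarrow> w = 0\<^sub>v (deg V)"
    and "x \<in> carrier_vec n \<Longrightarrow> v \<in> carrier_vec n \<Longrightarrow> i < deg V \<Longrightarrow>
        \<exists>p. degree p \<le> N \<and> (\<forall>s. \<psi> (x + s \<cdot>\<^sub>v v) $ i = poly p s)"
    and "\<psi> (unit_vec n 0) \<noteq> 0\<^sub>v (deg V)"
  using assms unfolding coherent_def by blast+

lemma poly_linear_combination:
  fixes f :: "nat \<Rightarrow> complex \<Rightarrow> complex"
  assumes "\<And>i. i < D \<Longrightarrow> \<exists>p. degree p \<le> N \<and> (\<forall>s. f i s = poly p s)"
  shows "\<exists>p. degree p \<le> N \<and> (\<forall>s. (\<Sum>i<D. f i s * c i) = poly p s)"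
proof -
  from assms have "\<forall>i\<in>{..<D}. \<exists>p. degree p \<le> N \<and> (\<forall>s. f i s = poly p s)" by auto
  then obtain P where P: "\<forall>i\<in>{..<D}. degree (P i) \<le> N \<and> (\<forall>s. f i s = poly (P i) s)"
    by (auto dest!: bchoice)
  have "degree (\<Sum>i<D. smult (c i) (P i)) \<le> N"
    using P by (intro degree_sum_le) (auto intro: order_trans[OF degree_smult_le])
  moreover have "(\<Sum>i<D. f i s * c i) = poly (\<Sum>i<D. smult (c i) (P i)) s" for s
    using P by (simp add: poly_sum mult.commute)
  ultimately show ?thesis by blast
qed

lemma coherent_line_cscalar:
  assumes V: "coherent n N V \<psi>" and x: "x \<in> carrier_vec n" and v: "v \<in> carrier_vec n"
    and w: "w \<in> carrier_vec (deg V)"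
  shows "\<exists>p. degree p \<le> N \<and> (\<forall>s. \<psi> (x + s \<cdot>\<^sub>v v) \<bullet>c w = poly p s)"
proof -
  have "\<psi> (x + s \<cdot>\<^sub>v v) \<bullet>c w = (\<Sum>i<deg V. \<psi> (x + s \<cdot>\<^sub>v v) $ i * cnj (w $ i))" for s
    using coherentD(2)[OF V, of "x + s \<cdot>\<^sub>v v"] x v w by (auto simp: scalar_prod_def atLeast0LessThan)
  then show ?thesis
    using poly_linear_combination[where D = "deg V" and f = "\<lambda>i s. \<psi> (x + s \<cdot>\<^sub>v v) $ i" and c = "\<lambda>i. cnj (w $ i)",
        OF coherentD(5)[OF V x v]] by simp
qed

definition std_rep :: "nat \<Rightarrow> rep" where
  "std_rep n = \<lparr>deg = n, act = (\<lambda>g. g)\<rparr>"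

lemma deg_std_rep [simp]: "deg (std_rep n) = n"
  by (simp add: std_rep_def)

lemma coherent_std_rep:
  assumes n: "n \<ge> 1"
  shows "coherent n 1 (std_rep n) (\<lambda>x. x)"
proof -
  have "is_rep n (GL n) (std_rep n)"
    unfolding is_rep_def std_rep_def
  proof (intro conjI ballI allI impI)
    fix i j assume "i < deg \<lparr>deg = n, act = \<lambda>g. g\<rparr>" "j < deg \<lparr>deg = n, act = \<lambda>g. g\<rparr>"
    then show "\<exists>f\<in>regular_funs n. \<forall>g\<in>GL n. act \<lparr>deg = n, act = \<lambda>g. g\<rparr> g $$ (i, j) = f g"
      by (intro bexI[OF _ regular_funs.entry[of i n j]]) auto
  qed (auto simp: GL_iff)
  moreover have "triangular_flag n (std_rep n)"
  proof -
    have "(\<Prod>i<n. b $$ (i, i) ^ (if l = i then 1 else 0)) = b $$ (l, l)" if "l < n" for b :: "complex mat" and l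
    proof -
      have "(\<Prod>i<n. b $$ (i, i) ^ (if l = i then 1 else 0)) = (\<Prod>i\<in>{l}. b $$ (i, i) ^ (if l = i then 1 else 0))"
        using that by (intro prod.mono_neutral_right) auto
      then show ?thesis by simp
    qed
    then show ?thesis
      unfolding triangular_flag_def std_rep_def
      by (intro exI[of _ n] exI[of _ "1\<^sub>m n"] exI[of _ "\<lambda>b. b"] exI[of _ "\<lambda>l i. if l = i then 1 else 0"])
        (auto simp: borel_def GL_iff)
  qed
  ultimately have "star_rep n 1 (std_rep n)"
    unfolding star_rep_def by (auto simp: std_rep_def)
  moreover have "w = 0\<^sub>v n" if "w \<in> carrier_vec n" "\<forall>x\<in>carrier_vec n. x \<bullet>c w = 0" for w :: "complex vec"
    using that cscalar_zero_iff by blast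
  moreover have "\<exists>p. degree p \<le> 1 \<and> (\<forall>s. (x + s \<cdot>\<^sub>v v) $ i = poly p s)"
    if "x \<in> carrier_vec n" "v \<in> carrier_vec n" "i < n" for x v :: "complex vec" and i
    using that by (intro exI[of _ "[:x $ i, v $ i:]"]) auto
  moreover have "unit_vec n 0 \<noteq> (0\<^sub>v n :: complex vec)"
  proof
    assume "unit_vec n 0 = (0\<^sub>v n :: complex vec)"
    then have "unit_vec n 0 $ 0 = (0\<^sub>v n :: complex vec) $ 0" by simp
    then show False using n by simp
  qed
  ultimately show ?thesis unfolding coherent_def by (simp add: std_rep_def)
qed

text \<open>
  The next symmetric power is the subrepresentation of \<open>V \<otimes> \<complex>\<^sup>n\<close> spanned by the vectors
  \<open>s x = \<psi> x \<otimes> x\<close>. Taking the span as the double orthogonal complement \<open>W\<close> of their set makes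
  its invariance an instance of \<open>invariant_orth_compl\<close>, and a vector of \<open>W\<close> orthogonal to all
  \<open>s x\<close> is orthogonal to itself.
\<close>

lemma coherent_step:
  assumes n: "n \<ge> 1" and V: "coherent n N V \<psi>"
  shows "\<exists>V' \<psi>'. coherent n (Suc N) V' \<psi>'"
proof -
  let ?d = "deg V" and ?T = "tensor_rep V (std_rep n)"
  note std = coherent_std_rep[OF n]
  have degT: "deg ?T = ?d * n" by simp
  have T: "star_rep n (Suc N) ?T"
    using star_rep_tensor_rep[OF coherentD(1)[OF V] coherentD(1)[OF std]] by simp
  define s where "s x = kron_vec (\<psi> x) x" for x
  have sc: "s x \<in> carrier_vec (?d * n)" if "x \<in> carrier_vec n" for x
    unfolding s_def using coherentD(2)[OF V that] that by auto
  have sg: "act ?T g *\<^sub>v s x = s (g *\<^sub>v x)" if g: "g \<in> GL n" and x: "x \<in> carrier_vec n" for g x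
  proof -
    have Vg: "act V g \<in> carrier_mat ?d ?d" and gc: "g \<in> carrier_mat n n"
      using star_repD(2)[OF coherentD(1)[OF V] g] g by (auto simp: GL_iff)
    have "act ?T g = kron (act V g) g"
      using Vg gc by (subst act_tensor_rep) (auto simp: std_rep_def)
    then show ?thesis
      unfolding s_def using kron_mult_vec[OF Vg gc coherentD(2)[OF V x] x] coherentD(3)[OF V g x] by simp
  qed
  define S where "S = s ` carrier_vec n"
  have Sc: "S \<subseteq> carrier_vec (deg ?T)" using sc by (auto simp: S_def)
  have invS: "invariant (GL n) ?T S"
    unfolding invariant_def S_def using sg by (auto simp: GL_iff)
  define W0 where "W0 = orth_compl (deg ?T) S"
  \<comment> \<open>\<open>W\<close> is the span of \<open>S\<close>.\<close>
  define W where "W = orth_compl (deg ?T) W0"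
  have W0c: "W0 \<subseteq> carrier_vec (deg ?T)" by (auto simp: W0_def orth_compl_def)
  have invW: "invariant (GL n) ?T W"
    unfolding W_def by (rule invariant_orth_compl[OF T W0c]) (unfold W0_def, rule invariant_orth_compl[OF T Sc invS])
  have SW: "S \<subseteq> W"
  proof
    fix v assume v: "v \<in> S"
    then have vc: "v \<in> carrier_vec (deg ?T)" using Sc by auto
    have "v \<bullet>c w = 0" if w: "w \<in> W0" for w
    proof -
      have "w \<bullet>c v = 0" using w v by (auto simp: W0_def orth_compl_def)
      then show ?thesis using cscalar_swap[OF vc, of w] w W0c by auto
    qed
    then show "v \<in> W" using vc by (simp add: W_def orth_compl_def)
  qed
  have W_zero: "w = 0\<^sub>v (deg ?T)" if w: "w \<in> W" and z: "\<And>v. v \<in> S \<Longrightarrow> v \<bullet>c w = 0" for w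
  proof -
    have wc: "w \<in> carrier_vec (deg ?T)" using w by (auto simp: W_def orth_compl_def)
    have "w \<bullet>c v = 0" if "v \<in> S" for v using cscalar_swap[OF wc, of v] that Sc z by auto
    then have "w \<in> W0" using wc by (simp add: W0_def orth_compl_def)
    then have "w \<bullet>c w = 0" using w by (simp add: W_def orth_compl_def)
    then show ?thesis using cscalar_zero_iff[OF wc] by simp
  qed
  obtain k Q where Q: "isometry_onto (deg ?T) k Q W"
    using isometry_onto_exists[OF lin_subspace_orth_compl[OF W0c]] unfolding W_def by blast
  note Qc = isometry_ontoD(1)[OF Q] and QQ = isometry_ontoD(2)[OF Q]
  let ?U = "sub_rep ?T Q"
  have degU: "deg ?U = k" by (rule deg_sub_rep[OF Q])
  define \<psi>' where "\<psi>' x = mat_adjoint Q *\<^sub>v s x" for x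
  have sx: "s x \<in> carrier_vec (deg ?T)" "Q *\<^sub>v \<psi>' x = s x" if "x \<in> carrier_vec n" for x
    using that sc[OF that] SW isometry_ontoD(4)[OF Q, of "s x"] by (auto simp: S_def \<psi>'_def)
  have "coherent n (Suc N) ?U \<psi>'"
    unfolding coherent_def degU
  proof (intro conjI ballI allI impI)
    show "star_rep n (Suc N) ?U" by (rule star_rep_sub_rep[OF T Q invW])
    fix x :: "complex vec" assume x: "x \<in> carrier_vec n"
    show "\<psi>' x \<in> carrier_vec k" using Qc by (auto simp: \<psi>'_def)
  next
    fix g and x :: "complex vec" assume g: "g \<in> GL n" and x: "x \<in> carrier_vec n"
    have gx: "g *\<^sub>v x \<in> carrier_vec n" using g by (auto simp: GL_iff)
    have Uc: "act ?U g \<in> carrier_mat k k" using Qc by (auto simp: sub_rep_def)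
    have "act ?U g *\<^sub>v \<psi>' x = (act ?U g * mat_adjoint Q) *\<^sub>v s x"
      unfolding \<psi>'_def using Uc Qc sx(1)[OF x] by (intro assoc_mult_mat_vec[symmetric]) auto
    also have "\<dots> = (mat_adjoint Q * act ?T g) *\<^sub>v s x"
      by (simp only: sub_rep_intertwines(2)[OF T Q invW g])
    also have "\<dots> = mat_adjoint Q *\<^sub>v (act ?T g *\<^sub>v s x)"
      using Qc sx(1)[OF x] star_repD(2)[OF T g] by (intro assoc_mult_mat_vec) auto
    finally show "act ?U g *\<^sub>v \<psi>' x = \<psi>' (g *\<^sub>v x)" by (simp add: sg[OF g x] \<psi>'_def)
  next
    fix w :: "complex vec" assume w: "w \<in> carrier_vec k" and z: "\<forall>x\<in>carrier_vec n. \<psi>' x \<bullet>c w = 0"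
    have Qw: "Q *\<^sub>v w \<in> carrier_vec (deg ?T)" using Qc by auto
    have "v \<bullet>c (Q *\<^sub>v w) = 0" if v: "v \<in> S" for v
    proof -
      obtain x where x: "x \<in> carrier_vec n" "v = s x" using v by (auto simp: S_def)
      have "s x \<bullet>c (Q *\<^sub>v w) = \<psi>' x \<bullet>c w"
        unfolding \<psi>'_def using cscalar_adjoint[of "mat_adjoint Q" k "deg ?T" "s x" w] Qc sx(1)[OF x(1)] w by simp
      then show ?thesis using z x by simp
    qed
    then have "Q *\<^sub>v w = 0\<^sub>v (deg ?T)" using W_zero isometry_ontoD(3)[OF Q w] by blast
    then have "mat_adjoint Q *\<^sub>v (Q *\<^sub>v w) = 0\<^sub>v k" using Qc by auto
    then show "w = 0\<^sub>v k" using isometry_inj[OF Qc QQ w] by simp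
  next
    fix x v :: "complex vec" and i assume x: "x \<in> carrier_vec n" and v: "v \<in> carrier_vec n" and i: "i < k"
    have e: "\<psi>' (x + t \<cdot>\<^sub>v v) $ i = (\<Sum>l<?d * n. s (x + t \<cdot>\<^sub>v v) $ l * cnj (Q $$ (l, i)))" for t
      unfolding \<psi>'_def using Qc i sc[of "x + t \<cdot>\<^sub>v v"] x v
      by (auto simp: scalar_prod_def atLeast0LessThan mult.commute)
    show "\<exists>p. degree p \<le> Suc N \<and> (\<forall>t. \<psi>' (x + t \<cdot>\<^sub>v v) $ i = poly p t)"
      unfolding e
    proof (rule poly_linear_combination)
      fix l assume l: "l < ?d * n"
      note lm = div_mod_less_mult[OF l]
      obtain p where p: "degree p \<le> N" "\<And>t. \<psi> (x + t \<cdot>\<^sub>v v) $ (l div n) = poly p t"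
        using coherentD(5)[OF V x v lm(1)] by blast
      have "degree (p * [:x $ (l mod n), v $ (l mod n):]) \<le> Suc N"
        using p(1) degree_mult_le[of p "[:x $ (l mod n), v $ (l mod n):]"]
          degree_pCons_le[of "x $ (l mod n)" "[:v $ (l mod n):]"] by simp
      moreover have "s (x + t \<cdot>\<^sub>v v) $ l = poly (p * [:x $ (l mod n), v $ (l mod n):]) t" for t
        unfolding s_def using l lm x v coherentD(2)[OF V, of "x + t \<cdot>\<^sub>v v"] p(2)[of t]
        by (subst index_kron_vec[of _ ?d _ n]) (auto simp: algebra_simps)
      ultimately show "\<exists>p. degree p \<le> Suc N \<and> (\<forall>t. s (x + t \<cdot>\<^sub>v v) $ l = poly p t)" by blast
    qed
  next
    have e0: "unit_vec n 0 \<in> carrier_vec n" by simp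
    have "s (unit_vec n 0) \<noteq> 0\<^sub>v (?d * n)"
      unfolding s_def using coherentD(2)[OF V e0] coherentD(6)[OF V] coherentD(6)[OF std]
      by (intro kron_vec_nonzero) (auto simp: std_rep_def)
    moreover have "Q *\<^sub>v 0\<^sub>v k = 0\<^sub>v (?d * n)" using Qc by (intro eq_vecI) auto
    ultimately show "\<psi>' (unit_vec n 0) \<noteq> 0\<^sub>v k" using sx(2)[OF e0] by metis
  qed
  then show ?thesis by (intro exI)
qed

theorem coherent_exists:
  assumes "n \<ge> 1"
  shows "\<exists>V \<psi>. coherent n (Suc N) V \<psi>"
proof (induction N)
  case 0
  show ?case using coherent_std_rep[OF assms] by (intro exI) simp
next
  case (Suc N)
  then show ?case using coherent_step[OF assms] by (elim exE)
qed

section \<open>Highest weight vectors via polynomial functions\<close>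

lemma hw_vectorD:
  assumes "hw_vector n V \<nu> w"
  shows "w \<in> carrier_vec (deg V)" "w \<noteq> 0\<^sub>v (deg V)" "length \<nu> = n"
    and "b \<in> borel n \<Longrightarrow> act V b *\<^sub>v w = (\<Prod>i<n. (b $$ (i, i)) powi (\<nu> ! i)) \<cdot>\<^sub>v w"
  using assms by (auto simp: hw_vector_def)

text \<open>
  Read as a function of the orbit variable \<open>g\<close>, the pairing with a highest weight vector is a
  character of the lower triangular group.
\<close>

lemma hw_functional_transform:
  assumes V: "star_rep n M V" and w: "hw_vector n V \<nu> w" and v: "v \<in> carrier_vec (deg V)"
    and g: "g \<in> GL n" and b: "mat_adjoint g \<in> borel n"
  shows "(act V g *\<^sub>v v) \<bullet>c w = (\<Prod>i<n. (g $$ (i, i)) powi (\<nu> ! i)) * (v \<bullet>c w)"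
proof -
  have gc: "g \<in> carrier_mat n n" using g by (auto simp: GL_iff)
  have "(act V g *\<^sub>v v) \<bullet>c w = v \<bullet>c (mat_adjoint (act V g) *\<^sub>v w)"
    by (rule cscalar_adjoint[OF star_repD(2)[OF V g] v hw_vectorD(1)[OF w]])
  also have "mat_adjoint (act V g) *\<^sub>v w = (\<Prod>i<n. (mat_adjoint g $$ (i, i)) powi (\<nu> ! i)) \<cdot>\<^sub>v w"
    using hw_vectorD(4)[OF w b] star_repD(3)[OF V g] by simp
  also have "v \<bullet>c \<dots> = cnj (\<Prod>i<n. (mat_adjoint g $$ (i, i)) powi (\<nu> ! i)) * (v \<bullet>c w)"
    by (rule cscalar_smult_right[OF v hw_vectorD(1)[OF w]])
  also have "cnj (\<Prod>i<n. (mat_adjoint g $$ (i, i)) powi (\<nu> ! i)) = (\<Prod>i<n. (g $$ (i, i)) powi (\<nu> ! i))"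
    using gc by simp
  finally show ?thesis .
qed

text \<open>
  If one vector \<open>s\<close> pairs nontrivially with all highest weight vectors, two of the same weight are
  proportional: some combination of them is orthogonal to \<open>s\<close>, hence zero. Proportional nonzero vectors
  are not orthogonal.
\<close>

lemma orth_free_if_detecting:
  assumes s: "s \<in> carrier_vec (deg V)" and detect: "\<And>\<nu> w. hw_vector n V \<nu> w \<Longrightarrow> s \<bullet>c w \<noteq> 0"
    and Vc: "\<And>b. b \<in> borel n \<Longrightarrow> act V b \<in> carrier_mat (deg V) (deg V)"
  shows "orth_free n V"
  unfolding orth_free_def
proof (intro allI impI notI)
  fix \<nu> w w' assume w: "hw_vector n V \<nu> w" and w': "hw_vector n V \<nu> w'" and orth: "w \<bullet>c w' = 0"
  note c = hw_vectorD(1)[OF w] hw_vectorD(1)[OF w']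
  define a where "a = cnj ((s \<bullet>c w') / (s \<bullet>c w))"
  define u where "u = w' + (- a) \<cdot>\<^sub>v w"
  have uc: "u \<in> carrier_vec (deg V)" using c by (simp add: u_def)
  have "s \<bullet>c u = s \<bullet>c w' + cnj (- a) * (s \<bullet>c w)"
    unfolding u_def using c s by (simp add: cscalar_add_right[of _ "deg V"] cscalar_smult_right[of _ "deg V"])
  also have "\<dots> = 0" using detect[OF w] by (simp add: a_def)
  finally have su: "s \<bullet>c u = 0" .
  have "act V b *\<^sub>v u = (\<Prod>i<n. (b $$ (i, i)) powi (\<nu> ! i)) \<cdot>\<^sub>v u" if b: "b \<in> borel n" for b
  proof -
    have "act V b *\<^sub>v u = act V b *\<^sub>v w' + (- a) \<cdot>\<^sub>v (act V b *\<^sub>v w)"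
      unfolding u_def using Vc[OF b] c
      by (simp add: mult_add_distrib_mat_vec[of _ "deg V" "deg V"] mult_mat_vec[of _ "deg V" "deg V"])
    also have "\<dots> = (\<Prod>i<n. (b $$ (i, i)) powi (\<nu> ! i)) \<cdot>\<^sub>v u"
      unfolding hw_vectorD(4)[OF w b] hw_vectorD(4)[OF w' b] u_def
      using c by (intro eq_vecI) (auto simp: algebra_simps)
    finally show ?thesis .
  qed
  then have "u = 0\<^sub>v (deg V)"
    using detect[of \<nu> u] su uc hw_vectorD(3)[OF w] unfolding hw_vector_def by blast
  then have u0: "(w' + (- a) \<cdot>\<^sub>v w) $ i = 0" if "i < deg V" for i using that by (simp add: u_def)
  have w'_eq: "w' = a \<cdot>\<^sub>v w"
  proof (rule eq_vecI)
    fix i assume "i < dim_vec (a \<cdot>\<^sub>v w)"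
    then have "i < deg V" using c by simp
    then show "w' $ i = (a \<cdot>\<^sub>v w) $ i" using u0[of i] c by simp
  qed (use c in auto)
  have "cnj a * (w \<bullet>c w) = 0"
    using orth unfolding w'_eq by (simp add: cscalar_smult_right[OF c(1) c(1)])
  then have "a = 0" using cscalar_zero_iff[OF c(1)] hw_vectorD(2)[OF w] by simp
  then have "w' = 0\<^sub>v (deg V)" using w'_eq c by (auto intro!: eq_vecI)
  then show False using hw_vectorD(2)[OF w'] by simp
qed

text \<open>
  A lower triangular matrix whose first two columns are prescribed vectors \<open>x\<close> and \<open>y\<close>.
\<close>

definition frame_mat :: "nat \<Rightarrow> complex vec \<Rightarrow> complex vec \<Rightarrow> complex mat" where
  "frame_mat n x y = mat n n (\<lambda>(i, j). if j = 0 then x $ i else if j = 1 then y $ i else if i = j then 1 else 0)"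

lemma frame_mat:
  assumes n: "n \<ge> 2" and x: "x \<in> carrier_vec n" and y: "y \<in> carrier_vec n"
    and nz: "x $ 0 \<noteq> 0" "y $ 0 = 0" "y $ 1 \<noteq> 0"
  shows "frame_mat n x y \<in> GL n" "mat_adjoint (frame_mat n x y) \<in> borel n"
    "frame_mat n x y *\<^sub>v unit_vec n 0 = x" "frame_mat n x y *\<^sub>v unit_vec n 1 = y"
proof -
  have c: "frame_mat n x y \<in> carrier_mat n n" by (simp add: frame_mat_def)
  have low: "frame_mat n x y $$ (i, j) = 0" if "i < j" "j < n" for i j
    using that nz by (auto simp: frame_mat_def)
  have diag: "frame_mat n x y $$ (i, i) \<noteq> 0" if "i < n" for i
    using that nz by (auto simp: frame_mat_def)
  show "frame_mat n x y \<in> GL n" "mat_adjoint (frame_mat n x y) \<in> borel n"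
    using lower_triangular_adjoint_borel[OF c low diag] by auto
  show "frame_mat n x y *\<^sub>v unit_vec n 0 = x"
    using mult_unit_vec_col[OF c, of 0] n x by (auto simp: frame_mat_def intro!: eq_vecI)
  show "frame_mat n x y *\<^sub>v unit_vec n 1 = y"
    using mult_unit_vec_col[OF c, of 1] n y by (auto simp: frame_mat_def intro!: eq_vecI)
qed

definition line_mat :: "nat \<Rightarrow> complex vec \<Rightarrow> complex mat" where
  "line_mat n x = mat n n (\<lambda>(i, j). if j = 0 then x $ i else if i = j then 1 else 0)"

lemma line_mat:
  assumes n: "n \<ge> 1" and x: "x \<in> carrier_vec n" and nz: "x $ 0 \<noteq> 0"
  shows "line_mat n x \<in> GL n" "mat_adjoint (line_mat n x) \<in> borel n" "line_mat n x *\<^sub>v unit_vec n 0 = x"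
proof -
  have c: "line_mat n x \<in> carrier_mat n n" by (simp add: line_mat_def)
  have low: "line_mat n x $$ (i, j) = 0" if "i < j" "j < n" for i j
    using that by (auto simp: line_mat_def)
  have diag: "line_mat n x $$ (i, i) \<noteq> 0" if "i < n" for i
    using that nz by (auto simp: line_mat_def)
  show "line_mat n x \<in> GL n" "mat_adjoint (line_mat n x) \<in> borel n"
    using lower_triangular_adjoint_borel[OF c low diag] by auto
  show "line_mat n x *\<^sub>v unit_vec n 0 = x"
    using mult_unit_vec_col[OF c, of 0] n x by (auto simp: line_mat_def intro!: eq_vecI)
qed

definition torus_mat :: "nat \<Rightarrow> nat \<Rightarrow> complex \<Rightarrow> complex mat" where
  "torus_mat n j t = mat n n (\<lambda>(i, k). if i = k then (if i = j then t else 1) else 0)"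

lemma torus_mat:
  assumes j: "j < n" and t: "t \<noteq> 0"
  shows "torus_mat n j t \<in> GL n" "mat_adjoint (torus_mat n j t) \<in> borel n"
    and "i < n \<Longrightarrow> torus_mat n j t *\<^sub>v unit_vec n i = (if i = j then t else 1) \<cdot>\<^sub>v unit_vec n i"
    and "(\<Prod>i<n. (torus_mat n j t $$ (i, i)) powi (\<nu> ! i)) = t powi (\<nu> ! j)"
proof -
  have c: "torus_mat n j t \<in> carrier_mat n n" by (simp add: torus_mat_def)
  have low: "torus_mat n j t $$ (i, k) = 0" if "i < k" "k < n" for i k
    using that by (auto simp: torus_mat_def)
  have diag: "torus_mat n j t $$ (i, i) \<noteq> 0" if "i < n" for i
    using that t by (auto simp: torus_mat_def)
  show "torus_mat n j t \<in> GL n" "mat_adjoint (torus_mat n j t) \<in> borel n"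
    using lower_triangular_adjoint_borel[OF c low diag] by auto
  show "torus_mat n j t *\<^sub>v unit_vec n i = (if i = j then t else 1) \<cdot>\<^sub>v unit_vec n i" if "i < n"
    using mult_unit_vec_col[OF c that] that by (auto simp: torus_mat_def intro!: eq_vecI)
  have "(\<Prod>i<n. (torus_mat n j t $$ (i, i)) powi (\<nu> ! i)) = (\<Prod>i\<in>{j}. (torus_mat n j t $$ (i, i)) powi (\<nu> ! i))"
    using j by (intro prod.mono_neutral_right) (auto simp: torus_mat_def)
  then show "(\<Prod>i<n. (torus_mat n j t $$ (i, i)) powi (\<nu> ! i)) = t powi (\<nu> ! j)"
    using j by (simp add: torus_mat_def)
qed

lemma coherent_smult:
  assumes V: "coherent n N V \<psi>" and x: "x \<in> carrier_vec n" and t: "t \<noteq> 0"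
  shows "\<psi> (t \<cdot>\<^sub>v x) = t ^ N \<cdot>\<^sub>v \<psi> x"
proof -
  have one: "(c \<cdot>\<^sub>m 1\<^sub>m d) *\<^sub>v v = c \<cdot>\<^sub>v v" if "v \<in> carrier_vec d" for c :: complex and d v
  proof -
    have "(c \<cdot>\<^sub>m 1\<^sub>m d) *\<^sub>v v = c \<cdot>\<^sub>v (1\<^sub>m d *\<^sub>v v)" using that
      by (intro eq_vecI) auto
    then show ?thesis using that by simp
  qed
  have "act V (t \<cdot>\<^sub>m 1\<^sub>m n) *\<^sub>v \<psi> x = \<psi> ((t \<cdot>\<^sub>m 1\<^sub>m n) *\<^sub>v x)"
    by (rule coherentD(3)[OF V scalar_in_GL[OF t] x])
  then show ?thesis
    by (simp add: one[OF x] one[OF coherentD(2)[OF V x]] star_repD(4)[OF coherentD(1)[OF V] t])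
qed

lemma poly_zero_if_zero_off:
  fixes p q :: "complex poly"
  assumes "q \<noteq> 0" "\<And>s. poly q s \<noteq> 0 \<Longrightarrow> poly p s = 0"
  shows "p = 0"
proof -
  have "poly (p * q) s = 0" for s using assms(2)[of s] by auto
  then have "p * q = 0" using poly_all_0_iff_0 by blast
  then show ?thesis using assms(1) by simp
qed

text \<open>
  Exponents of characters are read off at the argument \<open>2\<close>.
\<close>

lemma complex_powi_inject:
  assumes "(2 :: complex) powi a = 2 powi b"
  shows "a = b"
proof -
  have "norm ((2 :: complex) powi a) = norm ((2 :: complex) powi b)" using assms by simp
  then have "(2 :: real) powi a = 2 powi b" by (simp add: norm_power_int)
  then show ?thesis
    using power_int_strict_increasing[of a b "2 :: real"] power_int_strict_increasing[of b a "2 :: real"]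
    by (cases a b rule: linorder_cases) auto
qed

text \<open>
  If \<open>x\<close> has nonzero first entry, then \<open>x\<close> is in the lower triangular orbit of \<open>e\<^sub>0\<close>; so if the
  pairing with \<open>w\<close> vanished at \<open>e\<^sub>0\<close>, it would vanish at all such \<open>x\<close>, and then everywhere, because along each line in
  direction \<open>e\<^sub>0\<close> it is a polynomial and only one point is exceptional. Diagonal matrices scale
  \<open>e\<^sub>0\<close>, which gives the weight.
\<close>

lemma coherent_highest_weight:
  assumes n: "n \<ge> 1" and V: "coherent n N V \<psi>" and w: "hw_vector n V \<nu> w"
  shows "\<psi> (unit_vec n 0) \<bullet>c w \<noteq> 0" and "\<nu> = int N # replicate (n - 1) 0"
proof -
  let ?e = "unit_vec n 0 :: complex vec"
  note rep = coherentD(1)[OF V] and wc = hw_vectorD(1)[OF w]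
  have e: "?e \<in> carrier_vec n" by simp
  have trans: "\<psi> (g *\<^sub>v x) \<bullet>c w = (\<Prod>i<n. (g $$ (i, i)) powi (\<nu> ! i)) * (\<psi> x \<bullet>c w)"
    if "x \<in> carrier_vec n" "g \<in> GL n" "mat_adjoint g \<in> borel n" for g x
    using hw_functional_transform[OF rep w coherentD(2)[OF V that(1)] that(2,3)] coherentD(3)[OF V that(2,1)]
    by simp
  show ne: "\<psi> ?e \<bullet>c w \<noteq> 0"
  proof
    assume z: "\<psi> ?e \<bullet>c w = 0"
    have generic: "\<psi> x \<bullet>c w = 0" if "x \<in> carrier_vec n" "x $ 0 \<noteq> 0" for x
      using trans[OF e line_mat(1,2)[OF n that]] line_mat(3)[OF n that] z by simp
    have "\<psi> x \<bullet>c w = 0" if x: "x \<in> carrier_vec n" for x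
    proof -
      obtain p where p: "\<And>s. \<psi> (x + s \<cdot>\<^sub>v ?e) \<bullet>c w = poly p s"
        using coherent_line_cscalar[OF V x e wc] by blast
      have "p = 0"
      proof (rule poly_zero_if_zero_off[of "[:x $ 0, 1:]"])
        fix s assume "poly [:x $ 0, 1:] s \<noteq> 0"
        then show "poly p s = 0"
          using generic[of "x + s \<cdot>\<^sub>v ?e"] p[of s] x n by simp
      qed simp
      then have "\<psi> (x + 0 \<cdot>\<^sub>v ?e) \<bullet>c w = 0" using p[of 0] by simp
      moreover have "x + 0 \<cdot>\<^sub>v ?e = x" using x by (intro eq_vecI) auto
      ultimately show ?thesis by simp
    qed
    then have "w = 0\<^sub>v (deg V)" using coherentD(4)[OF V wc] by blast
    then show False using hw_vectorD(2)[OF w] by simp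
  qed
  have weight: "\<nu> ! j = (if j = 0 then int N else 0)" if j: "j < n" for j
  proof -
    note t = torus_mat[OF j, of 2]
    have "\<psi> ((if 0 = j then 2 else 1) \<cdot>\<^sub>v ?e) \<bullet>c w = 2 powi (\<nu> ! j) * (\<psi> ?e \<bullet>c w)"
      using trans[OF e t(1,2)] t(3)[of 0] t(4)[of \<nu>] n by simp
    moreover have "\<psi> ((if 0 = j then 2 else 1) \<cdot>\<^sub>v ?e) \<bullet>c w = 2 powi (if j = 0 then int N else 0) * (\<psi> ?e \<bullet>c w)"
      using coherent_smult[OF V e, of "if 0 = j then 2 else 1"]
        cscalar_smult_left[OF coherentD(2)[OF V e] wc] by (auto simp: power_int_of_nat)
    ultimately have "(2 :: complex) powi (\<nu> ! j) = 2 powi (if j = 0 then int N else 0)" using ne by simp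
    then show ?thesis by (rule complex_powi_inject)
  qed
  show "\<nu> = int N # replicate (n - 1) 0"
    using n hw_vectorD(3)[OF w] weight by (intro nth_equalityI) (auto simp: nth_Cons split: nat.split)
qed

text \<open>
  An invariant subspace and its complement would contain orthogonal highest weight vectors, both
  of the only possible weight.
\<close>

lemma coherent_irreducible:
  assumes n: "n \<ge> 1" and V: "coherent n N V \<psi>"
  shows "irreducible_rep n (GL n) V"
    and "\<exists>w. hw_vector n V (int N # replicate (n - 1) 0) w"
proof -
  let ?d = "deg V"
  note rep = coherentD(1)[OF V]
  have pos: "?d > 0"
  proof (rule ccontr)
    assume "\<not> 0 < ?d"
    then have "\<psi> (unit_vec n 0) = 0\<^sub>v ?d" using coherentD(2)[OF V, of "unit_vec n 0"] by (intro eq_vecI) auto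
    then show False using coherentD(6)[OF V] by simp
  qed
  have free: "orth_free n V"
  proof (rule orth_free_if_detecting)
    show "\<psi> (unit_vec n 0) \<in> carrier_vec ?d" using coherentD(2)[OF V] by simp
    show "\<psi> (unit_vec n 0) \<bullet>c w \<noteq> 0" if "hw_vector n V \<nu> w" for \<nu> w
      by (rule coherent_highest_weight(1)[OF n V that])
    show "act V b \<in> carrier_mat ?d ?d" if "b \<in> borel n" for b
      using star_repD(2)[OF rep] that borel_subset_GL by blast
  qed
  have weight: "\<nu> = int N # replicate (n - 1) 0" if "hw_vector n V \<nu> w" for \<nu> w
    using coherent_highest_weight(2)[OF n V that] .
  have "W = {0\<^sub>v ?d} \<or> W = carrier_vec ?d"
    if sub: "lin_subspace ?d W" and inv: "invariant (GL n) V W" for W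
  proof (rule ccontr)
    assume "\<not> (W = {0\<^sub>v ?d} \<or> W = carrier_vec ?d)"
    then have ne: "W \<noteq> {0\<^sub>v ?d}" "W \<noteq> carrier_vec ?d" by auto
    have Wc: "W \<subseteq> carrier_vec ?d" using sub by (simp add: lin_subspace_def)
    have "orth_compl ?d W \<noteq> {0\<^sub>v ?d}" using orth_compl_eq_zero[OF sub] ne(2) by blast
    then obtain \<nu>' w' where w': "w' \<in> orth_compl ?d W" "hw_vector n V \<nu>' w'"
      using hw_vector_exists[OF rep lin_subspace_orth_compl[OF Wc] invariant_orth_compl[OF rep Wc inv]] by blast
    obtain \<nu> w where w: "w \<in> W" "hw_vector n V \<nu> w" using hw_vector_exists[OF rep sub inv ne(1)] by blast
    have "\<nu> = \<nu>'" using weight[OF w(2)] weight[OF w'(2)] by simp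
    then have "w' \<bullet>c w \<noteq> 0" using free w(2) w'(2) by (simp add: orth_free_def)
    then show False using w(1) w'(1) by (simp add: orth_compl_def)
  qed
  then show "irreducible_rep n (GL n) V"
    unfolding irreducible_rep_def using pos star_repD(1)[OF rep] subspace_imp_lin_subspace
    by (auto simp: invariant_def)
  have "carrier_vec ?d \<noteq> {0\<^sub>v ?d :: complex vec}"
    using coherentD(6)[OF V] coherentD(2)[OF V, of "unit_vec n 0"] by auto
  then obtain \<nu> w where "hw_vector n V \<nu> w"
    using hw_vector_exists[OF rep lin_subspace_carrier invariant_carrier[OF rep]] by blast
  then show "\<exists>w. hw_vector n V (int N # replicate (n - 1) 0) w" using weight by blast
qed

section \<open>Highest weight vectors in the square of a symmetric power\<close>

text \<open>
  The hypothesis says that \<open>p t\<close> is a multiple of \<open>t\<close> to the power \<open>k - N\<close> off zero. A negative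
  exponent is excluded at \<open>t = 0\<close>, one larger than \<open>N\<close> by the degree.
\<close>

lemma poly_monomial_if_homogeneous:
  fixes p :: "complex poly"
  assumes deg: "degree p \<le> N" and p1: "poly p 1 \<noteq> 0"
    and hom: "\<And>t. t \<noteq> 0 \<Longrightarrow> t ^ N * poly p t = t powi k * poly p 1"
  shows "int N \<le> k" and "k \<le> 2 * int N"
proof -
  have inf: "q = r" if "\<And>t. t \<noteq> 0 \<Longrightarrow> poly q t = poly r t" for q r :: "complex poly"
  proof -
    have "q - r = 0" by (rule poly_zero_if_zero_off[of "[:0, 1:]"]) (use that in auto)
    then show ?thesis by simp
  qed
  show ge: "int N \<le> k"
  proof (rule ccontr)
    assume "\<not> int N \<le> k"
    define m where "m = nat (int N - k)"
    have m: "m > 0" "int m = int N - k" using \<open>\<not> int N \<le> k\<close> by (auto simp: m_def)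
    have "poly (monom 1 m * p) t = poly [:poly p 1:] t" if t: "t \<noteq> 0" for t
    proof -
      have "t ^ m = t powi (int N - k)" unfolding m(2)[symmetric] by simp
      also have "\<dots> = t ^ N / t powi k" using t by (simp add: power_int_diff)
      finally have "t ^ m * poly p t = t ^ N * poly p t / t powi k" by simp
      also have "\<dots> = poly p 1" unfolding hom[OF t] using t by simp
      finally show ?thesis by (simp add: poly_monom)
    qed
    then have "poly (monom 1 m * p) 0 = poly [:poly p 1:] 0" using inf by metis
    then show False using p1 m(1) by (simp add: poly_monom zero_power)
  qed
  define a where "a = nat (k - int N)"
  have a: "int a = k - int N" using ge by (simp add: a_def)
  have "poly p t = poly (monom (poly p 1) a) t" if t: "t \<noteq> 0" for t
  proof -
    have "t ^ a = t powi (k - int N)" unfolding a[symmetric] by simp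
    also have "\<dots> = t powi k / t ^ N" using t by (simp add: power_int_diff)
    finally have "poly p 1 * t ^ a = t powi k * poly p 1 / t ^ N" by simp
    also have "\<dots> = poly p t" unfolding hom[OF t, symmetric] using t by simp
    finally show ?thesis by (simp add: poly_monom)
  qed
  then have "p = monom (poly p 1) a" by (rule inf)
  then have "degree p = degree (monom (poly p 1) a)" by (rule arg_cong)
  then have "degree p = a" using degree_monom_eq[OF p1] by simp
  then show "k \<le> 2 * int N" using deg a by linarith
qed

locale coherent_square =
  fixes n N V \<psi> \<nu> w
  assumes n: "n \<ge> 2" and V: "coherent n N V \<psi>" and w: "hw_vector n (tensor_rep V V) \<nu> w"
begin

definition F :: "complex vec \<Rightarrow> complex vec \<Rightarrow> complex" where
  "F x y = kron_vec (\<psi> x) (\<psi> y) \<bullet>c w"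

abbreviation "e\<^sub>0 \<equiv> unit_vec n 0 :: complex vec"
abbreviation "e\<^sub>1 \<equiv> unit_vec n 1 :: complex vec"

lemma e: "e\<^sub>0 \<in> carrier_vec n" "e\<^sub>1 \<in> carrier_vec n"
  by simp_all

lemma wc: "w \<in> carrier_vec (deg V * deg V)"
  using hw_vectorD(1)[OF w] by simp

lemma F_sum:
  assumes "x \<in> carrier_vec n" "y \<in> carrier_vec n"
  shows "F x y = (\<Sum>i<deg V * deg V. \<psi> x $ (i div deg V) * \<psi> y $ (i mod deg V) * cnj (w $ i))"
proof -
  note c = coherentD(2)[OF V assms(1)] coherentD(2)[OF V assms(2)]
  have "F x y = (\<Sum>i<deg V * deg V. kron_vec (\<psi> x) (\<psi> y) $ i * cnj (w $ i))"
    unfolding F_def using c wc kron_vec_carrier[OF c] by (auto simp: scalar_prod_def atLeast0LessThan)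
  then show ?thesis using index_kron_vec[OF c] by simp
qed

lemma F_transform:
  assumes "x \<in> carrier_vec n" "y \<in> carrier_vec n" "g \<in> GL n" "mat_adjoint g \<in> borel n"
  shows "F (g *\<^sub>v x) (g *\<^sub>v y) = (\<Prod>i<n. (g $$ (i, i)) powi (\<nu> ! i)) * F x y"
proof -
  note rep = coherentD(1)[OF V]
  note c = coherentD(2)[OF V assms(1)] coherentD(2)[OF V assms(2)] star_repD(2)[OF rep assms(3)]
  have "act (tensor_rep V V) g *\<^sub>v kron_vec (\<psi> x) (\<psi> y) = kron_vec (\<psi> (g *\<^sub>v x)) (\<psi> (g *\<^sub>v y))"
    using act_tensor_rep[OF c(3,3)] kron_mult_vec[OF c(3,3,1,2)]
      coherentD(3)[OF V assms(3,1)] coherentD(3)[OF V assms(3,2)] by simp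
  moreover have "kron_vec (\<psi> x) (\<psi> y) \<in> carrier_vec (deg (tensor_rep V V))" using c by simp
  ultimately show ?thesis
    using hw_functional_transform[OF star_rep_tensor_rep[OF rep rep] w _ assms(3,4)] unfolding F_def by metis
qed

lemma F_smult:
  assumes "x \<in> carrier_vec n" "y \<in> carrier_vec n" "t \<noteq> 0"
  shows "F (t \<cdot>\<^sub>v x) y = t ^ N * F x y" "F x (t \<cdot>\<^sub>v y) = t ^ N * F x y"
proof -
  have d: "i div deg V < deg V" "i mod deg V < deg V" if "i < deg V * deg V" for i
    using div_mod_less_mult[OF that] by auto
  note c = coherentD(2)[OF V assms(1)] coherentD(2)[OF V assms(2)]
  have "F (t \<cdot>\<^sub>v x) y = (\<Sum>i<deg V * deg V. t ^ N * (\<psi> x $ (i div deg V) * \<psi> y $ (i mod deg V) * cnj (w $ i)))"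
    using assms c by (subst F_sum) (auto simp: coherent_smult[OF V] d intro!: sum.cong)
  then show "F (t \<cdot>\<^sub>v x) y = t ^ N * F x y" using F_sum[OF assms(1,2)] by (simp add: sum_distrib_left)
  have "F x (t \<cdot>\<^sub>v y) = (\<Sum>i<deg V * deg V. t ^ N * (\<psi> x $ (i div deg V) * \<psi> y $ (i mod deg V) * cnj (w $ i)))"
    using assms c by (subst F_sum) (auto simp: coherent_smult[OF V] d intro!: sum.cong)
  then show "F x (t \<cdot>\<^sub>v y) = t ^ N * F x y" using F_sum[OF assms(1,2)] by (simp add: sum_distrib_left)
qed

lemma F_line:
  assumes "x \<in> carrier_vec n" "y \<in> carrier_vec n" "u \<in> carrier_vec n" "v \<in> carrier_vec n"
  shows "\<exists>p. \<forall>s. F (x + s \<cdot>\<^sub>v u) (y + s \<cdot>\<^sub>v v) = poly p s"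
proof -
  have "\<exists>p. degree p \<le> 2 * N \<and> (\<forall>s. (\<Sum>i<deg V * deg V.
      (\<psi> (x + s \<cdot>\<^sub>v u) $ (i div deg V) * \<psi> (y + s \<cdot>\<^sub>v v) $ (i mod deg V)) * cnj (w $ i)) = poly p s)"
  proof (rule poly_linear_combination)
    fix i assume i: "i < deg V * deg V"
    obtain p where p: "degree p \<le> N" "\<And>s. \<psi> (x + s \<cdot>\<^sub>v u) $ (i div deg V) = poly p s"
      using coherentD(5)[OF V assms(1,3) div_mod_less_mult(1)[OF i]] by blast
    obtain q where q: "degree q \<le> N" "\<And>s. \<psi> (y + s \<cdot>\<^sub>v v) $ (i mod deg V) = poly q s"
      using coherentD(5)[OF V assms(2,4) div_mod_less_mult(2)[OF i]] by blast
    have "degree (p * q) \<le> 2 * N" using degree_mult_le[of p q] p(1) q(1) by linarith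
    moreover have "\<psi> (x + s \<cdot>\<^sub>v u) $ (i div deg V) * \<psi> (y + s \<cdot>\<^sub>v v) $ (i mod deg V) = poly (p * q) s" for s
      using p(2) q(2) by simp
    ultimately show "\<exists>p. degree p \<le> 2 * N \<and>
      (\<forall>s. \<psi> (x + s \<cdot>\<^sub>v u) $ (i div deg V) * \<psi> (y + s \<cdot>\<^sub>v v) $ (i mod deg V) = poly p s)" by blast
  qed
  then show ?thesis using assms by (auto simp: F_sum)
qed

lemma F_line_right:
  assumes "x \<in> carrier_vec n" "y \<in> carrier_vec n" "v \<in> carrier_vec n"
  shows "\<exists>p. degree p \<le> N \<and> (\<forall>s. F x (y + s \<cdot>\<^sub>v v) = poly p s)"
proof -
  have "\<exists>p. degree p \<le> N \<and> (\<forall>s. (\<Sum>i<deg V * deg V.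
      \<psi> (y + s \<cdot>\<^sub>v v) $ (i mod deg V) * (\<psi> x $ (i div deg V) * cnj (w $ i))) = poly p s)"
    by (rule poly_linear_combination) (use coherentD(5)[OF V assms(2,3)] div_mod_less_mult(2) in blast)
  then show ?thesis using assms by (auto simp: F_sum mult_ac)
qed

text \<open>
  The tensors \<open>\<psi> x \<otimes> \<psi> y\<close> have no common nonzero orthogonal vector, by the corresponding property
  of \<open>\<psi>\<close> applied in each factor in turn.
\<close>

lemma F_nonzero: "\<exists>x\<in>carrier_vec n. \<exists>y\<in>carrier_vec n. F x y \<noteq> 0"
proof (rule ccontr)
  let ?d = "deg V"
  assume "\<not> ?thesis"
  then have z: "F x y = 0" if "x \<in> carrier_vec n" "y \<in> carrier_vec n" for x y using that by blast
  have "w $ k = 0" if k: "k < ?d * ?d" for k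
  proof -
    note km = div_mod_less_mult[OF k]
    define r where "r y = vec ?d (\<lambda>i. \<Sum>j<?d. cnj (\<psi> y $ j) * w $ (i * ?d + j))" for y
    have r: "r y = 0\<^sub>v ?d" if y: "y \<in> carrier_vec n" for y
    proof (rule coherentD(4)[OF V])
      show "r y \<in> carrier_vec ?d" by (simp add: r_def)
      fix x :: "complex vec" assume x: "x \<in> carrier_vec n"
      have "F x y = (\<Sum>k<?d * ?d. \<psi> x $ (k div ?d) * \<psi> y $ (k mod ?d) * cnj (w $ ((k div ?d) * ?d + k mod ?d)))"
        unfolding F_sum[OF x y] by simp
      also have "\<dots> = (\<Sum>i<?d. \<Sum>j<?d. \<psi> x $ i * \<psi> y $ j * cnj (w $ (i * ?d + j)))"
        by (rule sum_div_mod)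
      also have "\<dots> = \<psi> x \<bullet>c r y"
        using coherentD(2)[OF V x] by (simp add: r_def scalar_prod_def atLeast0LessThan sum_distrib_left mult_ac)
      finally show "\<psi> x \<bullet>c r y = 0" using z[OF x y] by simp
    qed
    have "vec ?d (\<lambda>j. w $ ((k div ?d) * ?d + j)) = 0\<^sub>v ?d"
    proof (rule coherentD(4)[OF V])
      fix y :: "complex vec" assume y: "y \<in> carrier_vec n"
      have "r y $ (k div ?d) = 0" using r[OF y] km by simp
      then have "(\<Sum>j<?d. cnj (\<psi> y $ j) * w $ ((k div ?d) * ?d + j)) = 0" using km by (simp add: r_def)
      then have "cnj (\<Sum>j<?d. cnj (\<psi> y $ j) * w $ ((k div ?d) * ?d + j)) = 0" by simp
      then show "\<psi> y \<bullet>c vec ?d (\<lambda>j. w $ ((k div ?d) * ?d + j)) = 0"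
        using coherentD(2)[OF V y] by (simp add: scalar_prod_def atLeast0LessThan)
    qed simp
    then have "vec ?d (\<lambda>j. w $ ((k div ?d) * ?d + j)) $ (k mod ?d) = 0" using km by simp
    then show ?thesis using km by simp
  qed
  then have "w = 0\<^sub>v (?d * ?d)" using wc by (intro eq_vecI) auto
  then show False using hw_vectorD(2)[OF w] by simp
qed

text \<open>
  The lower triangular matrix with first two columns \<open>x\<close> and \<open>y - s x\<close>, for \<open>s = y\<^sub>0 / x\<^sub>0\<close>, maps the
  pair \<open>(e\<^sub>0, e\<^sub>1 + s e\<^sub>0)\<close> to \<open>(x, y)\<close>.
\<close>

lemma F_generic:
  assumes x: "x \<in> carrier_vec n" and y: "y \<in> carrier_vec n"
    and nz: "x $ 0 \<noteq> 0" "x $ 0 * y $ 1 - x $ 1 * y $ 0 \<noteq> 0"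
    and zero: "\<And>s. F e\<^sub>0 (e\<^sub>1 + s \<cdot>\<^sub>v e\<^sub>0) = 0"
  shows "F x y = 0"
proof -
  define s where "s = y $ 0 / x $ 0"
  define z where "z = y + (- s) \<cdot>\<^sub>v x"
  have zc: "z \<in> carrier_vec n" using x y by (simp add: z_def)
  have z0: "z $ 0 = 0" using x y n nz by (simp add: z_def s_def)
  have z1: "z $ 1 \<noteq> 0" using x y n nz by (simp add: z_def s_def field_simps)
  note g = frame_mat[OF n x zc nz(1) z0 z1]
  have gc: "frame_mat n x z \<in> carrier_mat n n" by (simp add: frame_mat_def)
  have "frame_mat n x z *\<^sub>v (e\<^sub>1 + s \<cdot>\<^sub>v e\<^sub>0) = z + s \<cdot>\<^sub>v x"
    using gc g(3,4) by (simp add: mult_add_distrib_mat_vec[of _ n n] mult_mat_vec[of _ n n])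
  also have "\<dots> = y" unfolding z_def using x y by (intro eq_vecI) auto
  finally have "F x y = F (frame_mat n x z *\<^sub>v e\<^sub>0) (frame_mat n x z *\<^sub>v (e\<^sub>1 + s \<cdot>\<^sub>v e\<^sub>0))" using g(3) by simp
  also have "\<dots> = 0" using F_transform[OF e(1) _ g(1,2), of "e\<^sub>1 + s \<cdot>\<^sub>v e\<^sub>0"] zero by simp
  finally show ?thesis .
qed

text \<open>
  The pairs covered by \<open>F_generic\<close> are dense: moving \<open>(x, y)\<close> in the direction \<open>(e\<^sub>0, e\<^sub>1)\<close> meets only
  the finitely many roots of the polynomial \<open>q\<close> below.
\<close>

lemma F_normal_form: "\<exists>s. F e\<^sub>0 (e\<^sub>1 + s \<cdot>\<^sub>v e\<^sub>0) \<noteq> 0"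
proof (rule ccontr)
  assume "\<not> ?thesis"
  then have zero: "\<And>s. F e\<^sub>0 (e\<^sub>1 + s \<cdot>\<^sub>v e\<^sub>0) = 0" by blast
  obtain x y where xy: "x \<in> carrier_vec n" "y \<in> carrier_vec n" "F x y \<noteq> 0" using F_nonzero by blast
  obtain p where p: "\<And>s. F (x + s \<cdot>\<^sub>v e\<^sub>0) (y + s \<cdot>\<^sub>v e\<^sub>1) = poly p s" using F_line[OF xy(1,2) e] by blast
  \<comment> \<open>The two factors are the expressions required to be nonzero in \<open>F_generic\<close>, evaluated along the line.\<close>
  define q where "q = [:x $ 0, 1:] * ([:x $ 0, 1:] * [:y $ 1, 1:] - [:x $ 1 * y $ 0:])"
  have "coeff ([:x $ 0, 1:] * [:y $ 1, 1:] - [:x $ 1 * y $ 0:]) 2 = 1"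
    by (simp add: numeral_2_eq_2)
  then have "[:x $ 0, 1:] * [:y $ 1, 1:] - [:x $ 1 * y $ 0:] \<noteq> 0" by (metis coeff_0 zero_neq_one)
  then have q0: "q \<noteq> 0" unfolding q_def by (intro no_zero_divisors) auto
  have "p = 0"
  proof (rule poly_zero_if_zero_off[OF q0])
    fix s assume "poly q s \<noteq> 0"
    moreover have "poly q s = (x $ 0 + s) * ((x $ 0 + s) * (y $ 1 + s) - x $ 1 * y $ 0)"
      unfolding q_def poly_mult poly_diff by simp
    ultimately have nz: "x $ 0 + s \<noteq> 0" "(x $ 0 + s) * (y $ 1 + s) - x $ 1 * y $ 0 \<noteq> 0" by auto
    have "F (x + s \<cdot>\<^sub>v e\<^sub>0) (y + s \<cdot>\<^sub>v e\<^sub>1) = 0"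
    proof (rule F_generic[OF _ _ _ _ zero])
      have ix: "(x + s \<cdot>\<^sub>v e\<^sub>0) $ 0 = x $ 0 + s" "(x + s \<cdot>\<^sub>v e\<^sub>0) $ 1 = x $ 1"
        "(y + s \<cdot>\<^sub>v e\<^sub>1) $ 0 = y $ 0" "(y + s \<cdot>\<^sub>v e\<^sub>1) $ 1 = y $ 1 + s"
        using xy(1,2) n by simp_all
      show "(x + s \<cdot>\<^sub>v e\<^sub>0) $ 0 \<noteq> 0" unfolding ix by (rule nz(1))
      show "(x + s \<cdot>\<^sub>v e\<^sub>0) $ 0 * (y + s \<cdot>\<^sub>v e\<^sub>1) $ 1 - (x + s \<cdot>\<^sub>v e\<^sub>0) $ 1 * (y + s \<cdot>\<^sub>v e\<^sub>1) $ 0 \<noteq> 0"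
        unfolding ix by (rule nz(2))
    qed (use xy in simp_all)
    then show "poly p s = 0" using p by simp
  qed
  then have "F (x + 0 \<cdot>\<^sub>v e\<^sub>0) (y + 0 \<cdot>\<^sub>v e\<^sub>1) = 0" using p by simp
  moreover have "x + 0 \<cdot>\<^sub>v e\<^sub>0 = x" "y + 0 \<cdot>\<^sub>v e\<^sub>1 = y" using xy by (auto intro!: eq_vecI)
  ultimately show False using xy(3) by simp
qed

text \<open>
  Put \<open>p s = F e\<^sub>0 (e\<^sub>1 + s e\<^sub>0)\<close>. Scaling \<open>e\<^sub>0\<close> by \<open>t\<close> turns the semi-invariance of \<open>F\<close> into a
  homogeneity property of \<open>p\<close> and so bounds the first component of the weight; scaling \<open>e\<^sub>1\<close> then
  determines the second component, and scaling the other basis vectors does not change \<open>p\<close>. A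
  nonzero monomial does not vanish at \<open>1\<close>.
\<close>

lemma weight_and_detection:
  shows "F e\<^sub>0 (e\<^sub>1 + e\<^sub>0) \<noteq> 0"
    and "\<exists>a\<le>N. \<nu> = int (N + a) # int (N - a) # replicate (n - 2) 0"
proof -
  obtain p where deg: "degree p \<le> N" and p: "\<And>s. F e\<^sub>0 (e\<^sub>1 + s \<cdot>\<^sub>v e\<^sub>0) = poly p s"
    using F_line_right[OF e(1,2,1)] by blast
  have n01: "0 < n" "1 < n" using n by auto
  have torus: "torus_mat n j t *\<^sub>v (e\<^sub>1 + s \<cdot>\<^sub>v e\<^sub>0) =
      (if j = 1 then t else 1) \<cdot>\<^sub>v e\<^sub>1 + (s * (if j = 0 then t else 1)) \<cdot>\<^sub>v e\<^sub>0"
    if j: "j < n" and t: "t \<noteq> 0" for j t s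
  proof -
    have "torus_mat n j t \<in> carrier_mat n n" by (simp add: torus_mat_def)
    then have "torus_mat n j t *\<^sub>v (e\<^sub>1 + s \<cdot>\<^sub>v e\<^sub>0) = torus_mat n j t *\<^sub>v e\<^sub>1 + s \<cdot>\<^sub>v (torus_mat n j t *\<^sub>v e\<^sub>0)"
      by (simp add: mult_add_distrib_mat_vec[of _ n n] mult_mat_vec[of _ n n])
    then show ?thesis
      using torus_mat(3)[OF j t n01(1)] torus_mat(3)[OF j t n01(2)] by (auto simp: smult_smult_assoc)
  qed
  have torus_F: "F ((if j = 0 then t else 1) \<cdot>\<^sub>v e\<^sub>0)
      ((if j = 1 then t else 1) \<cdot>\<^sub>v e\<^sub>1 + (s * (if j = 0 then t else 1)) \<cdot>\<^sub>v e\<^sub>0) = t powi (\<nu> ! j) * poly p s"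
    if j: "j < n" and t: "t \<noteq> 0" for j t s
    using F_transform[OF e(1) _ torus_mat(1,2)[OF j t], of "e\<^sub>1 + s \<cdot>\<^sub>v e\<^sub>0"] torus[OF j t, of s]
      torus_mat(3)[OF j t n01(1)] torus_mat(4)[OF j t, of \<nu>] p[of s] by auto
  have one: "1 \<cdot>\<^sub>v x = x" for x :: "complex vec" by (intro eq_vecI) auto
  have hom0: "t ^ N * poly p (s * t) = t powi (\<nu> ! 0) * poly p s" if t: "t \<noteq> 0" for t s
  proof -
    have "F (t \<cdot>\<^sub>v e\<^sub>0) (e\<^sub>1 + (s * t) \<cdot>\<^sub>v e\<^sub>0) = t powi (\<nu> ! 0) * poly p s"
      using torus_F[OF n01(1) t, of s] by (simp add: one)
    moreover have "F (t \<cdot>\<^sub>v e\<^sub>0) (e\<^sub>1 + (s * t) \<cdot>\<^sub>v e\<^sub>0) = t ^ N * poly p (s * t)"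
      unfolding p[symmetric] using t by (intro F_smult(1)) auto
    ultimately show ?thesis by simp
  qed
  have p1: "poly p 1 \<noteq> 0"
  proof
    assume z: "poly p 1 = 0"
    have "p = 0"
    proof (rule poly_zero_if_zero_off[of "[:0, 1:]"])
      fix t :: complex assume "poly [:0, 1:] t \<noteq> 0"
      then show "poly p t = 0" using hom0[of t 1] z by auto
    qed simp
    then show False using F_normal_form p by simp
  qed
  have "F e\<^sub>0 (e\<^sub>1 + e\<^sub>0) = poly p 1" using p[of 1] by (simp only: one)
  then show "F e\<^sub>0 (e\<^sub>1 + e\<^sub>0) \<noteq> 0" using p1 by (simp only: not_False_eq_True)
  define k where "k = \<nu> ! 0"
  have k: "int N \<le> k" "k \<le> 2 * int N"
    using poly_monomial_if_homogeneous[OF deg p1, of k] hom0[of _ 1] by (auto simp: k_def)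
  have \<nu>1: "\<nu> ! 1 = 2 * int N - k"
  proof -
    have "2 \<cdot>\<^sub>v (e\<^sub>1 + (1 / 2) \<cdot>\<^sub>v e\<^sub>0) = 2 \<cdot>\<^sub>v e\<^sub>1 + 1 \<cdot>\<^sub>v e\<^sub>0" by (intro eq_vecI) auto
    then have "F e\<^sub>0 (2 \<cdot>\<^sub>v e\<^sub>1 + 1 \<cdot>\<^sub>v e\<^sub>0) = 2 ^ N * poly p (1 / 2)"
      using F_smult(2)[OF e(1), of "e\<^sub>1 + (1 / 2) \<cdot>\<^sub>v e\<^sub>0" 2] p by simp
    then have h1: "2 powi (\<nu> ! 1) * poly p 1 = 2 ^ N * poly p (1 / 2)"
      using torus_F[OF n01(2), of 2 1] by (simp add: one)
    have h2: "2 ^ N * poly p 1 = 2 powi k * poly p (1 / 2)"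
    proof -
      have half: "(1 / 2) * 2 = (1 :: complex)" by simp
      have "2 ^ N * poly p ((1 / 2) * 2) = 2 powi (\<nu> ! 0) * poly p (1 / 2)" by (rule hom0) simp
      then show ?thesis by (simp only: half k_def)
    qed
    have "2 powi (\<nu> ! 1) * 2 powi k * poly p 1 = 2 powi k * (2 powi (\<nu> ! 1) * poly p 1)"
      by (simp only: mult_ac)
    also have "\<dots> = 2 ^ N * (2 powi k * poly p (1 / 2))" unfolding h1 by (simp only: mult_ac)
    also have "\<dots> = 2 ^ N * 2 ^ N * poly p 1" unfolding h2[symmetric] by (simp only: mult_ac)
    finally have "2 powi (\<nu> ! 1) * 2 powi k = (2 :: complex) ^ N * 2 ^ N" using p1 by simp
    moreover have "(2 :: complex) powi (\<nu> ! 1 + k) = 2 powi (\<nu> ! 1) * 2 powi k"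
      by (rule power_int_add) simp
    moreover have "(2 :: complex) powi (int N + int N) = 2 powi int N * 2 powi int N"
      by (rule power_int_add) simp
    ultimately have "(2 :: complex) powi (\<nu> ! 1 + k) = 2 powi (int N + int N)"
      by (simp only: power_int_of_nat)
    then have "\<nu> ! 1 + k = int N + int N" by (rule complex_powi_inject)
    then show ?thesis by simp
  qed
  have \<nu>j: "\<nu> ! j = 0" if j: "j < n" "j \<ge> 2" for j
  proof -
    have "poly p 1 = 2 powi (\<nu> ! j) * poly p 1"
      using torus_F[OF j(1), of 2 1] j p[of 1] by (simp add: one)
    then have "(2 :: complex) powi (\<nu> ! j) = 2 powi 0" using p1 by simp
    then show ?thesis by (rule complex_powi_inject)
  qed
  define a where "a = nat (k - int N)"
  have a: "a \<le> N" "int (N + a) = k" "int (N - a) = 2 * int N - k" using k by (auto simp: a_def)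
  have len: "length \<nu> = n" by (rule hw_vectorD(3)[OF w])
  have "\<nu> = int (N + a) # int (N - a) # replicate (n - 2) 0"
  proof (rule nth_equalityI)
    show "length \<nu> = length (int (N + a) # int (N - a) # replicate (n - 2) 0)" using len n by simp
    fix i assume "i < length \<nu>"
    then have i: "i < n" using len by simp
    consider "i = 0" | "i = 1" | "i \<ge> 2" by linarith
    then show "\<nu> ! i = (int (N + a) # int (N - a) # replicate (n - 2) 0) ! i"
    proof cases
      case 1
      then show ?thesis unfolding a k_def by simp
    next
      case 2
      then show ?thesis unfolding a using \<nu>1 by simp
    next
      case 3
      then obtain j where j: "i = Suc (Suc j)" by (metis add_2_eq_Suc le_Suc_ex)
      then show ?thesis using \<nu>j[OF i 3] i by simp
    qed
  qed
  then show "\<exists>a\<le>N. \<nu> = int (N + a) # int (N - a) # replicate (n - 2) 0" using a(1) by blast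
qed

end

lemma tensor_square_highest_weights:
  assumes "n \<ge> 2" "coherent n N V \<psi>"
  shows "orth_free n (tensor_rep V V)"
    and "hw_vector n (tensor_rep V V) \<nu> w \<Longrightarrow> \<exists>a\<le>N. \<nu> = int (N + a) # int (N - a) # replicate (n - 2) 0"
proof -
  show "orth_free n (tensor_rep V V)"
  proof (rule orth_free_if_detecting)
    show "kron_vec (\<psi> (unit_vec n 0)) (\<psi> (unit_vec n 1 + unit_vec n 0)) \<in> carrier_vec (deg (tensor_rep V V))"
      using coherentD(2)[OF assms(2)] by simp
    fix \<nu> w assume "hw_vector n (tensor_rep V V) \<nu> w"
    then interpret coherent_square n N V \<psi> \<nu> w using assms by unfold_locales
    show "kron_vec (\<psi> (unit_vec n 0)) (\<psi> (unit_vec n 1 + unit_vec n 0)) \<bullet>c w \<noteq> 0"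
      using weight_and_detection(1) by (simp add: F_def)
  next
    show "act (tensor_rep V V) b \<in> carrier_mat (deg (tensor_rep V V)) (deg (tensor_rep V V))" for b
      by (simp add: tensor_rep_def)
  qed
  assume "hw_vector n (tensor_rep V V) \<nu> w"
  then interpret coherent_square n N V \<psi> \<nu> w using assms by unfold_locales
  show "\<exists>a\<le>N. \<nu> = int (N + a) # int (N - a) # replicate (n - 2) 0" by (rule weight_and_detection(2))
qed

section \<open>Restriction to the special linear group\<close>

lemma rep_iso_refl:
  assumes "\<And>g. g \<in> G \<Longrightarrow> act V g \<in> carrier_mat (deg V) (deg V)"
    and "deg W = deg V" "\<And>g. g \<in> G \<Longrightarrow> act W g = act V g"
  shows "rep_iso G V W"
proof -
  have "1\<^sub>m (deg V) * act V g = act W g * 1\<^sub>m (deg V)" if "g \<in> G" for g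
    using left_mult_one_mat[OF assms(1)[OF that]] right_mult_one_mat[OF assms(1)[OF that]] assms(3)[OF that]
    by simp
  moreover have "invertible_mat (1\<^sub>m (deg V) :: complex mat)"
    by (rule invertible_mat_inverse[of _ "deg V" "1\<^sub>m (deg V)"]) auto
  ultimately show ?thesis
    unfolding rep_iso_def using assms(2) by (intro conjI bexI[of _ "1\<^sub>m (deg V)"]) auto
qed

lemma rep_iso_subgroup: "rep_iso G V W \<Longrightarrow> H \<subseteq> G \<Longrightarrow> rep_iso H V W"
  unfolding rep_iso_def by blast

lemma is_rep_subgroup: "is_rep n G V \<Longrightarrow> H \<subseteq> G \<Longrightarrow> is_rep n H V"
  unfolding is_rep_def by blast

text \<open>
  Every invertible matrix is a scalar matrix times a matrix of determinant one, and scalar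
  matrices preserve all subspaces.
\<close>

lemma irreducible_rep_SL:
  assumes n: "n \<ge> 1" and V: "star_rep n M V" and irr: "irreducible_rep n (GL n) V"
  shows "irreducible_rep n (SL n) V"
proof -
  have GL_inv: "\<forall>g\<in>GL n. \<forall>w\<in>W. act V g *\<^sub>v w \<in> W"
    if sub: "VectorSpace.subspace class_ring W (module_vec TYPE(complex) (deg V))"
      and inv: "\<forall>g\<in>SL n. \<forall>w\<in>W. act V g *\<^sub>v w \<in> W" for W
  proof (intro ballI)
    fix g w assume g: "g \<in> GL n" and w: "w \<in> W"
    have W: "W \<subseteq> carrier_vec (deg V)" and smult: "\<And>c v. v \<in> W \<Longrightarrow> c \<cdot>\<^sub>v v \<in> W"
      using subspace_imp_lin_subspace[OF sub] by (auto simp: lin_subspace_def)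
    have gc: "g \<in> carrier_mat n n" and d: "det g \<noteq> 0" using g by (auto simp: GL_iff)
    \<comment> \<open>An \<open>n\<close>-th root of the determinant.\<close>
    define c where "c = rcis (root n (cmod (det g))) (Arg (det g) / real n)"
    have "c ^ n = rcis (root n (cmod (det g)) ^ n) (real n * (Arg (det g) / real n))"
      unfolding c_def by (rule DeMoivre2)
    also have "\<dots> = rcis (cmod (det g)) (Arg (det g))" using n by (simp add: real_root_pow_pos2)
    finally have cn: "c ^ n = det g" by (simp only: rcis_cmod_Arg)
    then have c0: "c \<noteq> 0" using d n by (auto simp: zero_power)
    define h where "h = (1 / c) \<cdot>\<^sub>m g"
    have h: "h \<in> SL n" using gc cn c0 d by (simp add: h_def SL_def power_divide)
    then have hG: "h \<in> GL n" using SL_subset_GL by auto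
    have "g = (c \<cdot>\<^sub>m 1\<^sub>m n) * h" unfolding h_def using gc c0
      by (subst mult_smult_assoc_mat[of _ n n _ n]) (auto intro!: eq_matI)
    then have "act V g = act V (c \<cdot>\<^sub>m 1\<^sub>m n) * act V h"
      using is_repD(3)[OF star_repD(1)[OF V] scalar_in_GL[OF c0] hG] by simp
    also have "\<dots> = (c ^ M \<cdot>\<^sub>m 1\<^sub>m (deg V)) * act V h" by (simp only: star_repD(4)[OF V c0])
    also have "\<dots> = c ^ M \<cdot>\<^sub>m act V h"
      using star_repD(2)[OF V hG] by (subst mult_smult_assoc_mat[of _ "deg V" "deg V" _ "deg V"]) auto
    finally have "act V g *\<^sub>v w = c ^ M \<cdot>\<^sub>v (act V h *\<^sub>v w)"
      using star_repD(2)[OF V hG] w W by (intro eq_vecI) auto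
    then show "act V g *\<^sub>v w \<in> W" using inv h w smult by simp
  qed
  show ?thesis
    unfolding irreducible_rep_def
  proof (intro conjI allI impI)
    show "is_rep n (SL n) V" by (rule is_rep_subgroup[OF star_repD(1)[OF V] SL_subset_GL])
    show "0 < deg V" using irr by (simp add: irreducible_rep_def)
    fix W assume "VectorSpace.subspace class_ring W (module_vec TYPE(complex) (deg V))"
      and "\<forall>g\<in>SL n. \<forall>w\<in>W. act V g *\<^sub>v w \<in> W"
    then show "W = {0\<^sub>v (deg V)} \<or> W = carrier_vec (deg V)"
      using GL_inv[of W] irr by (simp add: irreducible_rep_def)
  qed
qed

text \<open>
  Tensoring with a negative power of the determinant: nothing changes on \<open>SL(n)\<close>, while
  \<open>k\<close> is subtracted from all components of a weight.
\<close>

definition det_twist :: "nat \<Rightarrow> rep \<Rightarrow> rep" where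
  "det_twist k V = \<lparr>deg = deg V, act = (\<lambda>g. (1 / det g) ^ k \<cdot>\<^sub>m act V g)\<rparr>"

lemma det_twist_irreducible:
  assumes irr: "irreducible_rep n (GL n) V"
  shows "irreducible_rep n (GL n) (det_twist k V)"
proof -
  have V: "is_rep n (GL n) V" using irr by (simp add: irreducible_rep_def)
  note Vc = is_repD(1)[OF V]
  have "is_rep n (GL n) (det_twist k V)"
    unfolding is_rep_def
  proof (intro conjI ballI allI impI)
    fix g assume g: "g \<in> GL n"
    show "act (det_twist k V) g \<in> carrier_mat (deg (det_twist k V)) (deg (det_twist k V))"
      using Vc[OF g] by (simp add: det_twist_def)
    fix h assume h: "h \<in> GL n"
    have "det (g * h) = det g * det h" using g h by (auto simp: GL_iff det_mult)
    then have "act (det_twist k V) (g * h) = ((1 / det g) ^ k * (1 / det h) ^ k) \<cdot>\<^sub>m (act V g * act V h)"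
      using is_repD(3)[OF V g h] by (simp add: det_twist_def power_mult_distrib power_divide)
    also have "\<dots> = ((1 / det g) ^ k \<cdot>\<^sub>m act V g) * ((1 / det h) ^ k \<cdot>\<^sub>m act V h)"
    proof -
      have hc: "(1 / det h) ^ k \<cdot>\<^sub>m act V h \<in> carrier_mat (deg V) (deg V)" using Vc[OF h] by simp
      show ?thesis
        unfolding mult_smult_assoc_mat[OF Vc[OF g] hc] mult_smult_distrib[OF Vc[OF g] Vc[OF h]]
        by (intro eq_matI) (auto simp: mult.assoc)
    qed
    finally show "act (det_twist k V) (g * h) = act (det_twist k V) g * act (det_twist k V) h"
      by (simp add: det_twist_def)
  next
    show "act (det_twist k V) (1\<^sub>m n) = 1\<^sub>m (deg (det_twist k V))"
      using is_repD(2)[OF V] by (auto simp: det_twist_def intro!: eq_matI)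
  next
    fix i j assume "i < deg (det_twist k V)" "j < deg (det_twist k V)"
    then have ij: "i < deg V" "j < deg V" by (auto simp: det_twist_def)
    obtain f where f: "f \<in> regular_funs n" "\<forall>g\<in>GL n. act V g $$ (i, j) = f g"
      using is_repD(4)[OF V ij] by blast
    show "\<exists>f\<in>regular_funs n. \<forall>g\<in>GL n. act (det_twist k V) g $$ (i, j) = f g"
    proof (rule bexI)
      show "(\<lambda>g. (1 / det g) ^ k * f g) \<in> regular_funs n"
        by (rule regular_funs.mult[OF regular_funs_power[OF regular_funs.inv_det] f(1)])
      show "\<forall>g\<in>GL n. act (det_twist k V) g $$ (i, j) = (1 / det g) ^ k * f g"
      proof
        fix g assume g: "g \<in> GL n"
        then show "act (det_twist k V) g $$ (i, j) = (1 / det g) ^ k * f g"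
          using f(2) ij carrier_matD[OF Vc[OF g]] by (simp add: det_twist_def)
      qed
    qed
  qed
  moreover have GL_inv: "\<forall>g\<in>GL n. \<forall>w\<in>W. act V g *\<^sub>v w \<in> W"
    if sub: "VectorSpace.subspace class_ring W (module_vec TYPE(complex) (deg V))"
      and inv: "\<forall>g\<in>GL n. \<forall>w\<in>W. act (det_twist k V) g *\<^sub>v w \<in> W" for W
  proof (intro ballI)
    fix g w assume g: "g \<in> GL n" and w: "w \<in> W"
    have W: "W \<subseteq> carrier_vec (deg V)" and smult: "\<And>c v. v \<in> W \<Longrightarrow> c \<cdot>\<^sub>v v \<in> W"
      using subspace_imp_lin_subspace[OF sub] by (auto simp: lin_subspace_def)
    have d: "det g \<noteq> 0" using g by (simp add: GL_iff)
    have "act V g *\<^sub>v w = det g ^ k \<cdot>\<^sub>v (act (det_twist k V) g *\<^sub>v w)"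
      using Vc[OF g] w W d by (intro eq_vecI) (auto simp: det_twist_def power_divide)
    then show "act V g *\<^sub>v w \<in> W" using inv g w smult by simp
  qed
  moreover have "deg (det_twist k V) = deg V" by (simp add: det_twist_def)
  moreover have "0 < deg V" using irr by (simp add: irreducible_rep_def)
  moreover have "W = {0\<^sub>v (deg V)} \<or> W = carrier_vec (deg V)"
    if "VectorSpace.subspace class_ring W (module_vec TYPE(complex) (deg V))"
      and "\<forall>g\<in>GL n. \<forall>w\<in>W. act (det_twist k V) g *\<^sub>v w \<in> W" for W
    using GL_inv[OF that] that(1) irr by (simp add: irreducible_rep_def)
  ultimately show ?thesis by (simp add: irreducible_rep_def)
qed

lemma hw_vector_det_twist:
  assumes w: "hw_vector n V \<nu> w" and Vc: "\<And>g. g \<in> GL n \<Longrightarrow> act V g \<in> carrier_mat (deg V) (deg V)"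
  shows "hw_vector n (det_twist k V) (map (\<lambda>x. x - int k) \<nu>) w"
proof -
  have "act (det_twist k V) b *\<^sub>v w = (\<Prod>i<n. (b $$ (i, i)) powi (map (\<lambda>x. x - int k) \<nu> ! i)) \<cdot>\<^sub>v w"
    if b: "b \<in> borel n" for b
  proof -
    have g: "b \<in> GL n" and bc: "b \<in> carrier_mat n n" and up: "upper_triangular b"
      using b by (auto simp: borel_def GL_iff)
    have "(\<Prod>i<n. (b $$ (i, i)) powi (map (\<lambda>x. x - int k) \<nu> ! i)) =
        (\<Prod>i<n. (b $$ (i, i)) powi (\<nu> ! i) * (1 / b $$ (i, i)) ^ k)"
      using hw_vectorD(3)[OF w] borel_diag_nonzero[OF b]
      by (intro prod.cong) (auto simp: power_int_diff power_divide)
    also have "\<dots> = (1 / det b) ^ k * (\<Prod>i<n. (b $$ (i, i)) powi (\<nu> ! i))"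
      using det_triangular[OF bc] up by (simp add: prod.distrib prod_dividef power_divide prod_power_distrib)
    finally have e: "(\<Prod>i<n. (b $$ (i, i)) powi (map (\<lambda>x. x - int k) \<nu> ! i)) =
        (1 / det b) ^ k * (\<Prod>i<n. (b $$ (i, i)) powi (\<nu> ! i))" .
    have "act (det_twist k V) b *\<^sub>v w = (1 / det b) ^ k \<cdot>\<^sub>v (act V b *\<^sub>v w)"
      using Vc[OF g] hw_vectorD(1)[OF w] by (intro eq_vecI) (auto simp: det_twist_def)
    then show ?thesis unfolding e hw_vectorD(4)[OF w b] by (simp add: smult_smult_assoc)
  qed
  then show ?thesis using hw_vectorD[OF w] by (simp add: hw_vector_def det_twist_def)
qed

lemma hw_vector_imp_highest_weight: "hw_vector n V \<nu> w \<Longrightarrow> has_highest_weight n \<nu> V"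
  unfolding hw_vector_def has_highest_weight_def borel_def by blast

lemma gl_irrepI:
  assumes "dominant n \<nu>" "irreducible_rep n (GL n) V" "hw_vector n V \<nu> w"
  shows "gl_irrep n \<nu> V"
  using assms hw_vector_imp_highest_weight by (auto simp: gl_irrep_def)

lemma sl_irrepI:
  assumes n: "n \<ge> 1" and dom: "dominant n \<nu>" "last \<nu> \<ge> 0"
    and V: "star_rep n M V" "irreducible_rep n (GL n) V" "hw_vector n V \<nu> w"
  shows "sl_irrep n (map (\<lambda>x. x - last \<nu>) \<nu>) V"
proof -
  define k where "k = nat (last \<nu>)"
  have k: "last \<nu> = int k" using dom by (simp add: k_def)
  have "\<nu> \<noteq> []" using n dom by (auto simp: dominant_def)
  then have last: "last (map (\<lambda>x. x - last \<nu>) \<nu>) = 0" by (simp add: last_map)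
  have "dominant n (map (\<lambda>x. x - last \<nu>) \<nu>)"
    using dom by (auto simp: dominant_def sorted_wrt_map)
  then have "gl_irrep n (map (\<lambda>x. x - last \<nu>) \<nu>) (det_twist k V)"
    using det_twist_irreducible[OF V(2)] hw_vector_det_twist[OF V(3) star_repD(2)[OF V(1)], of k]
    unfolding k by (intro gl_irrepI) auto
  moreover have "rep_iso (SL n) V (det_twist k V)"
  proof (rule rep_iso_refl)
    fix g assume g: "g \<in> SL n"
    then show Vg: "act V g \<in> carrier_mat (deg V) (deg V)" using star_repD(2)[OF V(1)] SL_subset_GL by blast
    show "act (det_twist k V) g = act V g"
      using g Vg by (auto simp: det_twist_def SL_def intro!: eq_matI)
  qed (simp add: det_twist_def)
  ultimately show ?thesis
    unfolding sl_irrep_def using last irreducible_rep_SL[OF n V(1,2)] by blast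
qed

section \<open>The saturating sequence\<close>

text \<open>
  Pigeonhole principle for dimensions.
\<close>

lemma big_component_exists:
  assumes iso: "unitary_equiv G T (direct_sum_rep Vs)" and len: "length Vs \<le> K" and pos: "deg T > 0"
  shows "\<exists>U\<in>set Vs. deg T \<le> K * deg U"
proof (rule ccontr)
  assume "\<not> ?thesis"
  then have small: "K * deg U < deg T" if "U \<in> set Vs" for U using that by (meson not_le_imp_less)
  have "deg T = sum_list (map deg Vs)"
    using unitary_equiv_imp_rep_iso[OF iso] by (simp add: rep_iso_def direct_sum_rep_def)
  then have ne: "Vs \<noteq> []" using pos by auto
  then have K: "K > 0" using len by (cases Vs) auto
  have "K * sum_list (map deg Vs) = sum_list (map (\<lambda>U. K * deg U) Vs)" by (simp add: sum_list_const_mult)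
  also have "\<dots> < sum_list (map (\<lambda>U. deg T) Vs)"
    using ne small by (intro sum_list_strict_mono) auto
  also have "\<dots> = length Vs * deg T" by (simp add: sum_list_triv)
  also have "\<dots> \<le> K * deg T" using len by simp
  finally show False using \<open>deg T = sum_list (map deg Vs)\<close> by simp
qed

definition sym_weight :: "nat \<Rightarrow> nat \<Rightarrow> int list" where
  "sym_weight n N = int (Suc N) # replicate (n - 1) 0"

lemma sym_weight_last: "n \<ge> 2 \<Longrightarrow> last (sym_weight n N) = 0"
  by (simp add: sym_weight_def)

lemma sym_weight_hd: "hd (sym_weight n N) = int (Suc N)"
  by (simp add: sym_weight_def)

lemma dominant_sym_weight: "n \<ge> 1 \<Longrightarrow> dominant n (sym_weight n N)"
  by (auto simp: dominant_def sym_weight_def sorted_wrt_iff_nth_less nth_Cons split: nat.split)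

lemma sym_weight_tends_to_infinity: "tends_to_infinity n (sym_weight n)"
proof -
  have inj: "inj (sym_weight n)" by (auto simp: inj_def sym_weight_def)
  have "filterlim (sym_weight n) cofinite sequentially"
    unfolding filterlim_iff cofinite_eq_sequentially[symmetric] eventually_cofinite
  proof (intro allI impI)
    fix P :: "int list \<Rightarrow> bool" assume "finite {\<nu>. \<not> P \<nu>}"
    then have "finite (sym_weight n -` {\<nu>. \<not> P \<nu>})" by (rule finite_vimageI[OF _ inj])
    then show "finite {N. \<not> P (sym_weight n N)}" by (simp add: vimage_def)
  qed
  moreover have "filterlim (\<lambda>N. hd (sym_weight n N) - last (sym_weight n N)) at_top sequentially" if "n \<ge> 2"
  proof -
    have "filterlim (\<lambda>N. int (Suc N)) at_top sequentially"
      using filterlim_compose[OF filterlim_int_sequentially filterlim_Suc] .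
    then show ?thesis by (simp only: sym_weight_hd sym_weight_last[OF that] diff_zero)
  qed
  ultimately show ?thesis
    by (auto simp: tends_to_infinity_def sym_weight_hd sym_weight_last)
qed

text \<open>
  The weights of the components are distinct and among the \<open>N + 1\<close> possible ones, so that there are at
  most \<open>N + 1\<close> components, and one of them is large.
\<close>

lemma square_components:
  assumes n: "n \<ge> 2" and V: "coherent n N V \<psi>"
  shows "\<exists>Vs U \<nu>. (\<forall>U\<in>set Vs. star_rep n (N + N) U \<and> irreducible_rep n (GL n) U) \<and>
     rep_iso (GL n) (tensor_rep V V) (direct_sum_rep Vs) \<and>
     U \<in> set Vs \<and> deg V * deg V \<le> Suc N * deg U \<and>
     dominant n \<nu> \<and> last \<nu> \<ge> 0 \<and> (\<exists>w. hw_vector n U \<nu> w)"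
proof -
  let ?T = "tensor_rep V V"
  note rep = coherentD(1)[OF V]
  have "deg V > 0" using coherent_irreducible(1)[OF _ V] n by (simp add: irreducible_rep_def)
  then have pos: "deg ?T > 0" by simp
  obtain Vs \<nu>s where comps: "list_all2 (\<lambda>U \<nu>. star_rep n (N + N) U \<and> irreducible_rep n (GL n) U \<and>
        (\<exists>w. hw_vector n U \<nu> w)) Vs \<nu>s"
    and iso: "unitary_equiv (GL n) ?T (direct_sum_rep Vs)"
    and hw: "\<forall>\<nu>\<in>set \<nu>s. \<exists>w. hw_vector n ?T \<nu> w" and dist: "orth_free n ?T \<longrightarrow> distinct \<nu>s"
    using decomposition_exists[OF star_rep_tensor_rep[OF rep rep]] by (elim exE conjE)
  have weights: "\<exists>a\<le>N. \<nu> = int (N + a) # int (N - a) # replicate (n - 2) 0" if "\<nu> \<in> set \<nu>s" for \<nu>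
    using hw tensor_square_highest_weights(2)[OF n V] that by blast
  have "length \<nu>s = card (set \<nu>s)"
    using dist tensor_square_highest_weights(1)[OF n V] by (simp add: distinct_card)
  also have "\<dots> \<le> card ((\<lambda>a. int (N + a) # int (N - a) # replicate (n - 2) 0) ` {..N})"
  proof (rule card_mono)
    show "set \<nu>s \<subseteq> (\<lambda>a. int (N + a) # int (N - a) # replicate (n - 2) 0) ` {..N}"
    proof
      fix \<nu> assume "\<nu> \<in> set \<nu>s"
      then obtain a where "a \<le> N" "\<nu> = int (N + a) # int (N - a) # replicate (n - 2) 0"
        using weights by blast
      then show "\<nu> \<in> (\<lambda>a. int (N + a) # int (N - a) # replicate (n - 2) 0) ` {..N}" by (intro image_eqI) auto
    qed
  qed simp
  also have "\<dots> \<le> card {..N}" by (rule card_image_le) simp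
  finally have "length Vs \<le> Suc N" using list_all2_lengthD[OF comps] by simp
  then obtain U where U: "U \<in> set Vs" "deg ?T \<le> Suc N * deg U"
    using big_component_exists[OF iso _ pos] by blast
  then obtain i where i: "i < length Vs" "Vs ! i = U" by (auto simp: in_set_conv_nth)
  have \<nu>: "\<nu>s ! i \<in> set \<nu>s" using i list_all2_lengthD[OF comps] by simp
  obtain w where w: "hw_vector n U (\<nu>s ! i) w" using list_all2_nthD[OF comps i(1)] i(2) by blast
  obtain a where a: "a \<le> N" "\<nu>s ! i = int (N + a) # int (N - a) # replicate (n - 2) 0" using weights[OF \<nu>] by blast
  have "dominant n (\<nu>s ! i)" unfolding a(2) dominant_def
    using n a(1) by (auto simp: sorted_wrt_iff_nth_less nth_Cons split: nat.split)
  moreover have "last (\<nu>s ! i) \<ge> 0" unfolding a(2) by simp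
  moreover have "\<forall>U\<in>set Vs. star_rep n (N + N) U \<and> irreducible_rep n (GL n) U"
    using comps by (auto simp: list_all2_conv_all_nth in_set_conv_nth)
  ultimately show ?thesis
    using U w unitary_equiv_imp_rep_iso[OF iso] by (intro exI[of _ Vs] exI[of _ U] exI[of _ "\<nu>s ! i"]) auto
qed

text \<open>
  The constant \<open>1 / (4 C)\<close> combines \<open>N + 2 \<le> 2 (N + 1)\<close> with the two equal terms on the
  right-hand side.
\<close>

lemma ratio_bound:
  fixes d u m N :: nat and C :: real
  assumes "d * d \<le> Suc (Suc N) * u" "d > 0" "m \<ge> 1" "C > 0"
  shows "real m * real u / (real d * real d) \<ge>
    1 / (4 * C) * (C * (1 / real_of_int (int (Suc N)) + 1 / real_of_int (int (Suc N))))"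
proof -
  have "real (d * d) \<le> real (Suc (Suc N) * u)" using assms(1) by (rule of_nat_mono)
  also have "\<dots> \<le> 2 * real (Suc N) * real u"
    by (simp add: mult_right_mono distrib_right)
  also have "\<dots> \<le> 2 * real (Suc N) * (real m * real u)"
    using assms(3) by (intro mult_left_mono) (auto simp: mult_le_cancel_right1)
  finally have "real d * real d \<le> 2 * real (Suc N) * (real m * real u)" by simp
  then have "1 / (2 * real (Suc N)) \<le> real m * real u / (real d * real d)"
    using assms(2) by (simp add: divide_simps mult_ac)
  moreover have "1 / (4 * C) * (C * (1 / real_of_int (int (Suc N)) + 1 / real_of_int (int (Suc N)))) = 1 / (2 * real (Suc N))"
    using assms(4) by (simp add: field_simps)
  ultimately show ?thesis by simp
qed

theorem proposition6p1:
  fixes n :: nat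
  assumes "n \<ge> 1"
  shows
    "(\<exists>(lam :: nat \<Rightarrow> int list) (mu :: nat \<Rightarrow> int list) (V :: nat \<Rightarrow> rep) (W :: nat \<Rightarrow> rep).
        (\<forall>N. gl_irrep n (lam N) (V N) \<and> gl_irrep n (mu N) (W N)) \<and>
        tends_to_infinity n lam \<and> tends_to_infinity n mu \<and>
        (\<forall>C::real. C > 0 \<longrightarrow>
          (\<exists>c::real. c > 0 \<and>
            (\<forall>N. \<exists>nu U m.
               gl_irrep n nu U \<and>
               has_multiplicity n (GL n) U (tensor_rep (V N) (W N)) m \<and>
               real m * real (deg U) / (real (deg (V N)) * real (deg (W N))) \<ge>
                 c * (C * (1 / real_of_int (hd (lam N) - last (lam N)) +
                           1 / real_of_int (hd (mu N) - last (mu N)))))))) \<and>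
     (n \<ge> 2 \<longrightarrow>
      (\<exists>(lam :: nat \<Rightarrow> int list) (mu :: nat \<Rightarrow> int list) (V :: nat \<Rightarrow> rep) (W :: nat \<Rightarrow> rep).
        (\<forall>N. sl_irrep n (lam N) (V N) \<and> sl_irrep n (mu N) (W N)) \<and>
        tends_to_infinity n lam \<and> tends_to_infinity n mu \<and>
        (\<forall>C::real. C > 0 \<longrightarrow>
          (\<exists>c::real. c > 0 \<and>
            (\<forall>N. \<exists>nu U m.
               sl_irrep n nu U \<and>
               has_multiplicity n (SL n) U (tensor_rep (V N) (W N)) m \<and> m \<ge> 1 \<and>
               real (deg U) / (real (deg (V N)) * real (deg (W N))) \<ge>
                 c * (C * (1 / real_of_int (hd (lam N)) +
                           1 / real_of_int (hd (mu N)))))))))"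
proof -
  have "\<forall>N. \<exists>V. \<exists>\<psi>. coherent n (Suc N) V \<psi>" using coherent_exists[OF assms] by blast
  then obtain V where "\<forall>N. \<exists>\<psi>. coherent n (Suc N) (V N) \<psi>" by (auto dest!: choice)
  then obtain \<psi> where V: "\<And>N. coherent n (Suc N) (V N) (\<psi> N)" by (auto dest!: choice)
  note rep = coherentD(1)[OF V] and irr = coherent_irreducible(1)[OF assms V]
  have hw: "\<exists>w. hw_vector n (V N) (sym_weight n N) w" for N
    using coherent_irreducible(2)[OF assms V[of N]] by (simp add: sym_weight_def)
  have gl: "gl_irrep n (sym_weight n N) (V N)" for N
    using hw[of N] gl_irrepI[OF dominant_sym_weight[OF assms] irr] by blast
  have pos: "deg (V N) > 0" for N using irr[of N] by (simp add: irreducible_rep_def)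

  have GL_part: "\<exists>c>0. \<forall>N. \<exists>nu U m. gl_irrep n nu U \<and>
      has_multiplicity n (GL n) U (tensor_rep (V N) (V N)) m \<and>
      real m * real (deg U) / (real (deg (V N)) * real (deg (V N))) \<ge>
        c * (C * (1 / real_of_int (hd (sym_weight n N) - last (sym_weight n N)) +
                  1 / real_of_int (hd (sym_weight n N) - last (sym_weight n N))))"
    if C: "C > 0" for C :: real
  proof (cases "n = 1")
    case True
    have "\<exists>nu U m. gl_irrep n nu U \<and>
      has_multiplicity n (GL n) U (tensor_rep (V N) (V N)) m \<and>
      real m * real (deg U) / (real (deg (V N)) * real (deg (V N))) \<ge>
        1 * (C * (1 / real_of_int (hd (sym_weight n N) - last (sym_weight n N)) +
                  1 / real_of_int (hd (sym_weight n N) - last (sym_weight n N))))" for N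
    \<comment> \<open>The gap is zero and the bound is trivial, but a decomposition is still needed to have a multiplicity.\<close>
    proof -
      obtain Vs \<nu>s where comps: "list_all2 (\<lambda>U \<nu>. star_rep n (Suc N + Suc N) U \<and>
          irreducible_rep n (GL n) U \<and> (\<exists>w. hw_vector n U \<nu> w)) Vs \<nu>s"
        and iso: "unitary_equiv (GL n) (tensor_rep (V N) (V N)) (direct_sum_rep Vs)"
        using decomposition_exists[OF star_rep_tensor_rep[OF rep[of N] rep[of N]]] by (elim exE conjE)
      have "\<forall>U\<in>set Vs. irreducible_rep n (GL n) U"
        using comps by (auto simp: list_all2_conv_all_nth in_set_conv_nth)
      then have "has_multiplicity n (GL n) (V N) (tensor_rep (V N) (V N))
          (length (filter (rep_iso (GL n) (V N)) Vs))"
        unfolding has_multiplicity_def using unitary_equiv_imp_rep_iso[OF iso] by blast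
      moreover have "hd (sym_weight n N) - last (sym_weight n N) = 0"
        using True by (simp add: sym_weight_def)
      ultimately show ?thesis
        using gl[of N] by (intro exI[of _ "sym_weight n N"] exI[of _ "V N"] exI conjI) auto
    qed
    then show ?thesis by (intro exI[of _ 1]) simp
  next
    case False
    then have n: "n \<ge> 2" using assms by simp
    have "\<exists>nu U m. gl_irrep n nu U \<and>
      has_multiplicity n (GL n) U (tensor_rep (V N) (V N)) m \<and>
      real m * real (deg U) / (real (deg (V N)) * real (deg (V N))) \<ge>
        1 / (4 * C) * (C * (1 / real_of_int (hd (sym_weight n N) - last (sym_weight n N)) +
                  1 / real_of_int (hd (sym_weight n N) - last (sym_weight n N))))" for N
    proof -
      obtain Vs U \<nu> w where Vs: "\<forall>U\<in>set Vs. star_rep n (Suc N + Suc N) U \<and> irreducible_rep n (GL n) U"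
        and iso: "rep_iso (GL n) (tensor_rep (V N) (V N)) (direct_sum_rep Vs)"
        and U: "U \<in> set Vs" "deg (V N) * deg (V N) \<le> Suc (Suc N) * deg U"
        and \<nu>: "dominant n \<nu>" "last \<nu> \<ge> 0" "hw_vector n U \<nu> w"
        using square_components[OF n V[of N]] by (elim exE conjE)
      define m where "m = length (filter (rep_iso (GL n) U) Vs)"
      have Us: "star_rep n (Suc N + Suc N) U" and Ui: "irreducible_rep n (GL n) U" using Vs U(1) by auto
      have "rep_iso (GL n) U U"
      proof (rule rep_iso_refl)
        fix g assume "g \<in> GL n"
        then show "act U g \<in> carrier_mat (deg U) (deg U)" using star_repD(2)[OF Us] SL_subset_GL by blast
      qed simp_all
      then have "U \<in> set (filter (rep_iso (GL n) U) Vs)" using U(1) by simp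
      then have "m > 0" unfolding m_def by (rule length_pos_if_in_set)
      then have m: "m \<ge> 1" by simp
      have "has_multiplicity n (GL n) U (tensor_rep (V N) (V N)) m"
        unfolding has_multiplicity_def m_def using Vs iso by blast
      moreover have "gl_irrep n \<nu> U" by (rule gl_irrepI[OF \<nu>(1) Ui \<nu>(3)])
      ultimately show ?thesis
        using ratio_bound[OF U(2) pos m C] unfolding sym_weight_hd sym_weight_last[OF n] diff_zero by blast
    qed
    then show ?thesis using C by (intro exI[of _ "1 / (4 * C)"]) auto
  qed

  have SL_part: "sl_irrep n (sym_weight n N) (V N) \<and>
      (\<exists>nu U m. sl_irrep n nu U \<and> has_multiplicity n (SL n) U (tensor_rep (V N) (V N)) m \<and> m \<ge> 1 \<and>
      real (deg U) / (real (deg (V N)) * real (deg (V N))) \<ge>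
        1 / (4 * C) * (C * (1 / real_of_int (hd (sym_weight n N)) + 1 / real_of_int (hd (sym_weight n N)))))"
    if n: "n \<ge> 2" and C: "C > 0" for N and C :: real
  proof
    have "last (sym_weight n N) \<ge> 0" "map (\<lambda>x. x - last (sym_weight n N)) (sym_weight n N) = sym_weight n N"
      by (simp_all add: sym_weight_last[OF n])
    then show "sl_irrep n (sym_weight n N) (V N)"
      using sl_irrepI[OF assms dominant_sym_weight[OF assms] _ rep irr, of N] hw[of N] by auto
    obtain Vs U \<nu> w where Vs: "\<forall>U\<in>set Vs. star_rep n (Suc N + Suc N) U \<and> irreducible_rep n (GL n) U"
      and iso: "rep_iso (GL n) (tensor_rep (V N) (V N)) (direct_sum_rep Vs)"
      and U: "U \<in> set Vs" "deg (V N) * deg (V N) \<le> Suc (Suc N) * deg U"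
      and \<nu>: "dominant n \<nu>" "last \<nu> \<ge> 0" "hw_vector n U \<nu> w"
      using square_components[OF n V[of N]] by (elim exE conjE)
    define m where "m = length (filter (rep_iso (SL n) U) Vs)"
    have Us: "star_rep n (Suc N + Suc N) U" and Ui: "irreducible_rep n (GL n) U" using Vs U(1) by auto
    have "rep_iso (SL n) U U"
    proof (rule rep_iso_refl)
      fix g assume "g \<in> SL n"
      then show "act U g \<in> carrier_mat (deg U) (deg U)" using star_repD(2)[OF Us] SL_subset_GL by blast
    qed simp_all
    then have "U \<in> set (filter (rep_iso (SL n) U) Vs)" using U(1) by simp
    then have "m > 0" unfolding m_def by (rule length_pos_if_in_set)
      then have m: "m \<ge> 1" by simp
    have "has_multiplicity n (SL n) U (tensor_rep (V N) (V N)) m"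
      unfolding has_multiplicity_def m_def
      using Vs irreducible_rep_SL[OF assms] rep_iso_subgroup[OF iso SL_subset_GL] by blast
    moreover have "sl_irrep n (map (\<lambda>x. x - last \<nu>) \<nu>) U"
      by (rule sl_irrepI[OF assms \<nu>(1,2) Us Ui \<nu>(3)])
    moreover have "real (deg U) / (real (deg (V N)) * real (deg (V N))) \<ge>
        1 / (4 * C) * (C * (1 / real_of_int (hd (sym_weight n N)) + 1 / real_of_int (hd (sym_weight n N))))"
      using ratio_bound[OF U(2) pos order_refl C] unfolding sym_weight_hd by simp
    ultimately show "\<exists>nu U m. sl_irrep n nu U \<and> has_multiplicity n (SL n) U (tensor_rep (V N) (V N)) m \<and> m \<ge> 1 \<and>
      real (deg U) / (real (deg (V N)) * real (deg (V N))) \<ge>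
        1 / (4 * C) * (C * (1 / real_of_int (hd (sym_weight n N)) + 1 / real_of_int (hd (sym_weight n N))))"
      using m by blast
  qed

  show ?thesis
  proof (intro conjI impI)
    show "\<exists>(lam :: nat \<Rightarrow> int list) (mu :: nat \<Rightarrow> int list) (V :: nat \<Rightarrow> rep) (W :: nat \<Rightarrow> rep).
        (\<forall>N. gl_irrep n (lam N) (V N) \<and> gl_irrep n (mu N) (W N)) \<and>
        tends_to_infinity n lam \<and> tends_to_infinity n mu \<and>
        (\<forall>C::real. C > 0 \<longrightarrow>
          (\<exists>c::real. c > 0 \<and>
            (\<forall>N. \<exists>nu U m.
               gl_irrep n nu U \<and>
               has_multiplicity n (GL n) U (tensor_rep (V N) (W N)) m \<and>
               real m * real (deg U) / (real (deg (V N)) * real (deg (W N))) \<ge>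
                 c * (C * (1 / real_of_int (hd (lam N) - last (lam N)) +
                           1 / real_of_int (hd (mu N) - last (mu N)))))))"
      using gl sym_weight_tends_to_infinity GL_part
      by (intro exI[of _ "sym_weight n"] exI[of _ V] conjI allI impI) blast+
    assume n: "n \<ge> 2"
    have "\<exists>c>0. \<forall>N. \<exists>nu U m. sl_irrep n nu U \<and> has_multiplicity n (SL n) U (tensor_rep (V N) (V N)) m \<and> m \<ge> 1 \<and>
      real (deg U) / (real (deg (V N)) * real (deg (V N))) \<ge>
        c * (C * (1 / real_of_int (hd (sym_weight n N)) + 1 / real_of_int (hd (sym_weight n N))))"
      if C: "C > 0" for C :: real
      using SL_part[OF n C] C by (intro exI[of _ "1 / (4 * C)"] conjI) auto
    moreover have "sl_irrep n (sym_weight n N) (V N)" for N using SL_part[OF n, of 1] by simp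
    ultimately show "\<exists>(lam :: nat \<Rightarrow> int list) (mu :: nat \<Rightarrow> int list) (V :: nat \<Rightarrow> rep) (W :: nat \<Rightarrow> rep).
        (\<forall>N. sl_irrep n (lam N) (V N) \<and> sl_irrep n (mu N) (W N)) \<and>
        tends_to_infinity n lam \<and> tends_to_infinity n mu \<and>
        (\<forall>C::real. C > 0 \<longrightarrow>
          (\<exists>c::real. c > 0 \<and>
            (\<forall>N. \<exists>nu U m.
               sl_irrep n nu U \<and>
               has_multiplicity n (SL n) U (tensor_rep (V N) (W N)) m \<and> m \<ge> 1 \<and>
               real (deg U) / (real (deg (V N)) * real (deg (W N))) \<ge>
                 c * (C * (1 / real_of_int (hd (lam N)) +
                           1 / real_of_int (hd (mu N)))))))"
      using sym_weight_tends_to_infinity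
      by (intro exI[of _ "sym_weight n"] exI[of _ V] conjI allI impI) blast+
  qed
qed

end
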